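(* Let $n\ge 1$ and $d\ge 1$ be integers, let $N_d=\binom{n+d}{d}-1$, and let $\mathcal{X}\subset \mathbb{P}^n\times\mathbb{P}^{N_d}$ be the universal family of hypersurfaces of degree $d$ in the complex projective space $\mathbb{P}^n$, with fiber $X_t$ over $t\in\mathbb{P}^{N_d}$. Let $U\subset \mathbb{P}^{N_d}$ be an open set and let $\Phi:\mathbb{C}\times U\to \mathcal{X}$ be a holomorphic map such that $\Phi(\mathbb{C}\times\{t\})\subset X_t$ for all $t\in U$. If $d\ge 2n$, then the rank of $\Phi$ is not maximal at any point of $\mathbb{C}\times U$; that is, at every point of $\mathbb{C}\times U$ the differential of $\Phi$ has rank strictly less than $N_d+1=\dim(\mathbb{C}\times U)$.
   Context: Everything is over $\mathbb{C}$, and open sets are taken in the Euclidean (complex-analytic) topology. Let $Z_0,\dots,Z_n$ be homogeneous coordinates on $\mathbb{P}^n$ and let $(a_\alpha)_{|\alpha|=d}$ be homogeneous coordinates on $\mathbb{P}^{N_d}$, indexed by the multi-indices $\alpha=(\alpha_0,\dots,\alpha_n)\in\mathbb{N}^{n+1}$ with $|\alpha|=\sum_j\alpha_j=d$. The universal family $\mathcal{X}$ is the complex submanifold of $\mathbb{P}^n\times\mathbb{P}^{N_d}$ defined by the equation $\sum_{|\alpha|=d}a_\alpha Z^\alpha=0$, where $Z^\alpha=\prod_j Z_j^{\alpha_j}$. For $t\in\mathbb{P}^{N_d}$, $X_t$ denotes the fiber over $t$ of the projection $\mathcal{X}\to\mathbb{P}^{N_d}$, i.e. the degree $d$ hypersurface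 of $\mathbb{P}^n$ with coefficients $t$, viewed inside $\mathcal{X}$. "$\Phi$ has maximal rank at a point $(z,\xi)$" means that, in local coordinates $\xi_1,\dots,\xi_{N_d}$ on $U$, the element $\frac{\partial\Phi}{\partial z}\wedge\frac{\partial\Phi}{\partial\xi_1}\wedge\dots\wedge\frac{\partial\Phi}{\partial\xi_{N_d}}(z,\xi)$ of $\Lambda^{1+N_d}T_{\mathcal{X},\Phi(z,\xi)}$ is nonzero, i.e. the differential of $\Phi$ at that point has rank $N_d+1$. *)

theory Defs
  imports "HOL-Analysis.Analysis"
begin

section \<open>Complex projective space\<close>

text \<open>
  The homogeneous coordinates are indexed by the finite type \<open>'n\<close>, so \<open>'n proj\<close> is the projective
  space of dimension \<open>CARD('n) - 1\<close>.
\<close>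

definition proj_rel :: "complex ^ 'n \<Rightarrow> complex ^ 'n \<Rightarrow> bool" where
  "proj_rel v w \<longleftrightarrow> v \<noteq> 0 \<and> w \<noteq> 0 \<and> (\<exists>c. c \<noteq> 0 \<and> w = c *s v)"

lemma part_equivp_proj_rel: "part_equivp (proj_rel :: complex ^ 'n \<Rightarrow> complex ^ 'n \<Rightarrow> bool)"
proof (rule part_equivpI)
  have "proj_rel (1 :: complex ^ 'n) 1"
    unfolding proj_rel_def by (auto intro!: exI[of _ 1])
  then show "\<exists>x :: complex ^ 'n. proj_rel x x" ..
  show "symp (proj_rel :: complex ^ 'n \<Rightarrow> complex ^ 'n \<Rightarrow> bool)"
  proof (rule sympI)
    fix v w :: "complex ^ 'n"
    assume "proj_rel v w"
    then obtain c where "v \<noteq> 0" "w \<noteq> 0" "c \<noteq> 0" "w = c *s v"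
      unfolding proj_rel_def by blast
    then show "proj_rel w v"
      unfolding proj_rel_def by (auto intro!: exI[of _ "inverse c"] simp: vector_smult_assoc)
  qed
  show "transp (proj_rel :: complex ^ 'n \<Rightarrow> complex ^ 'n \<Rightarrow> bool)"
  proof (rule transpI)
    fix u v w :: "complex ^ 'n"
    assume "proj_rel u v" "proj_rel v w"
    then obtain c e where "u \<noteq> 0" "w \<noteq> 0" "c \<noteq> 0" "e \<noteq> 0" "v = c *s u" "w = e *s v"
      unfolding proj_rel_def by blast
    then show "proj_rel u w"
      unfolding proj_rel_def by (auto intro!: exI[of _ "e * c"] simp: vector_smult_assoc)
  qed
qed

quotient_type 'n proj = "complex ^ ('n::finite)" / partial: proj_rel
  by (rule part_equivp_proj_rel)

text \<open>The Euclidean topology, as the quotient topology from the punctured vector space.\<close>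

instantiation proj :: (finite) topological_space
begin

definition open_proj :: "'a proj set \<Rightarrow> bool" where
  "open_proj U \<longleftrightarrow> open {v. v \<noteq> 0 \<and> abs_proj v \<in> U}"

instance
proof
  have "{v :: complex ^ 'a. v \<noteq> 0} = - {0}" by auto
  then show "open (UNIV :: 'a proj set)"
    unfolding open_proj_def by (simp add: open_Compl)
next
  fix S T :: "'a proj set"
  assume "open S" "open T"
  moreover have "{v. v \<noteq> 0 \<and> abs_proj v \<in> S \<inter> T} =
      {v. v \<noteq> 0 \<and> abs_proj v \<in> S} \<inter> {v. v \<noteq> 0 \<and> abs_proj v \<in> T}" by auto
  ultimately show "open (S \<inter> T)"
    unfolding open_proj_def by (simp add: open_Int)
next
  fix K :: "'a proj set set"
  assume "\<forall>S\<in>K. open S"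
  moreover have "{v. v \<noteq> 0 \<and> abs_proj v \<in> \<Union>K} = (\<Union>S\<in>K. {v. v \<noteq> 0 \<and> abs_proj v \<in> S})" by auto
  ultimately show "open (\<Union>K)"
    unfolding open_proj_def by (simp add: open_UN)
qed

end

lift_definition coord_nonzero :: "'n::finite \<Rightarrow> 'n proj \<Rightarrow> bool"
  is "\<lambda>i v. v $ i \<noteq> 0"
  by (auto simp: proj_rel_def)

text \<open>
  The affine coordinates on the open set where the homogeneous coordinate \<open>i\<close> does not vanish. The
  chart is written with all of the quotients \<open>Z\<^sub>l / Z\<^sub>i\<close>; the one with \<open>l = i\<close> is the
  constant \<open>1\<close>.
\<close>

lift_definition aff_coord :: "'n::finite \<Rightarrow> 'n proj \<Rightarrow> complex ^ 'n"
  is "\<lambda>i v. \<chi> l. v $ l / v $ i"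
  by (auto simp: proj_rel_def vec_eq_iff)

text \<open>
  The inverse of that chart. The entry \<open>w $ i\<close> is a dummy variable: it is overwritten by \<open>1\<close>.
\<close>

definition aff_point :: "'n::finite \<Rightarrow> complex ^ 'n \<Rightarrow> 'n proj" where
  "aff_point i w = abs_proj (\<chi> l. if l = i then 1 else w $ l)"

lemma coord_nonzero_exists: "\<exists>i. coord_nonzero i p"
  by transfer (auto simp: proj_rel_def vec_eq_iff)

lemma aff_point_aff_coord:
  assumes "coord_nonzero i p"
  shows "aff_point i (aff_coord i p) = p"
proof -
  obtain v where v: "p = abs_proj v" "proj_rel v v"
    using Quotient3_abs_rep[OF Quotient3_proj] Quotient3_rep_reflp[OF Quotient3_proj] by metis
  have vi: "v $ i \<noteq> 0"
    using assms v by (simp add: coord_nonzero.abs_eq)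
  have "proj_rel v (\<chi> l. if l = i then 1 else v $ l / v $ i)"
    unfolding proj_rel_def using v vi
    by (auto simp: proj_rel_def vec_eq_iff divide_inverse mult.commute intro!: exI[of _ "inverse (v $ i)"])
  then have "abs_proj v = abs_proj (\<chi> l. if l = i then 1 else v $ l / v $ i)"
    using Quotient3_rel_abs[OF Quotient3_proj] by metis
  moreover have "aff_coord i p = (\<chi> l. v $ l / v $ i)"
    using v by (simp add: aff_coord.abs_eq)
  ultimately show ?thesis
    using v(1) by (simp add: aff_point_def cong: if_cong)
qed


section \<open>Holomorphic maps and the rank of the differential\<close>

text \<open>
  The expression of \<open>\<Phi>\<close> in the affine charts given by \<open>j\<close> on the source and by \<open>i\<close>, \<open>k\<close> on the two
  factors of the target.
\<close>

definition local_expr ::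
  "'m::finite \<Rightarrow> 'n::finite \<Rightarrow> 'k::finite \<Rightarrow> (complex \<times> 'm proj \<Rightarrow> 'n proj \<times> 'k proj) \<Rightarrow>
    complex \<times> (complex ^ 'm) \<Rightarrow> complex ^ ('n + 'k)" where
  "local_expr j i k \<Phi> = (\<lambda>(z, w). \<chi> s. case s of
      Inl l \<Rightarrow> aff_coord i (fst (\<Phi> (z, aff_point j w))) $ l
    | Inr l \<Rightarrow> aff_coord k (snd (\<Phi> (z, aff_point j w))) $ l)"

definition charts_at ::
  "'m::finite \<Rightarrow> 'n::finite \<Rightarrow> 'k::finite \<Rightarrow> (complex \<times> 'm proj \<Rightarrow> 'n proj \<times> 'k proj) \<Rightarrow>
    complex \<Rightarrow> 'm proj \<Rightarrow> bool" where
  "charts_at j i k \<Phi> z t \<longleftrightarrow>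
    coord_nonzero j t \<and> coord_nonzero i (fst (\<Phi> (z, t))) \<and> coord_nonzero k (snd (\<Phi> (z, t)))"

definition complex_differentiable_at ::
  "(complex \<times> (complex ^ 'm) \<Rightarrow> complex ^ 'l) \<Rightarrow> complex \<times> (complex ^ 'm) \<Rightarrow> bool" where
  "complex_differentiable_at F x \<longleftrightarrow>
    (\<exists>D. (F has_derivative D) (at x) \<and> (\<forall>c z w. D (c * z, c *s w) = c *s D (z, w)))"

text \<open>
  This is meant for open \<open>W\<close>. Continuity ensures that the local expressions only
  involve values inside the chosen charts near the point considered.
\<close>

definition holomorphic_map_on ::
  "(complex \<times> 'm::finite proj \<Rightarrow> 'n::finite proj \<times> 'k::finite proj) \<Rightarrow>
    (complex \<times> 'm proj) set \<Rightarrow> bool" where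
  "holomorphic_map_on \<Phi> W \<longleftrightarrow> continuous_on W \<Phi> \<and>
    (\<forall>(z, t) \<in> W. \<forall>j i k. charts_at j i k \<Phi> z t \<longrightarrow>
      complex_differentiable_at (local_expr j i k \<Phi>) (z, aff_coord j t))"

text \<open>
  The complex dimension of the image of the differential of \<open>\<Phi>\<close> at \<open>(z, t)\<close>, read in charts. The
  dummy variable \<open>w $ j\<close> contributes nothing to the image, because the local expression does not
  depend on it. When \<open>\<Phi>\<close> takes values in a submanifold of the target, the tangent space
  of the submanifold is a subspace of that of the product, so the rank is the same.
\<close>

definition differential_rank ::
  "'m::finite \<Rightarrow> 'n::finite \<Rightarrow> 'k::finite \<Rightarrow> (complex \<times> 'm proj \<Rightarrow> 'n proj \<times> 'k proj) \<Rightarrow>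
    complex \<Rightarrow> 'm proj \<Rightarrow> nat" where
  "differential_rank j i k \<Phi> z t =
    vec.dim (range (frechet_derivative (local_expr j i k \<Phi>) (at (z, aff_coord j t))))"


section \<open>The universal family of hypersurfaces\<close>

text \<open>Multi-indices \<open>\<alpha>\<close> with \<open>\<bar>\<alpha>\<bar> = d\<close>, where \<open>d = CARD('d)\<close>.\<close>

typedef ('n, 'd) multi_index = "{\<alpha> :: 'n::finite \<Rightarrow> nat. (\<Sum>i\<in>UNIV. \<alpha> i) = CARD('d::finite)}"
  morphisms exponent Abs_multi_index
proof
  show "(\<lambda>i. if i = undefined then CARD('d) else 0) \<in>
      {\<alpha> :: 'n \<Rightarrow> nat. (\<Sum>i\<in>UNIV. \<alpha> i) = CARD('d)}" by simp
qed

lemma sum_exponent: "(\<Sum>i\<in>UNIV. exponent (\<alpha> :: ('n::finite, 'd::finite) multi_index) i) = CARD('d)"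
  using exponent[of \<alpha>] by simp

lemma bij_betw_funs_lists:
  assumes "distinct xs" "set xs = (UNIV :: 'n::finite set)"
  shows "bij_betw (\<lambda>\<alpha>. map \<alpha> xs) {\<alpha> :: 'n \<Rightarrow> nat. (\<Sum>i\<in>UNIV. \<alpha> i) = d}
    {l. length l = CARD('n) \<and> sum_list l = d}"
proof -
  have len: "length xs = CARD('n)"
    using assms distinct_card by fastforce
  have sum: "sum_list (map \<alpha> xs) = (\<Sum>i\<in>UNIV. \<alpha> i)" for \<alpha> :: "'n \<Rightarrow> nat"
    using assms sum_list_distinct_conv_sum_set by metis
  show ?thesis
  proof (rule bij_betw_imageI)
    show "inj_on (\<lambda>\<alpha>. map \<alpha> xs) {\<alpha> :: 'n \<Rightarrow> nat. (\<Sum>i\<in>UNIV. \<alpha> i) = d}"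
      using assms by (auto simp: inj_on_def fun_eq_iff)
    show "(\<lambda>\<alpha>. map \<alpha> xs) ` {\<alpha> :: 'n \<Rightarrow> nat. (\<Sum>i\<in>UNIV. \<alpha> i) = d} =
        {l. length l = CARD('n) \<and> sum_list l = d}"
    proof (intro equalityI subsetI)
      fix l :: "nat list"
      assume l: "l \<in> {l. length l = CARD('n) \<and> sum_list l = d}"
      define \<alpha> where "\<alpha> = (\<lambda>x. the (map_of (zip xs l) x))"
      have m: "map \<alpha> xs = l"
      proof (rule nth_equalityI)
        show "length (map \<alpha> xs) = length l" using l len by simp
        fix p assume "p < length (map \<alpha> xs)"
        then show "map \<alpha> xs ! p = l ! p"
          using l len assms(1) by (simp add: \<alpha>_def map_of_zip_nth)
      qed
      then show "l \<in> (\<lambda>\<alpha>. map \<alpha> xs) ` {\<alpha> :: 'n \<Rightarrow> nat. (\<Sum>i\<in>UNIV. \<alpha> i) = d}"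
        using l sum[of \<alpha>] by auto
    qed (use len sum in auto)
  qed
qed

lemma multi_index_bij:
  "bij_betw exponent (UNIV :: ('n::finite, 'd::finite) multi_index set)
    {\<alpha> :: 'n \<Rightarrow> nat. (\<Sum>i\<in>UNIV. \<alpha> i) = CARD('d)}"
  using type_definition.Rep_range[OF type_definition_multi_index]
  by (auto simp: bij_betw_def inj_on_def exponent_inject)

instance multi_index :: (finite, finite) finite
proof
  have "{\<alpha> :: 'a \<Rightarrow> nat. (\<Sum>i\<in>UNIV. \<alpha> i) = CARD('b)} \<subseteq> PiE UNIV (\<lambda>_. {..CARD('b)})"
    by (auto simp: PiE_UNIV_domain, metis finite_class.finite_UNIV iso_tuple_UNIV_I member_le_sum zero_le)
  then have "finite {\<alpha> :: 'a \<Rightarrow> nat. (\<Sum>i\<in>UNIV. \<alpha> i) = CARD('b)}"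
    by (rule finite_subset) (auto intro: finite_PiE)
  then show "finite (UNIV :: ('a, 'b) multi_index set)"
    using bij_betw_finite[OF multi_index_bij] by blast
qed

lemma card_multi_index:
  assumes "CARD('n::finite) = n + 1"
  shows "CARD(('n, 'd::finite) multi_index) = (n + CARD('d)) choose CARD('d)"
proof -
  obtain xs where xs: "distinct xs" "set xs = (UNIV :: 'n set)"
    using finite_distinct_list[OF finite_class.finite_UNIV] by blast
  have "CARD(('n, 'd) multi_index) = card {l :: nat list. length l = CARD('n) \<and> sum_list l = CARD('d)}"
    using bij_betw_same_card[OF multi_index_bij[where 'n='n and 'd='d]]
      bij_betw_same_card[OF bij_betw_funs_lists[OF xs]] by simp
  then show ?thesis
    using assms by (simp add: card_length_sum_list add.commute)
qed

definition hypersurface_eq :: "complex ^ ('n::finite) \<Rightarrow> complex ^ ('n, 'd::finite) multi_index \<Rightarrow> complex" where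
  "hypersurface_eq Z a = (\<Sum>\<alpha>\<in>UNIV. a $ \<alpha> * (\<Prod>i\<in>UNIV. (Z $ i) ^ exponent \<alpha> i))"

lemma hypersurface_eq_scale:
  "hypersurface_eq (c *s Z) (e *s (a :: complex ^ ('n::finite, 'd::finite) multi_index)) =
    e * c ^ CARD('d) * hypersurface_eq Z a"
proof -
  have "(\<Prod>i\<in>UNIV. (c * Z $ i) ^ exponent \<alpha> i) = c ^ CARD('d) * (\<Prod>i\<in>UNIV. (Z $ i) ^ exponent \<alpha> i)"
    for \<alpha> :: "('n, 'd) multi_index"
    by (simp add: power_mult_distrib prod.distrib power_sum[symmetric] sum_exponent)
  then show ?thesis
    by (simp add: hypersurface_eq_def sum_distrib_left mult_ac)
qed

lift_definition on_hypersurface :: "'n::finite proj \<Rightarrow> ('n, 'd::finite) multi_index proj \<Rightarrow> bool"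
  is "\<lambda>Z a. hypersurface_eq Z a = 0"
  by (auto simp: proj_rel_def hypersurface_eq_scale)

definition universal_family :: "('n::finite proj \<times> ('n, 'd::finite) multi_index proj) set" where
  "universal_family = {(p, t). on_hypersurface p t}"

definition fiber ::
  "('n::finite, 'd::finite) multi_index proj \<Rightarrow> ('n proj \<times> ('n, 'd) multi_index proj) set" where
  "fiber t = {x \<in> universal_family. snd x = t}"

end

theory Submission
  imports Defs "HOL-Complex_Analysis.Cauchy_Integral_Formula"
begin

text \<open>
  Write \<open>\<Phi>(z, t) = (f(z, t), t)\<close>. The rank is maximal exactly where \<open>\<partial>\<^sub>z f \<noteq> 0\<close>. Differentiating the equation \<open>P\<^sub>t(f) = 0\<close> with
  respect to the coefficient \<open>a\<^sub>\<beta>\<close> gives \<open>dP\<^sub>t(\<partial>\<^sub>\<beta> f) = - f\<^sup>\<beta>\<close>, so the curves only meet smooth points of the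
  fibers. The universal family carries enough tangent fields with a pole of order one; projecting
  \<open>n - 2\<close> of them to the fibers along the \<open>\<partial>\<^sub>\<beta> f\<close> yields vectors \<open>W\<^sub>k\<close> for which
  \<open>f \<and> \<partial>\<^sub>z f \<and> W\<^sub>1 \<and> \<dots> \<and> W\<^sub>n\<^sub>-\<^sub>2 = s dP\<^sub>t(f)\<close> with \<open>s\<close> homogeneous of degree \<open>- (d - 2 n + 1) < 0\<close> in the lift of \<open>f\<close>.
  Multiplying \<open>s\<close> by a monomial in \<open>f\<close> gives a holomorphic function \<open>F\<close> with values in the line
  \<open>f\<close>, not zero where \<open>\<partial>\<^sub>z f\<close> is not zero. By the Ahlfors-Schwarz argument, at a maximum of \<open>\<bar>F\<bar>\<^sup>2\<close> times powers
  of the weights \<open>1 - \<bar>x\<^sub>k\<bar>\<^sup>2 / r\<^sub>k\<^sup>2\<close> of a polydisc, \<open>\<partial>\<^sub>k f\<close> is \<open>O(1 / r\<^sub>k)\<close> up to weights,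
  while \<open>F\<close> is a polynomial in these derivatives with a factor \<open>\<partial>\<^sub>z f\<close>. Letting the radius in \<open>z\<close> tend to
  infinity forces \<open>F = 0\<close>.
\<close>

section \<open>A derivative bound at a weighted maximum\<close>

text \<open>The threshold \<open>d \<ge> 2 * n\<close> is a count of weights. If the lift
  \<open>f\<close> is multiplied by \<open>\<mu>\<close>, then, up to multiples of \<open>f\<close>,
  the rows \<open>f\<close>, \<open>\<partial>\<^sub>z f\<close> and one transversal row
  \<open>\<partial>\<^sub>\<beta> f\<close> gain a factor \<open>\<mu>\<close> each, and each of the
  \<open>n - 2\<close> fields gains \<open>\<mu>\<^sup>2\<close>: together \<open>2 * n - 1\<close>
  factors. Dividing by \<open>dP(\<partial>\<^sub>\<beta> f)\<close>, a monomial of degree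
  \<open>d\<close>, leaves the weight \<open>2 * n - 1 - d\<close>. One unit of negative weight is
  spent on the vector \<open>f\<close> itself, because \<open>F\<close> must lie in the line of
  \<open>f\<close>: then quotients of its entries are the affine coordinates of the curve, and a
  maximum of the size of \<open>F\<close> controls the derivatives of the curve. The other
  \<open>d - 2 * n\<close> units are spent on the monomial. The coefficients have to be variables of
  the maximum problem too, since the fields bring in the derivatives
  \<open>\<partial>\<^sub>\<beta> f\<close>. Their radii stay fixed while the radius in
  \<open>z\<close> is arbitrary, so only the factor \<open>\<partial>\<^sub>z f\<close> becomes
  small. In place of a global lift there are lifts with one coordinate equal to 1, and Wronskians,
  which depend on a common factor only through its square.\<close>

lemma four_point_sum:
  fixes a b c :: complex and r :: real
  defines "q \<equiv> \<lambda>h. a + b * h + c * h\<^sup>2"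
  shows "(cmod (q r))\<^sup>2 + (cmod (q (\<i> * r)))\<^sup>2 + (cmod (q (- r)))\<^sup>2 + (cmod (q (- \<i> * r)))\<^sup>2
    = 4 * ((cmod a)\<^sup>2 + r\<^sup>2 * (cmod b)\<^sup>2 + r^4 * (cmod c)\<^sup>2)"
  unfolding q_def cmod_power2 by (simp add: power2_eq_square power4_eq_xxxx) (simp add: algebra_simps)

text \<open>A discrete stand-in for the mean value inequality of a squared modulus: averaging over
  four points of a circle cancels all cross terms of the quadratic Taylor polynomial
  (\<open>four_point_sum\<close>), so only the cubic remainder produces an error.\<close>

lemma four_point_mean_lower_bound:
  fixes g :: "complex \<Rightarrow> complex"
  assumes e: "e > 0" and hol: "g holomorphic_on ball 0 e"
  shows "\<exists>C r0. r0 > 0 \<and> (\<forall>r. 0 < r \<and> r < r0 \<longrightarrow>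
    4 * (cmod (g 0))\<^sup>2 + 4 * r\<^sup>2 * (cmod (deriv g 0))\<^sup>2 - C * r^3
      \<le> (cmod (g (of_real r)))\<^sup>2 + (cmod (g (\<i> * of_real r)))\<^sup>2
        + (cmod (g (- of_real r)))\<^sup>2 + (cmod (g (- \<i> * of_real r)))\<^sup>2)"
proof -
  have hol3: "(deriv ^^ k) g holomorphic_on ball 0 e" for k
    using hol by (intro holomorphic_higher_deriv) auto
  have "continuous_on (cball 0 (e/2)) ((deriv ^^ 3) g)"
    using hol3[of 3] e by (intro holomorphic_on_imp_continuous_on) (auto elim!: holomorphic_on_subset)
  then have "bounded ((deriv ^^ 3) g ` cball 0 (e/2))"
    by (intro compact_imp_bounded compact_continuous_image) auto
  then obtain B where "\<forall>y \<in> (deriv ^^ 3) g ` cball 0 (e/2). cmod y \<le> B"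
    unfolding bounded_iff by blast
  then have B: "\<And>x. x \<in> cball 0 (e/2) \<Longrightarrow> cmod ((deriv ^^ 3) g x) \<le> B" by blast
  have B0: "B \<ge> 0" using B[of 0] e by (auto intro: order_trans[OF norm_ge_zero])
  define a b c where "a = g 0" and "b = deriv g 0" and "c = (deriv ^^ 2) g 0 / 2"
  define q where "q = (\<lambda>h. a + b * h + c * h\<^sup>2)"
  define M where "M = cmod a + cmod b + cmod c"
  have M0: "M \<ge> 0" by (simp add: M_def)
  have taylor: "cmod (g h - q h) \<le> B * cmod h ^ 3" if "cmod h \<le> e/2" for h
  proof -
    have "cmod ((deriv ^^ 0) g h - (\<Sum>i\<le>2. (deriv ^^ i) g 0 * (h - 0) ^ i / fact i)) \<le> B * cmod (h - 0) ^ Suc 2 / fact 2"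
    proof (rule complex_Taylor[where f = "\<lambda>i. (deriv ^^ i) g" and S = "cball 0 (e/2)" and n = 2])
      fix i and x :: complex assume "x \<in> cball 0 (e/2)" 
      then have "x \<in> ball 0 e" using e by auto
      then have "((deriv ^^ i) g has_field_derivative deriv ((deriv ^^ i) g) x) (at x)"
        using hol3[of i] by (auto intro!: holomorphic_derivI)
      then show "((deriv ^^ i) g has_field_derivative (deriv ^^ Suc i) g x) (at x within cball 0 (e/2))"
        by (auto intro: has_field_derivative_at_within)
    qed (use that B e in \<open>auto simp: numeral_3_eq_3\<close>)
    moreover have "(\<Sum>i\<le>2. (deriv ^^ i) g 0 * (h - 0) ^ i / fact i) = q h"
      by (simp add: q_def a_def b_def c_def numeral_2_eq_2)
    moreover have "B * cmod h ^ 3 / 2 \<le> B * cmod h ^ 3" using B0 by simp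
    ultimately show ?thesis by (simp add: numeral_3_eq_3)
  qed
  have lower: "(cmod (q h))\<^sup>2 - 2 * M * B * r^3 \<le> (cmod (g h))\<^sup>2" if h: "cmod h = r" "r \<le> e/2" "r \<le> 1" for h r
  proof -
    have r0: "r \<ge> 0" using h(1) by auto
    have "cmod (q h) \<le> cmod a + cmod b * r + cmod c * r\<^sup>2"
      using h(1) unfolding q_def by (metis norm_triangle_le norm_mult norm_power add_mono order_refl norm_triangle_ineq)
    also have "\<dots> \<le> M"
      unfolding M_def using h r0 by (intro add_mono) (auto intro!: mult_left_le power_le_one)
    finally have qM: "cmod (q h) \<le> M" .
    have R: "cmod (q h) - cmod (g h) \<le> B * r^3"
      using taylor[of h] h norm_triangle_ineq2[of "q h" "g h"] by (simp add: norm_minus_commute)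
    show ?thesis
    proof (cases "cmod (q h) \<le> cmod (g h)")
      case True
      then have "(cmod (q h))\<^sup>2 \<le> (cmod (g h))\<^sup>2" by (intro power_mono) auto
      then show ?thesis using M0 B0 r0 by (smt (verit) mult_nonneg_nonneg zero_le_power)
    next
      case False
      have "(cmod (q h))\<^sup>2 - (cmod (g h))\<^sup>2 = (cmod (q h) - cmod (g h)) * (cmod (q h) + cmod (g h))"
        by (simp add: power2_eq_square algebra_simps)
      also have "\<dots> \<le> (B * r^3) * (2 * M)"
        using False qM R by (intro mult_mono) auto
      finally show ?thesis by (simp add: algebra_simps)
    qed
  qed
  show ?thesis
  \<comment> \<open>Each of the four points loses \<open>2 * M * B * r^3\<close>. The radius bound 1
    is what makes \<open>M\<close> a bound for the Taylor polynomial.\<close>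
  proof (rule exI[of _ "8 * M * B"], rule exI[of _ "min (e/2) 1"], intro conjI allI impI)
    show "min (e/2) 1 > 0" using e by simp
    fix r :: real assume r: "0 < r \<and> r < min (e/2) 1"
    have n: "cmod (of_real r) = r" "cmod (\<i> * of_real r) = r" "cmod (- of_real r) = r" "cmod (- \<i> * of_real r) = r"
      using r by (auto simp: norm_mult)
    note L = lower[OF n(1)] lower[OF n(2)] lower[OF n(3)] lower[OF n(4)]
    have "4 * (cmod a)\<^sup>2 + 4 * r\<^sup>2 * (cmod b)\<^sup>2 \<le> 4 * ((cmod a)\<^sup>2 + r\<^sup>2 * (cmod b)\<^sup>2 + r^4 * (cmod c)\<^sup>2)"
      by simp
    also have "\<dots> = (cmod (q r))\<^sup>2 + (cmod (q (\<i> * r)))\<^sup>2 + (cmod (q (- r)))\<^sup>2 + (cmod (q (- \<i> * r)))\<^sup>2"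
      unfolding q_def using four_point_sum[of a b r c] by simp
    finally show "4 * (cmod (g 0))\<^sup>2 + 4 * r\<^sup>2 * (cmod (deriv g 0))\<^sup>2 - 8 * M * B * r^3
      \<le> (cmod (g (of_real r)))\<^sup>2 + (cmod (g (\<i> * of_real r)))\<^sup>2
        + (cmod (g (- of_real r)))\<^sup>2 + (cmod (g (- \<i> * of_real r)))\<^sup>2"
      using L r unfolding a_def b_def by simp
  qed
qed

text \<open>The second-order condition at a maximum: in the four-point mean the sum of squares gains
  \<open>r\<^sup>2\<close> times the squared derivatives, and the weight has to compensate for this
  with its factor \<open>1 - \<kappa> * r\<^sup>2\<close>. The bound compares the coefficients of
  \<open>r\<^sup>2\<close> as \<open>r\<close> tends to 0.\<close>

lemma derivative_bound_at_weighted_maximum: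
  fixes G :: "'n::finite \<Rightarrow> complex \<Rightarrow> complex"
  assumes e: "e > 0" and hol: "\<And>l. G l holomorphic_on ball 0 e" and "\<kappa> \<ge> 0"
    and bd: "\<And>h. cmod h < e \<Longrightarrow> (\<Sum>l\<in>UNIV. (cmod (G l h))\<^sup>2) * (1 - \<kappa> * (cmod h)\<^sup>2) \<le> (\<Sum>l\<in>UNIV. (cmod (G l 0))\<^sup>2)"
  shows "(\<Sum>l\<in>UNIV. (cmod (deriv (G l) 0))\<^sup>2) \<le> \<kappa> * (\<Sum>l\<in>UNIV. (cmod (G l 0))\<^sup>2)"
proof -
  obtain C r0 where r0: "\<And>l. r0 l > 0" and C: "\<And>l r. 0 < r \<Longrightarrow> r < r0 l \<Longrightarrow>
    4 * (cmod (G l 0))\<^sup>2 + 4 * r\<^sup>2 * (cmod (deriv (G l) 0))\<^sup>2 - C l * r^3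
      \<le> (cmod (G l (of_real r)))\<^sup>2 + (cmod (G l (\<i> * of_real r)))\<^sup>2
        + (cmod (G l (- of_real r)))\<^sup>2 + (cmod (G l (- \<i> * of_real r)))\<^sup>2"
    using four_point_mean_lower_bound[OF e hol] by metis
  define A D S where "A = (\<Sum>l\<in>UNIV. (cmod (G l 0))\<^sup>2)" and "D = (\<Sum>l\<in>UNIV. (cmod (deriv (G l) 0))\<^sup>2)"
    and "S = (\<Sum>l\<in>UNIV. C l)"
  define q where "q = (\<lambda>h. \<Sum>l\<in>UNIV. (cmod (G l h))\<^sup>2)"
  have ev: "\<forall>\<^sub>F r in at_right (0::real). 4 * D - 4 * \<kappa> * A \<le> S * r + 4 * D * \<kappa> * r\<^sup>2 - S * \<kappa> * r^3"
  proof -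
    have E: "\<forall>\<^sub>F r in at_right (0::real). r < r0 l" for l
      using r0[of l] by (auto simp: eventually_at_right)
    have "\<forall>\<^sub>F r in at_right (0::real). \<forall>l\<in>UNIV. r < r0 l"
      using E by (subst eventually_ball_finite_distrib) auto
    moreover have "\<forall>\<^sub>F r in at_right (0::real). r < e"
      using e by (auto simp: eventually_at_right)
    moreover have "\<forall>\<^sub>F r in at_right (0::real). 0 < 1 - \<kappa> * r\<^sup>2"
      by (rule order_tendstoD(1)[of _ 1]) (auto intro!: tendsto_eq_intros)
    moreover have "\<forall>\<^sub>F r in at_right (0::real). r > 0"
      by (rule eventually_at_right_less)
    ultimately show ?thesis
    proof eventually_elim
      case (elim r)
      have "4 * A + 4 * r\<^sup>2 * D - S * r^3
        = (\<Sum>l\<in>UNIV. 4 * (cmod (G l 0))\<^sup>2 + 4 * r\<^sup>2 * (cmod (deriv (G l) 0))\<^sup>2 - C l * r^3)"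
        by (simp add: A_def D_def S_def sum.distrib sum_subtractf sum_distrib_left sum_distrib_right)
      also have "\<dots> \<le> (\<Sum>l\<in>UNIV. (cmod (G l (of_real r)))\<^sup>2 + (cmod (G l (\<i> * of_real r)))\<^sup>2
        + (cmod (G l (- of_real r)))\<^sup>2 + (cmod (G l (- \<i> * of_real r)))\<^sup>2)"
        using elim C by (intro sum_mono) auto
      also have "\<dots> = q (of_real r) + q (\<i> * of_real r) + q (- of_real r) + q (- \<i> * of_real r)"
        by (simp add: q_def sum.distrib)
      finally have "(4 * A + 4 * r\<^sup>2 * D - S * r^3) * (1 - \<kappa> * r\<^sup>2) \<le>
        (q (of_real r) + q (\<i> * of_real r) + q (- of_real r) + q (- \<i> * of_real r)) * (1 - \<kappa> * r\<^sup>2)"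
        using elim by (intro mult_right_mono) auto
      also have "\<dots> \<le> A + A + A + A"
      proof -
        have "q h * (1 - \<kappa> * r\<^sup>2) \<le> A" if "cmod h = r" for h
          using bd[of h] that elim by (simp add: q_def A_def)
        from this[of "of_real r"] this[of "\<i> * of_real r"] this[of "- of_real r"] this[of "- \<i> * of_real r"]
        show ?thesis using elim by (simp add: norm_mult distrib_right)
      qed
      \<comment> \<open>The constant terms \<open>4 * A\<close> cancel, and every remaining term is
        divisible by \<open>r\<^sup>2\<close>.\<close>
      finally have "r\<^sup>2 * (4 * D - 4 * \<kappa> * A) \<le> r\<^sup>2 * (S * r + 4 * D * \<kappa> * r\<^sup>2 - S * \<kappa> * r^3)"
        by (simp add: algebra_simps power2_eq_square power3_eq_cube)
      then show ?case using elim by (simp add: mult_le_cancel_left)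
    qed
  qed
  have "((\<lambda>r. S * r + 4 * D * \<kappa> * r\<^sup>2 - S * \<kappa> * r^3) \<longlongrightarrow> 0) (at_right 0)"
    by (auto intro!: tendsto_eq_intros)
  then have "4 * D - 4 * \<kappa> * A \<le> 0"
    using ev by (rule tendsto_lowerbound) simp
  then show ?thesis by (simp add: A_def D_def)
qed

text \<open>Off the centre of the disc the weight has a first-order term, so the previous lemma does
  not apply directly. Multiplying all entries by one factor \<open>(1 - c * h) ^ p\<close>, equal to
  1 at 0, removes this term and does not change the Wronskians; divided by
  \<open>(g i 0)\<^sup>2\<close> these are the derivatives of the affine coordinates
  \<open>g l / g i\<close>.\<close>

lemma wronskian_bound_at_disc_weighted_maximum:
  fixes g :: "'n::finite \<Rightarrow> complex \<Rightarrow> complex" and \<zeta> :: complex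
  assumes e: "e > 0" and hol: "\<And>l. g l holomorphic_on ball 0 e"
    and r: "r > 0" "cmod \<zeta> < r"
    and bd: "\<And>h. cmod h < e \<Longrightarrow> (\<Sum>l\<in>UNIV. (cmod (g l h))\<^sup>2) * (1 - (cmod (\<zeta> + h))\<^sup>2 / r\<^sup>2) ^ p
       \<le> (\<Sum>l\<in>UNIV. (cmod (g l 0))\<^sup>2) * (1 - (cmod \<zeta>)\<^sup>2 / r\<^sup>2) ^ p"
    and big: "\<And>l. cmod (g l 0) \<le> cmod (g i 0)"
  shows "cmod (deriv (g l) 0 * g i 0 - g l 0 * deriv (g i) 0)
    \<le> 2 * sqrt (2 * p * CARD('n)) / (r * (1 - (cmod \<zeta>)\<^sup>2 / r\<^sup>2)) * (cmod (g i 0))\<^sup>2"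
proof -
  define \<eta> where "\<eta> = 1 - (cmod \<zeta>)\<^sup>2 / r\<^sup>2"
  have \<eta>0: "\<eta> > 0" using r by (simp add: \<eta>_def divide_simps power_strict_mono)
  define c where "c = cnj \<zeta> / (r\<^sup>2 * \<eta>)"
  define K where "K = 1 / (r * \<eta>)\<^sup>2"
  have K0: "K > 0" using r \<eta>0 by (simp add: K_def)
  \<comment> \<open>Completing the square: up to the squared modulus of a holomorphic function, absorbed into \<open>g\<close>, the weight is
    radial in \<open>h\<close>.\<close>
  have key: "1 - (cmod (\<zeta> + h))\<^sup>2 / r\<^sup>2 = \<eta> * ((cmod (1 - c * h))\<^sup>2 - K * (cmod h)\<^sup>2)" for h
  proof -
    have c: "Re c = Re \<zeta> / (r\<^sup>2 * \<eta>)" "Im c = - Im \<zeta> / (r\<^sup>2 * \<eta>)"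
      by (simp_all add: c_def flip: of_real_power of_real_mult)
    have cc: "(Re c)\<^sup>2 + (Im c)\<^sup>2 - K = - 1 / (r\<^sup>2 * \<eta>)"
    proof -
      have "(cmod \<zeta>)\<^sup>2 = r\<^sup>2 * (1 - \<eta>)" using r by (simp add: \<eta>_def)
      then have "(Re \<zeta>)\<^sup>2 + (Im \<zeta>)\<^sup>2 = r\<^sup>2 * (1 - \<eta>)" by (simp add: cmod_power2)
      moreover have "(Re c)\<^sup>2 + (Im c)\<^sup>2 = ((Re \<zeta>)\<^sup>2 + (Im \<zeta>)\<^sup>2) / (r\<^sup>2 * \<eta>)\<^sup>2"
        unfolding c by (simp add: power_divide add_divide_distrib)
      ultimately have "(Re c)\<^sup>2 + (Im c)\<^sup>2 = (1 - \<eta>) / (r\<^sup>2 * \<eta>\<^sup>2)"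
        using r \<eta>0 by (simp add: power2_eq_square)
      then have "(Re c)\<^sup>2 + (Im c)\<^sup>2 - K = (1 - \<eta>) / (r\<^sup>2 * \<eta>\<^sup>2) - 1 / (r\<^sup>2 * \<eta>\<^sup>2)"
        by (simp add: K_def power_mult_distrib)
      also have "\<dots> = - \<eta> / (r\<^sup>2 * \<eta>\<^sup>2)" by (simp add: diff_divide_distrib[symmetric])
      finally show ?thesis using \<eta>0 by (simp add: power2_eq_square)
    qed
    have "(cmod (1 - c * h))\<^sup>2 - K * (cmod h)\<^sup>2
      = 1 - 2 * (Re c * Re h - Im c * Im h) + ((Re c)\<^sup>2 + (Im c)\<^sup>2 - K) * ((Re h)\<^sup>2 + (Im h)\<^sup>2)"
      unfolding cmod_power2 by (simp add: power2_eq_square algebra_simps)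
    also have "\<eta> * \<dots> = \<eta> - 2 * (Re \<zeta> * Re h + Im \<zeta> * Im h) / r\<^sup>2 - ((Re h)\<^sup>2 + (Im h)\<^sup>2) / r\<^sup>2"
      unfolding cc unfolding c using r \<eta>0 by (simp add: field_simps)
    also have "\<dots> = 1 - (cmod (\<zeta> + h))\<^sup>2 / r\<^sup>2"
      unfolding \<eta>_def cmod_power2 using r by (simp add: field_simps power2_eq_square)
    finally show ?thesis by simp
  qed
  define G where "G = (\<lambda>l h. g l h * (1 - c * h) ^ p)"
  define A where "A = (\<Sum>l\<in>UNIV. (cmod (g l 0))\<^sup>2)"
  \<comment> \<open>The second bound gives \<open>cmod (c * h) \<le> 1 / 4\<close>, the third
    \<open>K * (cmod h)\<^sup>2 \<le> 1 / 2\<close>. Together they keep the base in Bernoulli's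
    inequality nonnegative.\<close>
  define e' where "e' = min e (min (1 / (4 * (cmod c + 1))) (sqrt (1 / (2 * K))))"
  have e': "e' > 0" using e K0 by (simp add: e'_def) (smt (verit) norm_ge_zero)
  have G0: "G l 0 = g l 0" for l by (simp add: G_def)
  have holG: "G l holomorphic_on ball 0 e'" for l
  proof -
    have "g l holomorphic_on ball 0 e'"
      by (rule holomorphic_on_subset[OF hol]) (auto simp: e'_def)
    then show ?thesis unfolding G_def by (intro holomorphic_intros)
  qed
  have der: "deriv (g l) 0 * g i 0 - g l 0 * deriv (g i) 0 = deriv (G l) 0 * G i 0 - G l 0 * deriv (G i) 0" for l
  proof -
    have dG: "deriv (G l) 0 = deriv (g l) 0 - of_nat p * c * g l 0" for l
    proof (rule DERIV_imp_deriv)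
      have "(g l has_field_derivative deriv (g l) 0) (at 0)"
        using hol[of l] e by (intro holomorphic_derivI) auto
      then show "(G l has_field_derivative deriv (g l) 0 - of_nat p * c * g l 0) (at 0)"
        unfolding G_def by (auto intro!: derivative_eq_intros)
    qed
    show ?thesis unfolding G0 dG by (simp add: algebra_simps)
  qed
  \<comment> \<open>In the constant \<open>2 * p * K\<close> the factor \<open>p\<close> comes from
    Bernoulli's inequality and the 2 from \<open>u \<ge> 1 / 2\<close>.\<close>
  have main: "(\<Sum>l\<in>UNIV. (cmod (deriv (G l) 0))\<^sup>2) \<le> (2 * real p * K) * (\<Sum>l\<in>UNIV. (cmod (G l 0))\<^sup>2)"
  proof (rule derivative_bound_at_weighted_maximum[OF e' holG])
    show "0 \<le> 2 * real p * K" using K0 by simp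
    fix h assume h: "cmod h < e'"
    define u where "u = (cmod (1 - c * h))\<^sup>2"
    have "cmod (c * h) \<le> (cmod c + 1) * (1 / (4 * (cmod c + 1)))"
      unfolding norm_mult using h by (intro mult_mono) (auto simp: e'_def)
    also have "\<dots> = 1 / 4" by (simp add: field_simps) (smt (verit) norm_ge_zero)
    finally have "cmod (1 - c * h) \<ge> 3/4"
      using norm_triangle_ineq2[of 1 "c * h"] by simp
    then have u: "u \<ge> 1/2" using power_mono[of "3/4" "cmod (1 - c * h)" 2] by (simp add: u_def power2_eq_square)
    have hK: "K * (cmod h)\<^sup>2 \<le> 1/2"
    proof -
      have "cmod h \<le> sqrt (1 / (2 * K))" using h by (simp add: e'_def)
      then have "(cmod h)\<^sup>2 \<le> 1 / (2 * K)" 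
        using K0 by (metis abs_norm_cancel real_sqrt_abs real_sqrt_le_iff)
      then show ?thesis using K0 by (simp add: field_simps)
    qed
    have "1 - 2 * p * K * (cmod h)\<^sup>2 \<le> 1 + p * (- (K * (cmod h)\<^sup>2 / u))"
    proof -
      have "K * (cmod h)\<^sup>2 / u \<le> 2 * (K * (cmod h)\<^sup>2)"
        using divide_left_mono[of "1/2" u "K * (cmod h)\<^sup>2"] u K0 by simp
      then have "p * (K * (cmod h)\<^sup>2 / u) \<le> p * (2 * (K * (cmod h)\<^sup>2))" by (intro mult_left_mono) auto
      then show ?thesis by (simp add: algebra_simps)
    qed
    also have "\<dots> \<le> (1 + (- (K * (cmod h)\<^sup>2 / u))) ^ p"
      using u hK by (intro Bernoulli_inequality) (simp add: divide_simps)
    finally have B: "1 - 2 * p * K * (cmod h)\<^sup>2 \<le> (1 - K * (cmod h)\<^sup>2 / u) ^ p" by simp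
    have "(\<Sum>l\<in>UNIV. (cmod (G l h))\<^sup>2) * (1 - 2 * p * K * (cmod h)\<^sup>2)
       \<le> (\<Sum>l\<in>UNIV. (cmod (G l h))\<^sup>2) * (1 - K * (cmod h)\<^sup>2 / u) ^ p"
      by (intro mult_left_mono B sum_nonneg) auto
    also have "\<dots> = (\<Sum>l\<in>UNIV. (cmod (g l h))\<^sup>2) * (u * (1 - K * (cmod h)\<^sup>2 / u)) ^ p"
      unfolding power_mult_distrib mult.assoc[symmetric] sum_distrib_right
      by (simp add: G_def norm_mult norm_power power_mult_distrib u_def power_mult[symmetric] mult.commute[of 2 p])
    also have "u * (1 - K * (cmod h)\<^sup>2 / u) = u - K * (cmod h)\<^sup>2" using u by (simp add: algebra_simps)
    also have "\<dots> = (1 - (cmod (\<zeta> + h))\<^sup>2 / r\<^sup>2) / \<eta>" using key[of h] \<eta>0 by (simp add: u_def)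
    also have "(\<Sum>l\<in>UNIV. (cmod (g l h))\<^sup>2) * \<dots> ^ p \<le> A"
      using bd[of h] h \<eta>0 by (simp add: e'_def \<eta>_def[symmetric] A_def power_divide pos_divide_le_eq)
    finally show "(\<Sum>l\<in>UNIV. (cmod (G l h))\<^sup>2) * (1 - 2 * real p * K * (cmod h)\<^sup>2) \<le> (\<Sum>l\<in>UNIV. (cmod (G l 0))\<^sup>2)"
      by (simp add: G0 A_def)
  qed
  have dG: "cmod (deriv (G l) 0) \<le> sqrt (2 * p * CARD('n)) / (r * \<eta>) * cmod (g i 0)" for l
  proof -
    have "A \<le> (\<Sum>l\<in>(UNIV::'n set). (cmod (g i 0))\<^sup>2)"
      unfolding A_def using big by (intro sum_mono power_mono) auto
    then have A: "A \<le> CARD('n) * (cmod (g i 0))\<^sup>2" by simp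
    have "(cmod (deriv (G l) 0))\<^sup>2 \<le> (\<Sum>l\<in>UNIV. (cmod (deriv (G l) 0))\<^sup>2)"
      by (rule member_le_sum) auto
    also have "\<dots> \<le> (2 * real p * K) * (CARD('n) * (cmod (g i 0))\<^sup>2)"
      using main A K0 by (simp add: G0 A_def) (meson mult_left_mono mult_nonneg_nonneg of_nat_0_le_iff order_trans less_imp_le zero_le_numeral)
    also have "\<dots> = (sqrt (2 * p * CARD('n)) / (r * \<eta>) * cmod (g i 0))\<^sup>2"
      by (simp add: K_def power_mult_distrib power_divide)
    finally show ?thesis using r \<eta>0 by (auto intro: power2_le_imp_le)
  qed
  have "cmod (deriv (G l) 0 * G i 0 - G l 0 * deriv (G i) 0)
    \<le> cmod (deriv (G l) 0) * cmod (g i 0) + cmod (g l 0) * cmod (deriv (G i) 0)"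
    by (metis G0 norm_mult norm_triangle_ineq4)
  also have "\<dots> \<le> (sqrt (2 * p * CARD('n)) / (r * \<eta>) * cmod (g i 0)) * cmod (g i 0)
      + cmod (g i 0) * (sqrt (2 * p * CARD('n)) / (r * \<eta>) * cmod (g i 0))"
    using dG big by (intro add_mono mult_mono) (auto intro: order_trans[OF norm_ge_zero])
  finally show ?thesis unfolding der \<eta>_def[symmetric] by (simp add: power2_eq_square algebra_simps)
qed

section \<open>Functions holomorphic in each variable\<close>

definition partial_deriv :: "'v::finite \<Rightarrow> (complex ^ 'v \<Rightarrow> complex) \<Rightarrow> complex ^ 'v \<Rightarrow> complex" where
  "partial_deriv k g x = deriv (\<lambda>c. g (x + axis k c)) 0"

text \<open>
  Holomorphy in Osgood's sense, which needs no total derivatives: continuous and holomorphic in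
  each variable separately. It is only used on open sets.
\<close>

definition sep_holomorphic_on :: "(complex ^ 'v::finite \<Rightarrow> complex) \<Rightarrow> (complex ^ 'v) set \<Rightarrow> bool" where
  "sep_holomorphic_on g S \<longleftrightarrow> continuous_on S g \<and>
    (\<forall>x\<in>S. \<forall>k. (\<lambda>c. g (x + axis k c)) field_differentiable at 0)"

lemma axis_add: "axis k (a + b) = axis k a + (axis k b :: 'a::monoid_add ^ 'v::finite)"
  by (simp add: axis_def vec_eq_iff)

lemma axis_zero [simp]: "axis k 0 = (0 :: 'a::zero ^ 'v::finite)"
  by (simp add: axis_def vec_eq_iff)

lemma norm_axis_complex: "norm (axis k c :: complex ^ 'v::finite) = cmod c"
proof -
  have "(\<Sum>i\<in>UNIV. (cmod ((axis k c :: complex ^ 'v) $ i))\<^sup>2) = (\<Sum>i\<in>UNIV. if i = k then (cmod c)\<^sup>2 else 0)"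
    by (rule sum.cong) (auto simp: axis_def)
  then show ?thesis by (simp add: norm_vec_def L2_set_def)
qed

lemma continuous_on_axis [continuous_intros]:
  fixes c :: "'b::topological_space \<Rightarrow> complex"
  assumes "continuous_on T c"
  shows "continuous_on T (\<lambda>y. axis k (c y) :: complex ^ 'v::finite)"
proof -
  have "continuous_on T (\<lambda>y. \<chi> l. if l = k then c y else 0)"
  proof (rule continuous_on_vec_lambda)
    show "continuous_on T (\<lambda>y. if l = k then c y else 0)" for l
      using assms by (cases "l = k") auto
  qed
  then show ?thesis by (simp add: axis_def)
qed

lemma eventually_shift_axis:
  assumes "open S" "x \<in> S"
  shows "\<forall>\<^sub>F c in nhds 0. x + axis k c \<in> (S :: (complex ^ 'v::finite) set)"
proof -
  have "continuous_on UNIV (\<lambda>c. x + axis k c)" by (intro continuous_intros)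
  then have "open ((\<lambda>c. x + axis k c) -` S)"
    using assms(1) by (simp add: continuous_on_open_vimage)
  moreover have "0 \<in> (\<lambda>c. x + axis k c) -` S" using assms by simp
  ultimately show ?thesis unfolding eventually_nhds by blast
qed

lemma sep_holomorphic_onD:
  assumes "sep_holomorphic_on g S" "x \<in> S"
  shows "((\<lambda>c. g (x + axis k c)) has_field_derivative partial_deriv k g x) (at 0)"
  using assms unfolding sep_holomorphic_on_def partial_deriv_def
  by (simp add: DERIV_deriv_iff_field_differentiable)

lemma sep_holomorphic_onD_slice:
  assumes "sep_holomorphic_on g S" "x + axis k c \<in> S"
  shows "((\<lambda>c. g (x + axis k c)) has_field_derivative partial_deriv k g (x + axis k c)) (at c)"
proof -
  have "((\<lambda>h. g (x + axis k (h + c))) has_field_derivative partial_deriv k g (x + axis k c)) (at 0)"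
    using sep_holomorphic_onD[OF assms, of k] by (simp add: axis_add add.assoc add.commute add.left_commute)
  then show ?thesis using DERIV_shift[of "\<lambda>c. g (x + axis k c)" _ 0 c] by simp
qed

lemma sep_holomorphic_on_continuous: "sep_holomorphic_on g S \<Longrightarrow> continuous_on S g"
  by (simp add: sep_holomorphic_on_def)

lemma sep_holomorphic_on_subset: "sep_holomorphic_on g S \<Longrightarrow> T \<subseteq> S \<Longrightarrow> sep_holomorphic_on g T"
  unfolding sep_holomorphic_on_def by (meson continuous_on_subset subsetD)

lemma partial_derivI:
  "((\<lambda>c. g (x + axis k c)) has_field_derivative D) (at 0) \<Longrightarrow> partial_deriv k g x = D"
  unfolding partial_deriv_def by (rule DERIV_imp_deriv)

lemma sep_holomorphic_onI:
  assumes "continuous_on S g" "\<And>x k. x \<in> S \<Longrightarrow> ((\<lambda>c. g (x + axis k c)) has_field_derivative D x k) (at 0)"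
  shows "sep_holomorphic_on g S"
  using assms unfolding sep_holomorphic_on_def field_differentiable_def by blast

lemma partial_deriv_cong:
  assumes "open S" "x \<in> S" "\<And>y. y \<in> S \<Longrightarrow> g y = h y"
  shows "partial_deriv k g x = partial_deriv k h x"
  unfolding partial_deriv_def
  by (rule deriv_cong_ev) (auto intro: eventually_mono[OF eventually_shift_axis[OF assms(1,2)]] assms(3))

lemma sep_holomorphic_on_local:
  assumes "\<And>x. x \<in> S \<Longrightarrow> \<exists>V h. open V \<and> x \<in> V \<and> sep_holomorphic_on h V \<and> (\<forall>y\<in>V. g y = h y)"
  shows "sep_holomorphic_on g S"
  unfolding sep_holomorphic_on_def
proof (intro conjI ballI allI)
  show "continuous_on S g"
  proof (rule continuous_at_imp_continuous_on, rule ballI)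
    fix x assume "x \<in> S"
    then obtain V h where V: "open V" "x \<in> V" "sep_holomorphic_on h V" "\<forall>y\<in>V. g y = h y" using assms by blast
    then have "continuous_on V g"
      using sep_holomorphic_on_continuous continuous_on_cong by metis
    then show "isCont g x" using V continuous_on_eq_continuous_at by blast
  qed
  fix x k assume "x \<in> S"
  then obtain V h where V: "open V" "x \<in> V" "sep_holomorphic_on h V" "\<forall>y\<in>V. g y = h y" using assms by blast
  have "((\<lambda>c. h (x + axis k c)) has_field_derivative partial_deriv k h x) (at 0)"
    using V by (intro sep_holomorphic_onD) auto
  moreover have "\<forall>\<^sub>F c in nhds 0. h (x + axis k c) = g (x + axis k c)"
    using eventually_shift_axis[OF V(1,2), of k] by eventually_elim (use V in auto)
  ultimately have "((\<lambda>c. g (x + axis k c)) has_field_derivative partial_deriv k h x) (at 0)"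
    by (subst (asm) DERIV_cong_ev[OF refl _ refl])
  then show "(\<lambda>c. g (x + axis k c)) field_differentiable at 0"
    unfolding field_differentiable_def by blast
qed

lemma sep_holomorphic_on_const [simp]: "sep_holomorphic_on (\<lambda>x. a) S"
  by (rule sep_holomorphic_onI) (auto intro!: derivative_eq_intros)

lemma sep_holomorphic_on_coord: "sep_holomorphic_on (\<lambda>x. x $ l) S"
proof (rule sep_holomorphic_onI)
  show "((\<lambda>c. (x + axis k c) $ l) has_field_derivative (if k = l then 1 else 0)) (at 0)" for x k
    by (auto simp: axis_def intro!: derivative_eq_intros)
qed (intro continuous_intros)

lemma sep_holomorphic_on_add:
  assumes "sep_holomorphic_on f S" "sep_holomorphic_on g S"
  shows "sep_holomorphic_on (\<lambda>x. f x + g x) S"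
  by (rule sep_holomorphic_onI[where D = "\<lambda>x k. partial_deriv k f x + partial_deriv k g x"])
    (use assms in \<open>auto intro!: continuous_intros derivative_eq_intros sep_holomorphic_onD intro: sep_holomorphic_on_continuous simp: power2_eq_square field_simps\<close>)

lemma sep_holomorphic_on_mult:
  assumes "sep_holomorphic_on f S" "sep_holomorphic_on g S"
  shows "sep_holomorphic_on (\<lambda>x. f x * g x) S"
  by (rule sep_holomorphic_onI[where D = "\<lambda>x k. partial_deriv k f x * g x + f x * partial_deriv k g x"])
    (use assms in \<open>auto intro!: continuous_intros derivative_eq_intros sep_holomorphic_onD intro: sep_holomorphic_on_continuous simp: power2_eq_square field_simps\<close>)

lemma sep_holomorphic_on_inverse:
  assumes "sep_holomorphic_on f S" "\<And>x. x \<in> S \<Longrightarrow> f x \<noteq> 0"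
  shows "sep_holomorphic_on (\<lambda>x. inverse (f x)) S"
  by (rule sep_holomorphic_onI[where D = "\<lambda>x k. - (partial_deriv k f x / (f x)\<^sup>2)"])
    (use assms in \<open>auto intro!: continuous_intros derivative_eq_intros sep_holomorphic_onD intro: sep_holomorphic_on_continuous simp: power2_eq_square field_simps\<close>)

lemma sep_holomorphic_on_power:
  "sep_holomorphic_on f S \<Longrightarrow> sep_holomorphic_on (\<lambda>x. f x ^ p) S"
  by (induction p) (auto intro: sep_holomorphic_on_mult)

lemma sep_holomorphic_on_sum:
  "(\<And>i. i \<in> I \<Longrightarrow> sep_holomorphic_on (f i) S) \<Longrightarrow> sep_holomorphic_on (\<lambda>x. \<Sum>i\<in>I. f i x) S"
  by (induction I rule: infinite_finite_induct) (auto intro: sep_holomorphic_on_add)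

lemma sep_holomorphic_on_prod:
  "(\<And>i. i \<in> I \<Longrightarrow> sep_holomorphic_on (f i) S) \<Longrightarrow> sep_holomorphic_on (\<lambda>x. \<Prod>i\<in>I. f i x) S"
  by (induction I rule: infinite_finite_induct) (auto intro: sep_holomorphic_on_mult)

lemma sep_holomorphic_on_det:
  fixes M :: "complex ^ 'v::finite \<Rightarrow> complex ^ 'n::finite ^ 'n"
  shows "(\<And>i j. sep_holomorphic_on (\<lambda>x. M x $ i $ j) S) \<Longrightarrow> sep_holomorphic_on (\<lambda>x. det (M x)) S"
  unfolding det_def
  by (intro sep_holomorphic_on_sum sep_holomorphic_on_mult sep_holomorphic_on_prod sep_holomorphic_on_const)

lemmas sep_holomorphic_intros = sep_holomorphic_on_const sep_holomorphic_on_coord sep_holomorphic_on_add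
  sep_holomorphic_on_mult sep_holomorphic_on_inverse sep_holomorphic_on_power
  sep_holomorphic_on_sum sep_holomorphic_on_prod sep_holomorphic_on_det

lemma partial_deriv_mult:
  assumes "sep_holomorphic_on f S" "sep_holomorphic_on g S" "x \<in> S"
  shows "partial_deriv k (\<lambda>x. f x * g x) x = partial_deriv k f x * g x + f x * partial_deriv k g x"
  by (rule partial_derivI) (auto intro!: derivative_eq_intros sep_holomorphic_onD assms)

lemma partial_deriv_divide:
  assumes "sep_holomorphic_on f S" "sep_holomorphic_on g S" "x \<in> S" "g x \<noteq> 0"
  shows "partial_deriv k (\<lambda>x. f x / g x) x = (partial_deriv k f x * g x - f x * partial_deriv k g x) / (g x)\<^sup>2"
  by (rule partial_derivI)
    (use assms in \<open>auto intro!: derivative_eq_intros sep_holomorphic_onD simp: power2_eq_square\<close>)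

lemma sep_holomorphic_on_slice:
  assumes "sep_holomorphic_on g S" "\<And>c. c \<in> T \<Longrightarrow> x + axis k c \<in> S"
  shows "(\<lambda>c. g (x + axis k c)) holomorphic_on T"
  unfolding holomorphic_on_def field_differentiable_def
  using sep_holomorphic_onD_slice[OF assms(1) assms(2)] has_field_derivative_at_within by blast

section \<open>Cauchy's formula and the regularity of partial derivatives\<close>

lemma partial_deriv_Cauchy:
  fixes g :: "complex ^ 'v::finite \<Rightarrow> complex"
  assumes r: "r > 0" and hol: "sep_holomorphic_on g S"
    and S: "\<And>c. cmod c \<le> r \<Longrightarrow> x + axis k c \<in> S"
  shows "partial_deriv k g x = integral (cbox 0 1)
    (\<lambda>t. g (x + axis k (of_real r * exp (2 * of_real pi * \<i> * of_real t))) / (of_real r * exp (2 * of_real pi * \<i> * of_real t)))"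
proof -
  define f where "f = (\<lambda>c. g (x + axis k c))"
  have h: "f holomorphic_on cball 0 r"
    unfolding f_def by (rule sep_holomorphic_on_slice[OF hol]) (use S in auto)
  have "((\<lambda>u. f u / (u - 0) ^ Suc 1) has_contour_integral ((2 * pi * \<i>) / (fact 1) * (deriv ^^ 1) f 0)) (circlepath 0 r)"
    using r h by (intro Cauchy_has_contour_integral_higher_derivative_circlepath holomorphic_on_imp_continuous_on)
      (auto elim: holomorphic_on_subset)
  then have "2 * pi * \<i> * deriv f 0 = contour_integral (circlepath 0 r) (\<lambda>u. f u / (u - 0) ^ Suc 1)"
    by (simp add: contour_integral_unique)
  also have "\<dots> = integral {0..1} (\<lambda>t. (2 * pi * \<i>) * (f (of_real r * exp (2 * of_real pi * \<i> * of_real t)) / (of_real r * exp (2 * of_real pi * \<i> * of_real t))))"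
    unfolding contour_integral_integral vector_derivative_circlepath
    using r by (intro integral_cong) (simp add: circlepath power2_eq_square)
  also have "\<dots> = (2 * pi * \<i>) * integral {0..1} (\<lambda>t. f (of_real r * exp (2 * of_real pi * \<i> * of_real t)) / (of_real r * exp (2 * of_real pi * \<i> * of_real t)))"
    by (rule integral_mult_right)
  finally show ?thesis by (simp add: partial_deriv_def f_def)
qed

text \<open>Circles of one fixed radius fit around all points near \<open>x0\<close>, so Cauchy's
  formula is an integral that depends continuously on the parameter \<open>x\<close>.\<close>

lemma continuous_on_partial_deriv:
  fixes g :: "complex ^ 'v::finite \<Rightarrow> complex"
  assumes S: "open S" and hol: "sep_holomorphic_on g S"
  shows "continuous_on S (partial_deriv k g)"
proof (rule continuous_at_imp_continuous_on, rule ballI)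
  fix x0 assume "x0 \<in> S"
  then obtain e where e: "e > 0" "ball x0 e \<subseteq> S" using S open_contains_ball by blast
  define r where "r = e / 2"
  have r: "r > 0" using e by (simp add: r_def)
  have sub: "x + axis k c \<in> S" if "x \<in> ball x0 r" "cmod c \<le> r" for x c
  proof -
    have "dist x0 (x + axis k c) \<le> dist x0 x + cmod c"
      using dist_triangle[of x0 "x + axis k c" x] by (simp add: dist_norm norm_axis_complex)
    then show ?thesis using that e by (auto simp: r_def)
  qed
  have "continuous_on (ball x0 r) (\<lambda>x. integral (cbox 0 1)
    (\<lambda>t. g (x + axis k (of_real r * exp (2 * of_real pi * \<i> * of_real t))) / (of_real r * exp (2 * of_real pi * \<i> * of_real t))))"
    using r sub unfolding r_def[symmetric]
    by (intro integral_continuous_on_param)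
      (auto simp: case_prod_beta norm_mult intro!: continuous_intros continuous_on_compose2[OF sep_holomorphic_on_continuous[OF hol]])
  then have "continuous_on (ball x0 r) (partial_deriv k g)"
    by (rule continuous_on_eq) (use partial_deriv_Cauchy[OF r hol] sub in auto)
  then show "isCont (partial_deriv k g) x0"
    using r by (simp add: continuous_on_eq_continuous_at)
qed

text \<open>Cauchy's formula in direction \<open>k\<close>, differentiated under the integral in
  direction \<open>l\<close>, involves only first derivatives of \<open>g\<close>, already known to
  be continuous. This closure property lets functions built from derivatives of the lifts enter the
  maximum argument.\<close>

lemma sep_holomorphic_on_partial_deriv:
  fixes g :: "complex ^ 'v::finite \<Rightarrow> complex"
  assumes S: "open S" and hol: "sep_holomorphic_on g S"
  shows "sep_holomorphic_on (partial_deriv k g) S"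
  unfolding sep_holomorphic_on_def
proof (intro conjI ballI allI)
  show "continuous_on S (partial_deriv k g)" by (rule continuous_on_partial_deriv[OF assms])
  fix x l assume "x \<in> S"
  then obtain e where e: "e > 0" "ball x e \<subseteq> S" using S open_contains_ball by blast
  define r where "r = e / 2"
  have r: "r > 0" using e by (simp add: r_def)
  have sub: "x + axis l c + axis k c' \<in> S" if "cmod c < r" "cmod c' \<le> r" for c c'
  proof -
    have "norm (- axis l c - axis k c' :: complex ^ 'v) \<le> cmod c + cmod c'"
      using norm_triangle_ineq4[of "- axis l c :: complex ^ 'v" "axis k c'"] by (simp add: norm_axis_complex)
    then have "dist x (x + axis l c + axis k c') < e"
      using that e by (simp add: r_def dist_norm add.assoc)
    then show ?thesis using e by auto
  qed
  define u where "u = (\<lambda>t::real. of_real r * exp (2 * of_real pi * \<i> * of_real t) :: complex)"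
  have u: "cmod (u t) = r" "u t \<noteq> 0" for t using r by (auto simp: u_def norm_mult)
  have cont_u: "continuous_on T (\<lambda>y. u (h y))" if "continuous_on T h" for T :: "'b::topological_space set" and h
    unfolding u_def using that by (intro continuous_intros)
  have cont: "continuous_on T (\<lambda>y. h (x + axis l (p y) + axis k (u (q y))) / u (q y))"
    if "continuous_on S h" "continuous_on T p" "continuous_on T q" "\<And>y. y \<in> T \<Longrightarrow> cmod (p y) < r"
    for T :: "'b::topological_space set" and h p q
  proof (rule continuous_on_divide)
    show "continuous_on T (\<lambda>y. h (x + axis l (p y) + axis k (u (q y))))"
    proof (rule continuous_on_compose2[OF that(1)])
      show "continuous_on T (\<lambda>y. x + axis l (p y) + axis k (u (q y)))"
        by (intro continuous_intros cont_u that)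
      show "(\<lambda>y. x + axis l (p y) + axis k (u (q y))) ` T \<subseteq> S"
        using sub that(4) by (auto simp: u)
    qed
  qed (use u cont_u that in auto)
  have at0: "at 0 within ball 0 r = at (0::complex)"
    using r by (intro at_within_open) auto
  let ?f = "\<lambda>c t. g (x + axis l c + axis k (u t)) / u t"
  have "((\<lambda>c. integral (cbox 0 1) (?f c)) has_field_derivative
      integral (cbox 0 1) (\<lambda>t. partial_deriv l g (x + axis l 0 + axis k (u t)) / u t)) (at 0 within ball 0 r)"
  proof (rule leibniz_rule_field_derivative)
    fix c :: complex and t :: real assume c: "c \<in> ball 0 r" "t \<in> cbox (0::real) 1"
    have "((\<lambda>c. g ((x + axis k (u t)) + axis l c)) has_field_derivative
        partial_deriv l g ((x + axis k (u t)) + axis l c)) (at c)"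
      using sub[of c "u t"] c r
      by (intro sep_holomorphic_onD_slice[OF hol]) (auto simp: u add_ac)
    then have "((\<lambda>c. g (x + axis l c + axis k (u t))) has_field_derivative
        partial_deriv l g (x + axis l c + axis k (u t))) (at c)" by (simp add: add_ac)
    from DERIV_cdivide[OF this, of "u t"]
    show "((\<lambda>c. ?f c t) has_field_derivative partial_deriv l g (x + axis l c + axis k (u t)) / u t) (at c within ball 0 r)"
      by (rule has_field_derivative_at_within)
  next
    fix c assume "c \<in> ball (0::complex) r"
    then show "?f c integrable_on cbox 0 1"
      using cont[OF sep_holomorphic_on_continuous[OF hol], of "cbox 0 1" "\<lambda>_. c" "\<lambda>t. t"]
      by (intro integrable_continuous) auto
  next
    show "continuous_on (ball 0 r \<times> cbox 0 1) (\<lambda>(c, t). partial_deriv l g (x + axis l c + axis k (u t)) / u t)"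
      unfolding case_prod_beta
      by (rule cont[OF continuous_on_partial_deriv[OF S hol]])
        (auto intro: continuous_on_fst continuous_on_snd continuous_on_id)
  qed (use r in auto)
  then have "((\<lambda>c. integral (cbox 0 1) (?f c)) has_field_derivative
      integral (cbox 0 1) (\<lambda>t. partial_deriv l g (x + axis l 0 + axis k (u t)) / u t)) (at 0)"
    unfolding at0 .
  moreover have "\<forall>\<^sub>F c in nhds 0. integral (cbox 0 1) (?f c) = partial_deriv k g (x + axis l c)"
    unfolding eventually_nhds
  proof (intro exI[of _ "ball 0 r"] conjI ballI)
    fix c assume "c \<in> ball (0::complex) r"
    then show "integral (cbox 0 1) (?f c) = partial_deriv k g (x + axis l c)"
      unfolding u_def by (intro partial_deriv_Cauchy[OF r hol, symmetric] sub) auto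
  qed (use r in auto)
  ultimately have "((\<lambda>c. partial_deriv k g (x + axis l c)) has_field_derivative
      integral (cbox 0 1) (\<lambda>t. partial_deriv l g (x + axis l 0 + axis k (u t)) / u t)) (at 0)"
    by (subst (asm) DERIV_cong_ev[OF refl _ refl])
  then show "(\<lambda>c. partial_deriv k g (x + axis l c)) field_differentiable at 0"
    unfolding field_differentiable_def by blast
qed

section \<open>Kernels of linear forms and determinants\<close>

definition pairing :: "'a::comm_ring_1 ^ 'n::finite \<Rightarrow> 'a ^ 'n \<Rightarrow> 'a" where
  "pairing h v = (\<Sum>p\<in>UNIV. h $ p * v $ p)"

lemma pairing_add: "pairing h (v + w) = pairing h v + pairing h w"
  by (simp add: pairing_def distrib_left sum.distrib)

lemma pairing_scale: "pairing h (c *s v) = c * pairing h v"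
  by (simp add: pairing_def sum_distrib_left mult_ac)

lemma pairing_zero [simp]: "pairing h 0 = 0"
  by (simp add: pairing_def)

lemma pairing_sum: "pairing h (\<Sum>i\<in>I. f i) = (\<Sum>i\<in>I. pairing h (f i))"
  by (induction I rule: infinite_finite_induct) (auto simp: pairing_add)

lemma pairing_axis: "pairing h (axis p 1) = h $ p"
  by (simp add: pairing_def axis_def if_distrib cong: if_cong)

lemma det_eq_0_if_common_kernel:
  fixes h :: "'a::field ^ 'n::finite"
  assumes "h \<noteq> 0" "\<And>k. pairing h (v k) = 0"
  shows "det (\<chi> k. v k) = 0"
proof (rule ccontr)
  assume "det (\<chi> k. v k) \<noteq> 0"
  then have "\<exists>B. B ** (\<chi> k. v k) = mat 1"
    by (simp add: invertible_det_nz[symmetric] invertible_left_inverse)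
  moreover have "(\<chi> k. v k) *v h = 0"
    using assms(2) by (simp add: vec_eq_iff matrix_vector_mult_def pairing_def mult.commute)
  ultimately show False
    using assms(1) unfolding matrix_left_invertible_ker by blast
qed

text \<open>This is how a change of lift acts on a frame: rows are rescaled, and derivatives pick up
  multiples of the position row \<open>i\<close>. Row operations remove the latter one at a
  time.\<close>

lemma det_scale_and_shear:
  fixes v :: "'n::finite \<Rightarrow> 'a::field ^ 'n"
  assumes "\<nu> i = 0" "c i \<noteq> 0"
  shows "det (\<chi> k. c k *s v k + \<nu> k *s v i) = prod c UNIV * det (\<chi> k. v k)"
proof -
  \<comment> \<open>\<open>K\<close> is the set of rows already sheared. Row \<open>i\<close>
    carries its own factor \<open>c i\<close>, hence the multiplier \<open>\<nu> k / c i\<close>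
    below.\<close>
  define A where "A = (\<lambda>K. (\<chi> k. if k \<in> K then c k *s v k + \<nu> k *s v i else c k *s v k) :: 'a ^ 'n ^ 'n)"
  have "det (A K) = det (A {})" if "finite K" "i \<notin> K" for K
    using that
  proof (induction K rule: finite_induct)
    case (insert k K)
    have rows: "row i (A K) = c i *s v i" "row k (A K) = c k *s v k"
      using insert by (auto simp: A_def row_def vec_eq_iff)
    have "A (insert k K) = (\<chi> l. if l = k then row k (A K) + (\<nu> k / c i) *s row i (A K) else row l (A K))"
      unfolding rows using assms(2) insert(2) by (auto simp: A_def row_def vec_eq_iff)
    then show ?case
      using insert det_row_operation[of k i "A K" "\<nu> k / c i"] by auto
  qed simp
  from this[of "UNIV - {i}"] have "det (A (UNIV - {i})) = det (A {})" by simp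
  moreover have "A (UNIV - {i}) = (\<chi> k. c k *s v k + \<nu> k *s v i)"
    using assms(1) by (auto simp: A_def vec_eq_iff)
  moreover have "det (A {}) = prod c UNIV * det (\<chi> k. v k)"
    by (simp add: A_def det_rows_mul)
  ultimately show ?thesis by simp
qed

text \<open>A basis of the kernel of \<open>h\<close> through \<open>u1\<close> and
  \<open>u2\<close>, with the transversal vector \<open>E\<close> added, spans the whole space.
  Three distinct indices come out of the conclusion, so the projective line is no separate case:
  there the hypotheses contradict each other.\<close>

lemma exists_completion_to_invertible:
  fixes h u1 u2 E :: "'a::field ^ 'n::finite"
  assumes hE: "pairing h E \<noteq> 0" and h1: "pairing h u1 = 0" and h2: "pairing h u2 = 0"
    and ind: "vec.independent {u1, u2}" "u1 \<noteq> u2"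
  shows "\<exists>i1 i2 i3 Y. i1 \<noteq> i2 \<and> i1 \<noteq> i3 \<and> i2 \<noteq> i3 \<and> Y i1 = u1 \<and> Y i2 = u2 \<and> Y i3 = E
    \<and> (\<forall>k. k \<noteq> i3 \<longrightarrow> pairing h (Y k) = 0) \<and> det (\<chi> k. Y k) \<noteq> 0"
proof -
  define V where "V = {y. pairing h y = 0}"
  have V: "vec.subspace V"
    unfolding V_def by (rule vec.subspaceI) (auto simp: pairing_add pairing_scale)
  have "{u1, u2} \<subseteq> V" using h1 h2 by (simp add: V_def)
  then obtain B where B: "{u1, u2} \<subseteq> B" "B \<subseteq> V" "vec.independent B" "V \<subseteq> vec.span B"
    using vec.maximal_independent_subset_extend[OF _ ind(1)] by metis
  have "vec.span B \<subseteq> V" using B(2) V by (rule vec.span_minimal)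
  then have EB: "E \<notin> vec.span B" using hE by (auto simp: V_def)
  define B' where "B' = insert E B"
  have ind': "vec.independent B'"
    unfolding B'_def using EB B(3) by (rule vec.independent_insertI)
  have "UNIV \<subseteq> vec.span B'"
  proof
    fix y
    define t where "t = pairing h y / pairing h E"
    have "y - t *s E = y + (- t) *s E" by simp
    then have "pairing h (y - t *s E) = 0"
      unfolding t_def using hE by (simp only: pairing_add pairing_scale) simp
    then have "y - t *s E \<in> vec.span B" using B(4) by (auto simp: V_def)
    then have "y - t *s E \<in> vec.span B'"
      using vec.span_mono[of B B'] by (auto simp: B'_def)
    moreover have "t *s E \<in> vec.span B'"
      by (intro vec.span_scale vec.span_base) (simp add: B'_def)
    ultimately have "(y - t *s E) + t *s E \<in> vec.span B'" by (rule vec.span_add)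
    then show "y \<in> vec.span B'" by simp
  qed
  then have "card B' = CARD('n)"
    using vec.basis_card_eq_dim[of B' UNIV] ind' by (simp add: card_cart_basis)
  moreover have finB: "finite B'" using ind' by (rule vec.finiteI_independent)
  ultimately obtain Y :: "'n \<Rightarrow> 'a ^ 'n" where Y: "bij_betw Y UNIV B'"
    using finite_same_card_bij[of "UNIV :: 'n set" B'] by auto
  have "E \<in> B'" "u1 \<in> B'" "u2 \<in> B'" using B by (auto simp: B'_def)
  then obtain i1 i2 i3 where i: "Y i1 = u1" "Y i2 = u2" "Y i3 = E"
    using Y unfolding bij_betw_def by (metis imageE)
  have "E \<noteq> u1" "E \<noteq> u2" using hE h1 h2 by auto
  then have ne: "i1 \<noteq> i2 \<and> i1 \<noteq> i3 \<and> i2 \<noteq> i3" using i ind(2) by auto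
  have ker: "pairing h (Y k) = 0" if "k \<noteq> i3" for k
  proof -
    have "Y k \<noteq> E" using that i(3) Y by (metis bij_betw_def injD)
    moreover have "Y k \<in> B'" using Y by (auto simp: bij_betw_def)
    ultimately show ?thesis using B(2) by (auto simp: B'_def V_def)
  qed
  have "\<exists>C. (\<chi> k. Y k) ** C = mat 1"
    unfolding matrix_right_invertible_independent_rows
  proof (intro allI impI)
    fix c i assume "(\<Sum>k\<in>UNIV. c k *s row k (\<chi> k. Y k)) = 0"
    then have "(\<Sum>k\<in>UNIV. c (inv_into UNIV Y (Y k)) *s Y k) = 0"
      using Y by (simp add: row_def bij_betw_def)
    then have "(\<Sum>b\<in>B'. c (inv_into UNIV Y b) *s b) = 0"
      by (subst (asm) sum.reindex_bij_betw[OF Y, of "\<lambda>b. c (inv_into UNIV Y b) *s b"])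
    then have "c (inv_into UNIV Y b) = 0" if "b \<in> B'" for b
      using that ind' finB vec.independentD[OF ind' finB subset_refl, of "\<lambda>b. c (inv_into UNIV Y b)" b] by blast
    from this[of "Y i"] show "c i = 0" using Y by (auto simp: bij_betw_def)
  qed
  then have "det (\<chi> k. Y k) \<noteq> 0"
    by (simp add: invertible_det_nz[symmetric] invertible_right_inverse)
  then show ?thesis using ne i ker by blast
qed

section \<open>The equation of a hypersurface and multi-indices\<close>

definition monomial :: "complex ^ 'n::finite \<Rightarrow> ('n, 'd::finite) multi_index \<Rightarrow> complex" where
  "monomial L \<alpha> = (\<Prod>i\<in>UNIV. (L $ i) ^ exponent \<alpha> i)"

text \<open>The gradient in the homogeneous coordinates. Where
  \<open>exponent \<alpha> p = 0\<close>, the truncated \<open>- 1\<close> is harmless because the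
  factor in front vanishes.\<close>

definition hyp_grad :: "complex ^ 'n::finite \<Rightarrow> complex ^ ('n, 'd::finite) multi_index \<Rightarrow> complex ^ 'n" where
  "hyp_grad L a = (\<chi> p. \<Sum>\<alpha>\<in>UNIV. a $ \<alpha> * (of_nat (exponent \<alpha> p) *
      (\<Prod>l\<in>UNIV. (L $ l) ^ (if l = p then exponent \<alpha> l - 1 else exponent \<alpha> l))))"

lemma hypersurface_eq_monomial: "hypersurface_eq L a = (\<Sum>\<alpha>\<in>UNIV. a $ \<alpha> * monomial L \<alpha>)"
  by (simp add: hypersurface_eq_def monomial_def)

lemma has_field_derivative_monomial:
  assumes "\<And>l. ((\<lambda>c. L c $ l) has_field_derivative L' $ l) (at z)"
  shows "((\<lambda>c. monomial (L c) \<alpha>) has_field_derivative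
    (\<Sum>p\<in>UNIV. of_nat (exponent \<alpha> p) *
      (\<Prod>l\<in>UNIV. (L z $ l) ^ (if l = p then exponent \<alpha> l - 1 else exponent \<alpha> l)) * L' $ p)) (at z)"
proof -
  have "((\<lambda>c. monomial (L c) \<alpha>) has_field_derivative
    (\<Sum>p\<in>UNIV. (of_nat (exponent \<alpha> p) * (L z $ p) ^ (exponent \<alpha> p - 1) * L' $ p)
       * (\<Prod>l\<in>UNIV - {p}. (L z $ l) ^ exponent \<alpha> l))) (at z)"
    unfolding monomial_def
    by (rule has_field_derivative_prod) (auto intro!: derivative_eq_intros assms)
  moreover have "(\<Prod>l\<in>UNIV. (L z $ l) ^ (if l = p then exponent \<alpha> l - 1 else exponent \<alpha> l))
      = (L z $ p) ^ (exponent \<alpha> p - 1) * (\<Prod>l\<in>UNIV - {p}. (L z $ l) ^ exponent \<alpha> l)" for p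
    by (subst prod.remove[of _ p]) (auto intro!: prod.cong)
  ultimately show ?thesis by (simp add: mult_ac)
qed

lemma has_field_derivative_hypersurface_eq:
  assumes L: "\<And>l. ((\<lambda>c. L c $ l) has_field_derivative L' $ l) (at z)"
    and a: "\<And>\<alpha>. ((\<lambda>c. a c $ \<alpha>) has_field_derivative a' $ \<alpha>) (at z)"
  shows "((\<lambda>c. hypersurface_eq (L c) (a c)) has_field_derivative
    pairing (hyp_grad (L z) (a z)) L' + (\<Sum>\<alpha>\<in>UNIV. a' $ \<alpha> * monomial (L z) \<alpha>)) (at z)"
proof -
  let ?m = "\<lambda>\<alpha> p. of_nat (exponent \<alpha> p) *
      (\<Prod>l\<in>UNIV. (L z $ l) ^ (if l = p then exponent \<alpha> l - 1 else exponent \<alpha> l))"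
  have "((\<lambda>c. hypersurface_eq (L c) (a c)) has_field_derivative
    (\<Sum>\<alpha>\<in>UNIV. a' $ \<alpha> * monomial (L z) \<alpha> + (\<Sum>p\<in>UNIV. ?m \<alpha> p * L' $ p) * a z $ \<alpha>)) (at z)"
    unfolding hypersurface_eq_monomial
    by (intro DERIV_sum DERIV_mult has_field_derivative_monomial L a)
  moreover have "(\<Sum>\<alpha>\<in>UNIV. (\<Sum>p\<in>UNIV. ?m \<alpha> p * L' $ p) * a z $ \<alpha>) = pairing (hyp_grad (L z) (a z)) L'"
    unfolding pairing_def hyp_grad_def sum_distrib_right vec_lambda_beta
    by (subst sum.swap) (simp add: mult_ac)
  ultimately show ?thesis by (simp add: sum.distrib add.commute)
qed

text \<open>Replaces one factor \<open>p\<close> of the monomial by a factor \<open>q\<close>. It is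
  meaningful only if \<open>exponent \<alpha> p > 0\<close>; otherwise the exponents add up to
  \<open>d + 1\<close> and \<open>Abs_multi_index\<close> is applied outside its domain.\<close>

definition exchange :: "'n \<Rightarrow> 'n \<Rightarrow> ('n::finite, 'd::finite) multi_index \<Rightarrow> ('n, 'd) multi_index" where
  "exchange p q \<alpha> = Abs_multi_index
    (\<lambda>l. (if l = p then exponent \<alpha> l - 1 else exponent \<alpha> l) + (if l = q then 1 else 0))"

lemma exponent_exchange:
  assumes "exponent \<alpha> p > 0"
  shows "exponent (exchange p q \<alpha>) l = (if l = p then exponent \<alpha> l - 1 else exponent \<alpha> l) + (if l = q then 1 else 0)"
proof -
  have "(\<Sum>l\<in>UNIV. (if l = p then exponent \<alpha> l - 1 else exponent \<alpha> l)) + 1 = (\<Sum>l\<in>UNIV. exponent \<alpha> l)"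
    using assms by (subst (1 2) sum.remove[of _ p]) auto
  then have "(\<Sum>l\<in>UNIV. (if l = p then exponent \<alpha> l - 1 else exponent \<alpha> l) + (if l = q then 1 else 0)) = CARD('b)"
    by (simp add: sum.distrib sum_exponent)
  then show ?thesis by (simp add: exchange_def Abs_multi_index_inverse)
qed

lemma monomial_exchange:
  assumes "exponent \<alpha> p > 0"
  shows "monomial L (exchange p q \<alpha>) =
    L $ q * (\<Prod>l\<in>UNIV. (L $ l) ^ (if l = p then exponent \<alpha> l - 1 else exponent \<alpha> l))"
proof -
  have "(\<Prod>l\<in>UNIV. (L $ l) ^ (if l = q then 1 else 0)) = L $ q"
    by (simp add: if_distrib cong: if_cong)
  then show ?thesis
    unfolding monomial_def exponent_exchange[OF assms] power_add prod.distrib by (simp add: mult.commute)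
qed

lemma monomial_exchange_swap:
  assumes "exponent \<alpha> p > 0"
  shows "L $ p * monomial L (exchange p q \<alpha>) = L $ q * monomial L \<alpha>"
proof -
  have "monomial L \<alpha> = L $ p * (\<Prod>l\<in>UNIV. (L $ l) ^ (if l = p then exponent \<alpha> l - 1 else exponent \<alpha> l))"
    unfolding monomial_def using assms
    by (subst (1 2) prod.remove[of _ p]) (auto simp: power_eq_if intro!: prod.cong)
  then show ?thesis using monomial_exchange[OF assms] by simp
qed

text \<open>Its monomial equals 1 on lifts with \<open>i\<close>-th coordinate 1, so the derivative
  in this coefficient is a transversal direction available throughout chart
  \<open>i\<close>.\<close>

definition pure_power :: "'n \<Rightarrow> ('n::finite, 'd::finite) multi_index" where
  "pure_power i = Abs_multi_index (\<lambda>l. if l = i then CARD('d) else 0)"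

lemma exponent_pure_power:
  "exponent (pure_power i :: ('n::finite, 'd::finite) multi_index) l = (if l = i then CARD('d) else 0)"
  by (simp add: pure_power_def Abs_multi_index_inverse)

lemma monomial_pure_power: "monomial L (pure_power i :: ('n::finite, 'd::finite) multi_index) = L $ i ^ CARD('d)"
  by (simp add: monomial_def exponent_pure_power if_distrib cong: if_cong)

lemma eq_pure_power:
  assumes "exponent \<beta> i = CARD('d)"
  shows "\<beta> = (pure_power i :: ('n::finite, 'd::finite) multi_index)"
proof -
  have "(\<Sum>l\<in>UNIV - {i}. exponent \<beta> l) = 0"
    using sum_exponent[of \<beta>] assms by (subst (asm) sum.remove[of _ i]) auto
  then have "exponent \<beta> = exponent (pure_power i :: ('n, 'd) multi_index)"
    using assms by (auto simp: fun_eq_iff exponent_pure_power)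
  then show ?thesis by (simp add: exponent_inject)
qed

section \<open>Vector fields tangent to the universal family\<close>

text \<open>
  The vector field \<open>(L\<^sub>i)\<^sup>2 c \<cdot> \<partial>\<^sub>Z + \<Sum> B\<^sub>\<beta>\<^sub>l(a) L\<^sub>l \<partial>\<^sub>\<beta>\<close> is tangent to the universal family, up to the sign of the
  second summand, which is chosen so that \<open>field_value\<close> is the component along the fibers.
\<close>

definition tangent_field ::
  "'n::finite \<Rightarrow> complex ^ 'n \<Rightarrow> (('n, 'd::finite) multi_index \<Rightarrow> 'n \<Rightarrow> complex ^ ('n, 'd) multi_index \<Rightarrow> complex) \<Rightarrow> bool" where
  "tangent_field i c B \<longleftrightarrow> (\<forall>\<beta> l. sep_holomorphic_on (B \<beta> l) UNIV) \<and>
    (\<forall>L a. (L $ i)\<^sup>2 * pairing (hyp_grad L a) c = (\<Sum>\<beta>\<in>UNIV. (\<Sum>l\<in>UNIV. B \<beta> l a * L $ l) * monomial L \<beta>))"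

text \<open>\<open>E \<beta>\<close> stands for \<open>\<partial>\<^sub>\<beta> f\<close>. Moving
  the coefficient \<open>\<beta>\<close> moves the point of the curve by \<open>E \<beta>\<close>;
  subtracting this motion from the tangent field cancels its coefficient directions and leaves a
  vector along the fiber.\<close>

definition field_value ::
  "'n::finite \<Rightarrow> complex ^ 'n \<Rightarrow> (('n, 'd::finite) multi_index \<Rightarrow> 'n \<Rightarrow> complex ^ ('n, 'd) multi_index \<Rightarrow> complex) \<Rightarrow>
    complex ^ ('n, 'd) multi_index \<Rightarrow> complex ^ 'n \<Rightarrow> (('n, 'd) multi_index \<Rightarrow> complex ^ 'n) \<Rightarrow> complex ^ 'n" where
  "field_value i c B a L E = (L $ i)\<^sup>2 *s c + (\<Sum>\<beta>\<in>UNIV. (\<Sum>l\<in>UNIV. B \<beta> l a * L $ l) *s E \<beta>)"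

lemma pairing_field_value:
  assumes "tangent_field i c B" "\<And>\<beta>. pairing (hyp_grad L a) (E \<beta>) = - monomial L \<beta>"
  shows "pairing (hyp_grad L a) (field_value i c B a L E) = 0"
  using assms by (simp add: tangent_field_def field_value_def pairing_add pairing_scale pairing_sum sum_negf)

text \<open>Differentiating a rescaled lift adds multiples \<open>e \<beta>\<close> of
  \<open>L\<close> to the derivatives. Both parts of the field are homogeneous of degree 2, which is
  the weight of such a row in the later count.\<close>

lemma field_value_scale:
  "field_value i c B a (\<mu> *s L) (\<lambda>\<beta>. \<mu> *s E \<beta> + e \<beta> *s L)
    = \<mu>\<^sup>2 *s field_value i c B a L E + (\<mu> * (\<Sum>\<beta>\<in>UNIV. (\<Sum>l\<in>UNIV. B \<beta> l a * L $ l) * e \<beta>)) *s L"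
proof -
  have s: "(\<Sum>l\<in>UNIV. B \<beta> l a * (\<mu> *s L) $ l) = \<mu> * (\<Sum>l\<in>UNIV. B \<beta> l a * L $ l)" for \<beta>
    by (simp add: sum_distrib_left mult_ac)
  show ?thesis unfolding field_value_def s
    by (simp add: vec_eq_iff sum.distrib sum_distrib_left sum_distrib_right algebra_simps power2_eq_square)
qed

section \<open>The vectors along a fiber that the tangent fields produce\<close>

definition field_values ::
  "'n::finite \<Rightarrow> complex ^ ('n, 'd::finite) multi_index \<Rightarrow> complex ^ 'n \<Rightarrow> (('n, 'd) multi_index \<Rightarrow> complex ^ 'n) \<Rightarrow> (complex ^ 'n) set" where
  "field_values i a L E = {field_value i c B a L E | c B. tangent_field i c B}"

lemma field_valuesI: "tangent_field i c B \<Longrightarrow> field_value i c B a L E = y \<Longrightarrow> y \<in> field_values i a L E"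
  unfolding field_values_def by blast

lemma subspace_field_values: "vec.subspace (field_values i a L (E :: ('n::finite, 'd::finite) multi_index \<Rightarrow> complex ^ 'n))"
proof (rule vec.subspaceI)
  have "tangent_field i 0 (\<lambda>(\<beta> :: ('n, 'd) multi_index) l a. 0)" "field_value i 0 (\<lambda>\<beta> l a. 0) a L E = 0"
    by (simp_all add: tangent_field_def field_value_def)
  then show "0 \<in> field_values i a L E" by (rule field_valuesI)
next
  fix x y assume "x \<in> field_values i a L E" "y \<in> field_values i a L E"
  then obtain c B c' B' where *: "tangent_field i c B" "x = field_value i c B a L E"
    "tangent_field i c' B'" "y = field_value i c' B' a L E"
    unfolding field_values_def by blast
  let ?B = "\<lambda>\<beta> l a. B \<beta> l a + B' \<beta> l a"
  have "tangent_field i (c + c') ?B"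
    using * by (auto simp: tangent_field_def pairing_add distrib_left distrib_right sum.distrib intro: sep_holomorphic_on_add)
  moreover have "x + y = field_value i (c + c') ?B a L E"
    unfolding * by (simp add: field_value_def vec_eq_iff sum.distrib algebra_simps)
  ultimately show "x + y \<in> field_values i a L E" unfolding field_values_def by blast
next
  fix t x assume "x \<in> field_values i a L E"
  then obtain c B where *: "tangent_field i c B" "x = field_value i c B a L E"
    unfolding field_values_def by blast
  let ?B = "\<lambda>\<beta> l a. t * B \<beta> l a"
  have s: "(\<Sum>l\<in>UNIV. t * B \<beta> l a * L $ l) = t * (\<Sum>l\<in>UNIV. B \<beta> l a * L $ l)" for \<beta> a and L :: "complex ^ 'n"
    by (simp add: sum_distrib_left mult.assoc)
  have "tangent_field i (t *s c) ?B"
    unfolding tangent_field_def s pairing_scale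
  proof (intro conjI allI)
    show "sep_holomorphic_on (\<lambda>a. t * B \<beta> l a) UNIV" for \<beta> l
      using * by (auto simp: tangent_field_def intro: sep_holomorphic_intros)
    show "(L $ i)\<^sup>2 * (t * pairing (hyp_grad L a) c) =
        (\<Sum>\<beta>\<in>UNIV. t * (\<Sum>l\<in>UNIV. B \<beta> l a * L $ l) * monomial L \<beta>)" for L a
      using *(1) by (simp add: tangent_field_def mult.assoc mult.left_commute[of _ t] flip: sum_distrib_left)
  qed
  moreover have "t *s x = field_value i (t *s c) ?B a L E"
    unfolding * field_value_def s by (simp add: vec_eq_iff sum_distrib_left algebra_simps)
  ultimately show "t *s x \<in> field_values i a L E" unfolding field_values_def by blast
qed

text \<open>Fields that move only the coefficients: multiplying the monomial of
  \<open>\<beta>\<close> by coordinate \<open>i\<close>, or that of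
  \<open>exchange j i \<beta>\<close> by coordinate \<open>j\<close>, gives the same monomial of
  degree \<open>d + 1\<close>, so the two contributions to the equation cancel.\<close>

lemma exchange_mem_field_values:
  fixes E :: "('n::finite, 'd::finite) multi_index \<Rightarrow> complex ^ 'n"
  assumes "exponent \<beta> j > 0"
  shows "L $ i *s E \<beta> - L $ j *s E (exchange j i \<beta>) \<in> field_values i a L E"
proof -
  \<comment> \<open>Two separate summands, because for \<open>j = i\<close> the indices
    \<open>\<beta>\<close> and \<open>exchange j i \<beta>\<close> coincide and the entries must add
    up to 0.\<close>
  let ?B = "\<lambda>\<gamma> l (a :: complex ^ ('n, 'd) multi_index). (if \<gamma> = \<beta> then (if l = i then 1 else 0) else 0)
     + (if \<gamma> = exchange j i \<beta> then (if l = j then - 1 else 0) else (0::complex))"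
  have s: "(\<Sum>l\<in>UNIV. ?B \<gamma> l a * L $ l) = (if \<gamma> = \<beta> then L $ i else 0) + (if \<gamma> = exchange j i \<beta> then - L $ j else 0)"
    for \<gamma> a and L :: "complex ^ 'n"
    by (cases "\<gamma> = \<beta>"; cases "\<gamma> = exchange j i \<beta>"; simp only: simp_thms if_True if_False distrib_right sum.distrib mult_delta_left;
      simp)
  have "tangent_field i 0 ?B"
    unfolding tangent_field_def s
  proof (intro conjI allI)
    show "sep_holomorphic_on (?B \<gamma> l) UNIV" for \<gamma> l by (rule sep_holomorphic_on_const)
    show "(L $ i)\<^sup>2 * pairing (hyp_grad L a) 0 = (\<Sum>\<gamma>\<in>UNIV. ((if \<gamma> = \<beta> then L $ i else 0)
       + (if \<gamma> = exchange j i \<beta> then - L $ j else 0)) * monomial L \<gamma>)"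
      for L :: "complex ^ 'n" and a :: "complex ^ ('n, 'd) multi_index"
      unfolding distrib_right sum.distrib mult_delta_left
      using monomial_exchange_swap[OF assms, of L i] by simp
  qed
  moreover have "field_value i 0 ?B a L E = L $ i *s E \<beta> - L $ j *s E (exchange j i \<beta>)"
    unfolding field_value_def s by (simp add: vec_eq_iff distrib_right sum.distrib mult_delta_left)
  ultimately show ?thesis by (rule field_valuesI)
qed

text \<open>Fields that move the point in direction \<open>p\<close>. One factor
  \<open>L $ i\<close> restores degree \<open>d\<close> in the differentiated monomials, the other
  matches the linear forms in the coefficient part; this is the origin of the square in
  \<open>tangent_field\<close>.\<close>

lemma linear_mem_field_values:
  fixes E :: "('n::finite, 'd::finite) multi_index \<Rightarrow> complex ^ 'n"
  shows "(L $ i)\<^sup>2 *s axis p 1 + (\<Sum>\<alpha>\<in>UNIV. (of_nat (exponent \<alpha> p) * a $ \<alpha> * L $ i) *s E (exchange p i \<alpha>)) \<in> field_values i a L E"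
proof -
  let ?B = "\<lambda>\<gamma> l (a :: complex ^ ('n, 'd) multi_index).
     if l = i then (\<Sum>\<alpha>\<in>UNIV. if exchange p i \<alpha> = \<gamma> then of_nat (exponent \<alpha> p) * a $ \<alpha> else 0) else (0::complex)"
  have s: "(\<Sum>l\<in>UNIV. ?B \<gamma> l a * L $ l) = (\<Sum>\<alpha>\<in>UNIV. if \<gamma> = exchange p i \<alpha> then of_nat (exponent \<alpha> p) * a $ \<alpha> * L $ i else 0)"
    for \<gamma> a and L :: "complex ^ 'n"
  proof -
    have "(\<Sum>l\<in>UNIV. ?B \<gamma> l a * L $ l) = (\<Sum>l\<in>UNIV. if l = i then
      (\<Sum>\<alpha>\<in>UNIV. if exchange p i \<alpha> = \<gamma> then of_nat (exponent \<alpha> p) * a $ \<alpha> else 0) * L $ i else 0)"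
      by (rule sum.cong) auto
    then show ?thesis by (auto simp: sum_distrib_right intro!: sum.cong)
  qed
  have "tangent_field i (axis p 1) ?B"
    unfolding tangent_field_def s
  proof (intro conjI allI)
    show "sep_holomorphic_on (?B \<beta> l) UNIV" for \<beta> l
    proof (cases "l = i")
      case True
      have "sep_holomorphic_on (\<lambda>a :: complex ^ ('n, 'd) multi_index. if P \<alpha> then of_nat (exponent \<alpha> p) * a $ \<alpha> else 0) UNIV" for P \<alpha>
        by (cases "P \<alpha>") (auto intro: sep_holomorphic_intros)
      then show ?thesis using True by (auto intro!: sep_holomorphic_on_sum)
    qed simp
    fix L :: "complex ^ 'n" and a :: "complex ^ ('n, 'd) multi_index"
    have "(\<Sum>\<beta>\<in>UNIV. (\<Sum>\<alpha>\<in>UNIV. if \<beta> = exchange p i \<alpha> then of_nat (exponent \<alpha> p) * a $ \<alpha> * L $ i else 0) * monomial L \<beta>)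
      = (\<Sum>\<alpha>\<in>UNIV. of_nat (exponent \<alpha> p) * a $ \<alpha> * L $ i * monomial L (exchange p i \<alpha>))"
      unfolding sum_distrib_right by (subst sum.swap) (simp add: mult_delta_left)
    also have "\<dots> = (\<Sum>\<alpha>\<in>UNIV. (L $ i)\<^sup>2 * (a $ \<alpha> * (of_nat (exponent \<alpha> p) *
      (\<Prod>l\<in>UNIV. (L $ l) ^ (if l = p then exponent \<alpha> l - 1 else exponent \<alpha> l)))))"
    proof (rule sum.cong[OF refl])
      fix \<alpha> :: "('n, 'd) multi_index"
      \<comment> \<open>If the exponent is 0, \<open>exchange p i \<alpha>\<close> is unspecified,
        but its coefficient is 0.\<close>
      show "of_nat (exponent \<alpha> p) * a $ \<alpha> * L $ i * monomial L (exchange p i \<alpha>) = (L $ i)\<^sup>2 * (a $ \<alpha> * (of_nat (exponent \<alpha> p) *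
        (\<Prod>l\<in>UNIV. (L $ l) ^ (if l = p then exponent \<alpha> l - 1 else exponent \<alpha> l))))"
        by (cases "exponent \<alpha> p = 0") (simp_all add: monomial_exchange power2_eq_square)
    qed
    finally show "(L $ i)\<^sup>2 * pairing (hyp_grad L a) (axis p 1) =
      (\<Sum>\<beta>\<in>UNIV. (\<Sum>\<alpha>\<in>UNIV. if \<beta> = exchange p i \<alpha> then of_nat (exponent \<alpha> p) * a $ \<alpha> * L $ i else 0) * monomial L \<beta>)"
      by (simp add: pairing_axis hyp_grad_def sum_distrib_left)
  qed
  moreover have "field_value i (axis p 1) ?B a L E = (L $ i)\<^sup>2 *s axis p 1
     + (\<Sum>\<alpha>\<in>UNIV. (of_nat (exponent \<alpha> p) * a $ \<alpha> * L $ i) *s E (exchange p i \<alpha>))"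
  proof -
    have "(\<Sum>\<beta>\<in>UNIV. (\<Sum>\<alpha>\<in>UNIV. if \<beta> = exchange p i \<alpha> then of_nat (exponent \<alpha> p) * a $ \<alpha> * L $ i else 0) *s E \<beta>)
      = (\<Sum>\<alpha>\<in>UNIV. (of_nat (exponent \<alpha> p) * a $ \<alpha> * L $ i) *s E (exchange p i \<alpha>))"
      unfolding vec_eq_iff sum_component vector_smult_component sum_distrib_right
      by (subst sum.swap) (simp add: mult_delta_left)
    then show ?thesis unfolding field_value_def s by simp
  qed
  ultimately show ?thesis by (rule field_valuesI)
qed

text \<open>Modulo the field values, every vector is a multiple of \<open>E (pure_power i)\<close>:
  exchanges move the factors of a monomial into coordinate \<open>i\<close> one by one, and the
  linear fields express each \<open>axis p 1\<close> through the vectors \<open>E \<beta>\<close>.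
  On the remaining direction the gradient is nonzero, so nothing of the kernel is left over.\<close>

lemma kernel_subset_field_values:
  fixes E :: "('n::finite, 'd::finite) multi_index \<Rightarrow> complex ^ 'n"
  assumes L: "L $ i = 1" and E: "\<And>\<beta>. pairing (hyp_grad L a) (E \<beta>) = - monomial L \<beta>"
    and y: "pairing (hyp_grad L a) y = 0"
  shows "y \<in> field_values i a L E"
proof -
  define S where "S = field_values i a L E"
  have S: "vec.subspace S" unfolding S_def by (rule subspace_field_values)
  have kerS: "pairing (hyp_grad L a) y = 0" if "y \<in> S" for y
    using that pairing_field_value[OF _ E] unfolding S_def field_values_def by blast
  \<comment> \<open>The vectors whose projection to the kernel along \<open>E (pure_power i)\<close>
    lies in \<open>S\<close>. The sign is a plus because the gradient takes the value
    \<open>- 1\<close> on that direction.\<close>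
  define Q where "Q = {y. y + pairing (hyp_grad L a) y *s E (pure_power i) \<in> S}"
  have Q: "vec.subspace Q"
  proof (rule vec.subspaceI)
    show "0 \<in> Q" using S by (simp add: Q_def vec.subspace_0)
  next
    fix x y assume "x \<in> Q" "y \<in> Q"
    then have "(x + pairing (hyp_grad L a) x *s E (pure_power i)) + (y + pairing (hyp_grad L a) y *s E (pure_power i)) \<in> S"
      unfolding Q_def using S by (auto intro: vec.subspace_add)
    then show "x + y \<in> Q" by (simp add: Q_def pairing_add vector_sadd_rdistrib add_ac)
  next
    fix t x assume "x \<in> Q"
    then have "t *s (x + pairing (hyp_grad L a) x *s E (pure_power i)) \<in> S"
      unfolding Q_def using vec.subspace_scale[OF S] by blast
    then show "t *s x \<in> Q" by (simp add: Q_def pairing_scale vector_add_ldistrib vector_smult_assoc)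
  qed
  have "E \<beta> - monomial L \<beta> *s E (pure_power i) \<in> S" for \<beta>
  \<comment> \<open>An exchange towards \<open>i\<close> raises the exponent of \<open>i\<close> by
    one; it stops at \<open>pure_power i\<close>, the only index with full exponent there.\<close>
  proof (induction "CARD('d) - exponent \<beta> i" arbitrary: \<beta> rule: less_induct)
    case less
    have le: "exponent \<beta> l \<le> CARD('d)" for l
      using sum_exponent[of \<beta>] member_le_sum[of l UNIV "exponent \<beta>"] by simp
    show ?case
    proof (cases "exponent \<beta> i = CARD('d)")
      case True
      then have "\<beta> = pure_power i" by (rule eq_pure_power)
      then show ?thesis using S L by (simp add: monomial_pure_power vec.subspace_0)
    next
      case False
      have "\<exists>j. j \<noteq> i \<and> exponent \<beta> j > 0"
      proof (rule ccontr)
        assume "\<not> ?thesis"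
        then have "(\<Sum>l\<in>UNIV - {i}. exponent \<beta> l) = 0" by auto
        then show False using False sum_exponent[of \<beta>] by (subst (asm) (2) sum.remove[of _ i]) auto
      qed
      then obtain j where j: "j \<noteq> i" "exponent \<beta> j > 0" by blast
      define \<gamma> where "\<gamma> = exchange j i \<beta>"
      have "exponent \<gamma> i = exponent \<beta> i + 1"
        using j by (simp add: \<gamma>_def exponent_exchange)
      then have IH: "E \<gamma> - monomial L \<gamma> *s E (pure_power i) \<in> S"
        using less[of \<gamma>] le[of i] False by simp
      have "E \<beta> - L $ j *s E \<gamma> \<in> S"
        using exchange_mem_field_values[OF j(2), of L i E a] L by (simp add: S_def \<gamma>_def)
      then have "(E \<beta> - L $ j *s E \<gamma>) + L $ j *s (E \<gamma> - monomial L \<gamma> *s E (pure_power i)) \<in> S"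
        using S IH by (intro vec.subspace_add vec.subspace_scale)
      moreover have "L $ j * monomial L \<gamma> = monomial L \<beta>"
        using monomial_exchange_swap[OF j(2), of L i] L by (simp add: \<gamma>_def)
      ultimately show ?thesis
        by (simp add: vector_ssub_ldistrib vector_smult_assoc)
    qed
  qed
  then have EQ: "E \<beta> \<in> Q" for \<beta> using E by (simp add: Q_def)
  have SQ: "y \<in> Q" if "y \<in> S" for y using that kerS by (simp add: Q_def)
  have ax: "axis p 1 \<in> Q" for p
  proof -
    let ?s = "\<Sum>\<alpha>\<in>UNIV. (of_nat (exponent \<alpha> p) * a $ \<alpha>) *s E (exchange p i \<alpha>)"
    have "axis p 1 + ?s \<in> S" using linear_mem_field_values[of L i p a E] L by (simp add: S_def)
    moreover have "?s \<in> Q" using Q EQ by (intro vec.subspace_sum vec.subspace_scale) auto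
    ultimately have "(axis p 1 + ?s) - ?s \<in> Q" using Q SQ vec.subspace_diff by blast
    then show ?thesis by simp
  qed
  have "y = (\<Sum>p\<in>UNIV. y $ p *s axis p 1)" by (simp add: basis_expansion)
  also have "\<dots> \<in> Q" using Q ax by (intro vec.subspace_sum vec.subspace_scale) auto
  finally show ?thesis using y by (simp add: Q_def S_def)
qed

section \<open>The weighted maximum on a polydisc\<close>

lemma compact_polydisc: "compact {x :: complex ^ 'v::finite. \<forall>k. cmod (x $ k - x0 $ k) \<le> r k}"
proof (rule compact_eq_bounded_closed[THEN iffD2], rule conjI)
  show "bounded {x :: complex ^ 'v. \<forall>k. cmod (x $ k - x0 $ k) \<le> r k}"
    unfolding bounded_iff
  proof (intro exI ballI)
    fix x assume "x \<in> {x :: complex ^ 'v. \<forall>k. cmod (x $ k - x0 $ k) \<le> r k}"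
    then have *: "cmod (x $ k - x0 $ k) \<le> r k" for k by simp
    have "norm x \<le> (\<Sum>k\<in>UNIV. cmod (x $ k))" 
      unfolding norm_vec_def by (rule L2_set_le_sum) simp
    also have "\<dots> \<le> (\<Sum>k\<in>UNIV. r k + cmod (x0 $ k))"
    proof (rule sum_mono)
      fix k show "cmod (x $ k) \<le> r k + cmod (x0 $ k)"
        using *[of k] norm_triangle_sub[of "x $ k" "x0 $ k"] by simp
    qed
    finally show "norm x \<le> (\<Sum>k\<in>UNIV. r k + cmod (x0 $ k))" .
  qed
  have "closed {x :: complex ^ 'v. cmod (x $ k - x0 $ k) \<le> r k}" for k
    by (intro closed_Collect_le continuous_intros)
  then show "closed {x :: complex ^ 'v. \<forall>k. cmod (x $ k - x0 $ k) \<le> r k}"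
    by (rule closed_Collect_all)
qed

text \<open>The weight is 1 at the centre and 0 where some coordinate reaches its radius, so a
  maximum over the closed polydisc is attained inside. It remains a maximum along each coordinate
  axis, where the one-variable bound applies.\<close>

lemma polydisc_weighted_maximum:
  fixes F :: "complex ^ 'v::finite \<Rightarrow> complex ^ 'n::finite"
  defines "\<eta> \<equiv> \<lambda>r x0 k (x :: complex ^ 'v). 1 - (cmod (x $ k - x0 $ k))\<^sup>2 / (r k)\<^sup>2"
  assumes hol: "\<And>l. sep_holomorphic_on (\<lambda>x. F x $ l) S"
    and r: "\<And>k. r k > 0" and sub: "{x. \<forall>k. cmod (x $ k - x0 $ k) \<le> r k} \<subseteq> S"
    and F0: "F x0 \<noteq> 0" and p: "p > 0"
  shows "\<exists>x. (\<forall>k. cmod (x $ k - x0 $ k) < r k) \<and> F x \<noteq> 0 \<and>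
    (\<Sum>l\<in>UNIV. (cmod (F x0 $ l))\<^sup>2) \<le> (\<Sum>l\<in>UNIV. (cmod (F x $ l))\<^sup>2) * (\<Prod>k\<in>UNIV. \<eta> r x0 k x) ^ p \<and>
    (\<forall>i. (\<forall>l. cmod (F x $ l) \<le> cmod (F x $ i)) \<longrightarrow>
      (\<forall>k l. cmod (partial_deriv k (\<lambda>x. F x $ l) x * F x $ i - F x $ l * partial_deriv k (\<lambda>x. F x $ i) x)
        \<le> 2 * sqrt (2 * p * CARD('n)) / (r k * \<eta> r x0 k x) * (cmod (F x $ i))\<^sup>2))"
proof -
  define P where "P = {x. \<forall>k. cmod (x $ k - x0 $ k) \<le> r k}"
  define e where "e = \<eta> r x0"
  define q where "q = (\<lambda>x. \<Sum>l\<in>UNIV. (cmod (F x $ l))\<^sup>2)"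
  define \<phi> where "\<phi> = (\<lambda>x. q x * (\<Prod>k\<in>UNIV. e k x) ^ p)"
  have contF: "continuous_on P (\<lambda>x. F x $ l)" for l
    using sep_holomorphic_on_continuous[OF hol] sub continuous_on_subset unfolding P_def by blast
  have "continuous_on P \<phi>"
    unfolding \<phi>_def q_def e_def \<eta>_def using r by (intro continuous_intros contF) (auto simp: less_imp_neq[symmetric])
  moreover have "x0 \<in> P" using r by (auto simp: P_def intro: less_imp_le)
  ultimately obtain x where x: "x \<in> P" "\<And>y. y \<in> P \<Longrightarrow> \<phi> y \<le> \<phi> x"
    using continuous_attains_sup[of P \<phi>] compact_polydisc[of x0 r] unfolding P_def by blast
  have "\<phi> x0 = q x0" by (simp add: \<phi>_def e_def \<eta>_def)
  moreover have "q x0 > 0"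
  proof -
    obtain l where "F x0 $ l \<noteq> 0" using F0 by (auto simp: vec_eq_iff)
    then show ?thesis unfolding q_def by (intro sum_pos2[of _ l]) auto
  qed
  ultimately have pos: "\<phi> x > 0" and le: "q x0 \<le> \<phi> x"
    using x(2)[OF \<open>x0 \<in> P\<close>] by auto
  have nonneg: "e k y \<ge> 0" if "y \<in> P" for k y
  proof -
    have "(cmod (y $ k - x0 $ k))\<^sup>2 \<le> (r k)\<^sup>2" using that by (intro power_mono) (auto simp: P_def)
    then show ?thesis using r[of k] by (simp add: e_def \<eta>_def)
  qed
  have epos: "e k x > 0" for k
  proof -
    have "e k x \<noteq> 0"
    proof
      assume "e k x = 0"
      then have "(\<Prod>k\<in>UNIV. e k x) = 0" by (intro prod_zero) auto
      then have "(\<Prod>k\<in>UNIV. e k x) ^ p = 0" using p by (simp only: zero_power)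
      then have "\<phi> x = q x * 0" unfolding \<phi>_def by (simp only:)
      then show False using pos by simp
    qed
    then show ?thesis using nonneg[OF x(1), of k] by simp
  qed
  have strict: "cmod (x $ k - x0 $ k) < r k" for k
  proof (rule ccontr)
    assume "\<not> ?thesis"
    then have "cmod (x $ k - x0 $ k) = r k" using x(1) by (auto simp: P_def intro: antisym)
    then show False using epos[of k] r[of k] by (simp add: e_def \<eta>_def)
  qed
  have Fx: "F x \<noteq> 0" using pos by (auto simp: \<phi>_def q_def)
  have main: "cmod (partial_deriv k (\<lambda>x. F x $ l) x * F x $ i - F x $ l * partial_deriv k (\<lambda>x. F x $ i) x)
        \<le> 2 * sqrt (2 * p * CARD('n)) / (r k * e k x) * (cmod (F x $ i))\<^sup>2"
    if big: "\<forall>l. cmod (F x $ l) \<le> cmod (F x $ i)" for i k l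
  proof -
    define \<zeta> where "\<zeta> = x $ k - x0 $ k"
    define \<epsilon> where "\<epsilon> = r k - cmod \<zeta>"
    have \<epsilon>: "\<epsilon> > 0" using strict[of k] by (simp add: \<epsilon>_def \<zeta>_def)
    have inP: "x + axis k h \<in> P" if "cmod h < \<epsilon>" for h
    proof -
      have "cmod ((x + axis k h) $ m - x0 $ m) \<le> r m" for m
      proof (cases "m = k")
        case True
        have "cmod (\<zeta> + h) \<le> r k" using that norm_triangle_ineq[of \<zeta> h] by (simp add: \<epsilon>_def)
        then show ?thesis using True by (simp add: \<zeta>_def algebra_simps)
      next
        case False
        then show ?thesis using strict[of m] by (simp add: axis_def)
      qed
      then show ?thesis by (simp add: P_def)
    qed
    define g where "g = (\<lambda>l h. F (x + axis k h) $ l)"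
    have dg: "deriv (g l) 0 = partial_deriv k (\<lambda>x. F x $ l) x" for l
      by (simp add: g_def partial_deriv_def)
    have "cmod (deriv (g l) 0 * g i 0 - g l 0 * deriv (g i) 0)
      \<le> 2 * sqrt (2 * p * CARD('n)) / (r k * (1 - (cmod \<zeta>)\<^sup>2 / (r k)\<^sup>2)) * (cmod (g i 0))\<^sup>2"
    proof (rule wronskian_bound_at_disc_weighted_maximum[OF \<epsilon> _ r])
      show "g l holomorphic_on ball 0 \<epsilon>" for l
        unfolding g_def using inP sub
        by (intro sep_holomorphic_on_slice[OF hol]) (auto simp: P_def)
      show "cmod \<zeta> < r k" using strict[of k] by (simp add: \<zeta>_def)
      show "cmod (g l 0) \<le> cmod (g i 0)" for l using big by (simp add: g_def)
      fix h assume h: "cmod h < \<epsilon>"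
      \<comment> \<open>Along axis \<open>k\<close> the other factors of the weight are a positive
        constant, which cancels.\<close>
      define W where "W = (\<Prod>m\<in>UNIV - {k}. e m x) ^ p"
      have W: "W > 0" unfolding W_def using epos by (intro zero_less_power prod_pos) auto
      have "\<phi> (x + axis k h) = q (x + axis k h) * (1 - (cmod (\<zeta> + h))\<^sup>2 / (r k)\<^sup>2) ^ p * W"
      proof -
        have "(\<Prod>m\<in>UNIV. e m (x + axis k h)) = e k (x + axis k h) * (\<Prod>m\<in>UNIV - {k}. e m x)"
          by (subst prod.remove[of _ k]) (auto simp: e_def \<eta>_def axis_def intro!: prod.cong)
        moreover have "e k (x + axis k h) = 1 - (cmod (\<zeta> + h))\<^sup>2 / (r k)\<^sup>2"
          by (simp add: e_def \<eta>_def \<zeta>_def algebra_simps)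
        ultimately show ?thesis by (simp add: \<phi>_def W_def power_mult_distrib)
      qed
      moreover have "\<phi> x = q x * (1 - (cmod \<zeta>)\<^sup>2 / (r k)\<^sup>2) ^ p * W"
        unfolding \<phi>_def W_def
        by (subst prod.remove[of _ k]) (auto simp: e_def \<eta>_def \<zeta>_def power_mult_distrib)
      ultimately have "q (x + axis k h) * (1 - (cmod (\<zeta> + h))\<^sup>2 / (r k)\<^sup>2) ^ p * W \<le> q x * (1 - (cmod \<zeta>)\<^sup>2 / (r k)\<^sup>2) ^ p * W"
        using x(2)[OF inP[OF h]] by simp
      then show "(\<Sum>l\<in>UNIV. (cmod (g l h))\<^sup>2) * (1 - (cmod (\<zeta> + h))\<^sup>2 / (r k)\<^sup>2) ^ p
        \<le> (\<Sum>l\<in>UNIV. (cmod (g l 0))\<^sup>2) * (1 - (cmod \<zeta>)\<^sup>2 / (r k)\<^sup>2) ^ p"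
        using W by (simp add: q_def g_def)
    qed
    then show ?thesis unfolding dg by (simp add: g_def e_def \<eta>_def \<zeta>_def)
  qed
  show ?thesis
    using strict Fx le main unfolding q_def \<phi>_def e_def by (intro exI[of _ x]) auto
qed

lemma norm_det_le:
  fixes M :: "complex ^ 'n::finite ^ 'n"
  assumes "\<And>k j. cmod (M $ k $ j) \<le> b k"
  shows "cmod (det M) \<le> fact CARD('n) * prod b UNIV"
proof -
  have "cmod (det M) \<le> (\<Sum>p | p permutes (UNIV :: 'n set). prod b UNIV)"
    unfolding det_def
  proof (rule sum_norm_le)
    fix p assume "p \<in> {p. p permutes (UNIV :: 'n set)}"
    have "cmod (of_int (sign p) * (\<Prod>i\<in>UNIV. M $ i $ p i)) = (\<Prod>i\<in>UNIV. cmod (M $ i $ p i))"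
      by (simp add: norm_mult prod_norm sign_def)
    also have "\<dots> \<le> prod b UNIV" by (intro prod_mono) (auto simp: assms)
    finally show "cmod (of_int (sign p) * (\<Prod>i\<in>UNIV. M $ i $ p i)) \<le> prod b UNIV" .
  qed
  also have "\<dots> = fact CARD('n) * prod b UNIV"
    by (simp add: card_permutations[OF refl])
  finally show ?thesis .
qed

section \<open>The vector-valued function attached to a family of curves\<close>

definition equation_coeffs :: "complex ^ ('m::finite) option \<Rightarrow> complex ^ 'm" where
  "equation_coeffs x = (\<chi> \<alpha>. x $ Some \<alpha>)"

lemma equation_coeffs_component [simp]: "equation_coeffs x $ \<alpha> = x $ Some \<alpha>"
  by (simp add: equation_coeffs_def)

lemma equation_coeffs_shift_None: "equation_coeffs (x + axis None c) = equation_coeffs x"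
  by (simp add: vec_eq_iff axis_def)

lemma equation_coeffs_shift_Some: "equation_coeffs (x + axis (Some \<alpha>) c) = equation_coeffs x + axis \<alpha> c"
  by (simp add: vec_eq_iff axis_def)

lemma continuous_on_equation_coeffs [continuous_intros]: "continuous_on S equation_coeffs"
  unfolding equation_coeffs_def by (intro continuous_intros)

lemma sep_holomorphic_on_equation_coeffs:
  assumes "sep_holomorphic_on b UNIV"
  shows "sep_holomorphic_on (\<lambda>x. b (equation_coeffs x)) S"
proof (rule sep_holomorphic_onI[where D = "\<lambda>x k. case k of None \<Rightarrow> 0 | Some \<alpha> \<Rightarrow> partial_deriv \<alpha> b (equation_coeffs x)"])
  show "continuous_on S (\<lambda>x. b (equation_coeffs x))"
    by (rule continuous_on_compose2[OF sep_holomorphic_on_continuous[OF assms] continuous_on_equation_coeffs]) auto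
  show "((\<lambda>c. b (equation_coeffs (x + axis k c))) has_field_derivative
      (case k of None \<Rightarrow> 0 | Some \<alpha> \<Rightarrow> partial_deriv \<alpha> b (equation_coeffs x))) (at 0)" for x k
    by (cases k) (auto simp: equation_coeffs_shift_None equation_coeffs_shift_Some intro: sep_holomorphic_onD[OF assms])
qed

definition vec_partial :: "'v::finite \<Rightarrow> (complex ^ 'v \<Rightarrow> complex ^ 'n::finite) \<Rightarrow> complex ^ 'v \<Rightarrow> complex ^ 'n" where
  "vec_partial k L x = (\<chi> l. partial_deriv k (\<lambda>y. L y $ l) x)"

lemma vec_partial_component [simp]: "vec_partial k L x $ l = partial_deriv k (\<lambda>y. L y $ l) x"
  by (simp add: vec_partial_def)

lemma vec_partial_cong:
  assumes "open S" "x \<in> S" "\<And>y. y \<in> S \<Longrightarrow> g y = h y"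
  shows "vec_partial k g x = vec_partial k h x"
  unfolding vec_eq_iff vec_partial_component
  by (intro allI partial_deriv_cong[OF assms(1,2)]) (simp add: assms(3))

lemma vec_partial_scale:
  assumes "sep_holomorphic_on \<mu> S" "\<And>l. sep_holomorphic_on (\<lambda>x. L x $ l) S" "x \<in> S"
  shows "vec_partial k (\<lambda>x. \<mu> x *s L x) x = \<mu> x *s vec_partial k L x + partial_deriv k \<mu> x *s L x"
  by (simp add: vec_eq_iff partial_deriv_mult[OF assms(1,2,3)] add.commute)

text \<open>
  A holomorphic map to projective space, given by its lifts \<open>A i\<close> with \<open>i\<close>-th coordinate \<open>1\<close>. The
  variable \<open>None\<close> is the one of the entire curves, the others are the coefficients of the equation.
\<close>

locale curve_family =
  fixes D :: "'n::finite \<Rightarrow> (complex ^ ('n, 'd::finite) multi_index option) set"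
    and A :: "'n \<Rightarrow> complex ^ ('n, 'd) multi_index option \<Rightarrow> complex ^ 'n"
  assumes open_D: "open (D i)"
    and holomorphic_A: "sep_holomorphic_on (\<lambda>x. A i x $ l) (D i)"
    and A_diag: "x \<in> D i \<Longrightarrow> A i x $ i = 1"
    and D_iff: "x \<in> D i \<Longrightarrow> x \<in> D k \<longleftrightarrow> A i x $ k \<noteq> 0"
    and A_change: "x \<in> D i \<Longrightarrow> x \<in> D k \<Longrightarrow> A k x = inverse (A i x $ k) *s A i x"
    and A_equation: "x \<in> D i \<Longrightarrow> hypersurface_eq (A i x) (equation_coeffs x) = 0"
    and entire: "x \<in> (\<Union>i. D i) \<Longrightarrow> x + axis None c \<in> (\<Union>i. D i)"
    and degree: "CARD('d) \<ge> 2 * (CARD('n) - 1)"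
begin

abbreviation grad :: "'n \<Rightarrow> complex ^ ('n, 'd) multi_index option \<Rightarrow> complex ^ 'n" where
  "grad i x \<equiv> hyp_grad (A i x) (equation_coeffs x)"

text \<open>Euler's relation: the equation vanishes along the whole ray through the lift.\<close>

lemma pairing_grad_self:
  assumes "x \<in> D i"
  shows "pairing (grad i x) (A i x) = 0"
proof -
  have "((\<lambda>c. hypersurface_eq ((1 + c) *s A i x) (equation_coeffs x)) has_field_derivative
    pairing (hyp_grad ((1 + 0) *s A i x) (equation_coeffs x)) (A i x) +
      (\<Sum>\<alpha>\<in>UNIV. (0 :: complex ^ ('n, 'd) multi_index) $ \<alpha> * monomial ((1 + 0) *s A i x) \<alpha>)) (at 0)"
    by (rule has_field_derivative_hypersurface_eq[where L = "\<lambda>c. (1 + c) *s A i x" and a = "\<lambda>_. equation_coeffs x"])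
      (auto intro!: derivative_eq_intros)
  moreover have "hypersurface_eq ((1 + c) *s A i x) (equation_coeffs x) = 0" for c
    using hypersurface_eq_scale[of "1 + c" "A i x" 1 "equation_coeffs x"] A_equation[OF assms] by simp
  ultimately have "((\<lambda>c. 0) has_field_derivative pairing (grad i x) (A i x)) (at 0)" by simp
  then show ?thesis using DERIV_const DERIV_unique by blast
qed

text \<open>\<open>A_equation\<close> holds on an open set and can be differentiated in every
  variable. A coefficient enters both through the lift and directly, and the direct part contributes
  its monomial.\<close>

lemma derivative_equation:
  assumes x: "x \<in> D i"
  shows "pairing (grad i x) (vec_partial k (A i) x)
    + (\<Sum>\<alpha>\<in>UNIV. (if k = Some \<alpha> then 1 else 0) * monomial (A i x) \<alpha>) = 0"
proof -
  define a' :: "complex ^ ('n, 'd) multi_index" where "a' = (\<chi> \<alpha>. if k = Some \<alpha> then 1 else 0)"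
  have "((\<lambda>c. hypersurface_eq (A i (x + axis k c)) (equation_coeffs (x + axis k c))) has_field_derivative
    pairing (hyp_grad (A i (x + axis k 0)) (equation_coeffs (x + axis k 0))) (vec_partial k (A i) x) +
      (\<Sum>\<alpha>\<in>UNIV. a' $ \<alpha> * monomial (A i (x + axis k 0)) \<alpha>)) (at 0)"
  proof (rule has_field_derivative_hypersurface_eq)
    show "((\<lambda>c. A i (x + axis k c) $ l) has_field_derivative vec_partial k (A i) x $ l) (at 0)" for l
      using sep_holomorphic_onD[OF holomorphic_A x] by simp
    show "((\<lambda>c. equation_coeffs (x + axis k c) $ \<alpha>) has_field_derivative a' $ \<alpha>) (at 0)" for \<alpha>
      by (auto simp: axis_def a'_def intro!: derivative_eq_intros)
  qed
  moreover have "\<forall>\<^sub>F c in nhds 0. hypersurface_eq (A i (x + axis k c)) (equation_coeffs (x + axis k c)) = 0"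
    using eventually_shift_axis[OF open_D x, of k] by eventually_elim (rule A_equation)
  ultimately have "((\<lambda>c. 0) has_field_derivative
    pairing (hyp_grad (A i (x + axis k 0)) (equation_coeffs (x + axis k 0))) (vec_partial k (A i) x) +
      (\<Sum>\<alpha>\<in>UNIV. a' $ \<alpha> * monomial (A i (x + axis k 0)) \<alpha>)) (at 0)"
    by (subst (asm) DERIV_cong_ev[OF refl _ refl])
  then have "pairing (hyp_grad (A i (x + axis k 0)) (equation_coeffs (x + axis k 0))) (vec_partial k (A i) x) +
      (\<Sum>\<alpha>\<in>UNIV. a' $ \<alpha> * monomial (A i (x + axis k 0)) \<alpha>) = 0"
    using DERIV_const DERIV_unique by blast
  then show ?thesis by (simp add: a'_def)
qed

lemma pairing_grad_None: "x \<in> D i \<Longrightarrow> pairing (grad i x) (vec_partial None (A i) x) = 0"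
  using derivative_equation[of x i None] by simp

lemma pairing_grad_Some: "x \<in> D i \<Longrightarrow> pairing (grad i x) (vec_partial (Some \<beta>) (A i) x) = - monomial (A i x) \<beta>"
  using derivative_equation[of x i "Some \<beta>"] by (simp add: mult_delta_left eq_neg_iff_add_eq_0)

lemma pairing_grad_pure:
  assumes "x \<in> D i"
  shows "pairing (grad i x) (vec_partial (Some (pure_power i)) (A i) x) = - 1"
  using pairing_grad_Some[OF assms] A_diag[OF assms] by (simp add: monomial_pure_power)

lemma grad_nonzero: "x \<in> D i \<Longrightarrow> grad i x \<noteq> 0"
  using pairing_grad_pure[of x i] by (auto simp: pairing_def)

text \<open>The product rule for the transition factor. The value of \<open>\<nu>\<close> does not
  matter: in a determinant that also has the row \<open>A i x\<close> it is only a shear.\<close>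

lemma vec_partial_change:
  assumes "x \<in> D i" "x \<in> D k"
  shows "\<exists>\<nu>. vec_partial m (A k) x = inverse (A i x $ k) *s vec_partial m (A i) x + \<nu> *s A i x"
proof -
  let ?S = "D i \<inter> D k"
  have S: "open ?S" "x \<in> ?S" using open_D assms by auto
  have hA: "sep_holomorphic_on (\<lambda>x. A i x $ l) ?S" for l
    by (rule sep_holomorphic_on_subset[OF holomorphic_A]) auto
  have "sep_holomorphic_on (\<lambda>x. inverse (A i x $ k)) ?S"
    by (rule sep_holomorphic_on_inverse[OF hA]) (use D_iff in auto)
  from vec_partial_scale[OF this hA S(2), of m]
  have "vec_partial m (\<lambda>x. inverse (A i x $ k) *s A i x) x = inverse (A i x $ k) *s vec_partial m (A i) x
      + partial_deriv m (\<lambda>x. inverse (A i x $ k)) x *s A i x" .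
  moreover have "vec_partial m (A k) x = vec_partial m (\<lambda>x. inverse (A i x $ k) *s A i x) x"
    by (rule vec_partial_cong[OF S]) (use A_change in auto)
  ultimately have "vec_partial m (A k) x = inverse (A i x $ k) *s vec_partial m (A i) x
      + partial_deriv m (\<lambda>x. inverse (A i x $ k)) x *s A i x" by (simp only:)
  then show ?thesis by blast
qed

end

text \<open>
  The section of the anticanonical bundle of the fibers obtained by contracting the Jacobian
  of the map with \<open>n - 2\<close> tangent fields. Multiplication by a power of a
  coordinate leaves a section of the tautological bundle, that is, a vector-valued function.
\<close>

locale framed_curve_family = curve_family D A
  for D :: "'n::finite \<Rightarrow> (complex ^ ('n, 'd::finite) multi_index option) set"
    and A :: "'n \<Rightarrow> complex ^ ('n, 'd) multi_index option \<Rightarrow> complex ^ 'n" +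
  fixes i0 i1 i2 i3 :: 'n and C :: "'n \<Rightarrow> complex ^ 'n"
    and B :: "'n \<Rightarrow> ('n, 'd) multi_index \<Rightarrow> 'n \<Rightarrow> complex ^ ('n, 'd) multi_index \<Rightarrow> complex"
  assumes distinct: "i1 \<noteq> i2" "i1 \<noteq> i3" "i2 \<noteq> i3"
    and tangent: "k \<notin> {i1, i2, i3} \<Longrightarrow> tangent_field i0 (C k) (B k)"
begin

text \<open>All rows except \<open>i3\<close> lie in the kernel of the gradient, so row
  \<open>i3\<close> enters the determinant only through its pairing with the gradient, which is
  \<open>- 1\<close> for \<open>m = i\<close>. The index \<open>m\<close> is independent of the
  chart \<open>i\<close> so that frames in different charts can be compared with the same
  transversal direction.\<close>

definition frame :: "'n \<Rightarrow> 'n \<Rightarrow> complex ^ ('n, 'd) multi_index option \<Rightarrow> 'n \<Rightarrow> complex ^ 'n" where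
  "frame i m x k = (if k = i1 then A i x else if k = i2 then vec_partial None (A i) x
     else if k = i3 then vec_partial (Some (pure_power m)) (A i) x
     else field_value i0 (C k) (B k) (equation_coeffs x) (A i x) (\<lambda>\<beta>. vec_partial (Some \<beta>) (A i) x))"

lemma pairing_frame:
  assumes "x \<in> D i" "k \<noteq> i3"
  shows "pairing (grad i x) (frame i m x k) = 0"
  using assms pairing_grad_self pairing_grad_None pairing_field_value[OF tangent[of k] pairing_grad_Some]
  by (simp add: frame_def)

text \<open>The two candidates for row \<open>i3\<close> have proportional pairings with the
  gradient. Their difference, after scaling, lies in the kernel with all the other rows and
  contributes a zero determinant.\<close>

lemma det_frame_pure_power:
  assumes x: "x \<in> D i"
  shows "det (\<chi> k. frame i m x k) = (A i x $ m) ^ CARD('d) * det (\<chi> k. frame i i x k)"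
proof -
  define t where "t = (A i x $ m) ^ CARD('d)"
  define u w where "u = vec_partial (Some (pure_power m)) (A i) x" and "w = vec_partial (Some (pure_power i)) (A i) x"
  define y where "y = u + (- t) *s w"
  have rows: "frame i m x k = (if k = i3 then y + t *s w else frame i i x k)" for k
    using distinct by (simp add: frame_def y_def u_def w_def)
  have "det (\<chi> k. if k = i3 then y else frame i i x k) = 0"
  proof (rule det_eq_0_if_common_kernel[OF grad_nonzero[OF x]])
    fix k
    have "pairing (grad i x) y = pairing (grad i x) u + (- t) * pairing (grad i x) w"
      unfolding y_def by (simp only: pairing_add pairing_scale)
    also have "\<dots> = 0"
      unfolding u_def w_def pairing_grad_Some[OF x] by (simp add: monomial_pure_power t_def A_diag[OF x])
    finally have "pairing (grad i x) y = 0" .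
    then show "pairing (grad i x) (if k = i3 then y else frame i i x k) = 0"
      using pairing_frame[OF x] by simp
  qed
  moreover have "(\<chi> k. if k = i3 then w else frame i i x k) = (\<chi> k. frame i i x k)"
    using distinct by (auto simp: frame_def w_def vec_eq_iff)
  moreover have "det (\<chi> k. frame i m x k) = det (\<chi> k. if k = i3 then y else frame i i x k) +
      t * det (\<chi> k. if k = i3 then w else frame i i x k)"
    unfolding rows det_row_add[of i3] det_row_mul[of i3] ..
  ultimately show ?thesis by (simp add: t_def)
qed

text \<open>Three rows of weight 1 and \<open>CARD('n) - 3\<close> rows of weight 2 give
  \<open>2 * CARD('n) - 3\<close>, which is \<open>2 * n - 1\<close>. The power
  \<open>CARD('d)\<close> on the left comes from changing the transversal direction from
  \<open>pure_power k\<close> to \<open>pure_power i\<close>.\<close>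

lemma det_frame_change:
  assumes x: "x \<in> D i" "x \<in> D k"
  defines "\<mu> \<equiv> inverse (A i x $ k)"
  shows "\<mu> ^ CARD('d) * det (\<chi> l. frame k k x l) = \<mu> ^ (2 * CARD('n) - 3) * det (\<chi> l. frame i i x l)"
proof -
  have \<mu>0: "\<mu> \<noteq> 0" using D_iff[OF x(1)] x(2) by (simp add: \<mu>_def)
  obtain e where e: "\<And>m. vec_partial m (A k) x = \<mu> *s vec_partial m (A i) x + e m *s A i x"
    using choice[of "\<lambda>m \<nu>. vec_partial m (A k) x = \<mu> *s vec_partial m (A i) x + \<nu> *s A i x"]
      vec_partial_change[OF x] unfolding \<mu>_def by blast
  define \<nu> where "\<nu> = (\<lambda>l. if l = i1 then 0 else if l = i2 then e None else if l = i3 then e (Some (pure_power k))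
    else \<mu> * (\<Sum>\<beta>\<in>UNIV. (\<Sum>p\<in>UNIV. B l \<beta> p (equation_coeffs x) * A i x $ p) * e (Some \<beta>)))"
  define c where "c = (\<lambda>l. if l \<in> {i1, i2, i3} then \<mu> else \<mu>\<^sup>2)"
  have Ak: "A k x = \<mu> *s A i x" unfolding \<mu>_def by (rule A_change[OF x])
  have row: "frame k k x l = c l *s frame i k x l + \<nu> l *s frame i k x i1" for l
    unfolding frame_def c_def \<nu>_def e Ak field_value_scale using distinct by simp
  have "\<nu> i1 = 0" "c i1 \<noteq> 0" using \<mu>0 by (simp_all add: \<nu>_def c_def)
  then have "det (\<chi> l. frame k k x l) = prod c UNIV * det (\<chi> l. frame i k x l)"
    unfolding row by (rule det_scale_and_shear)
  also have "prod c UNIV = \<mu> ^ (2 * CARD('n) - 3)"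
  proof -
    have card3: "card {i1, i2, i3} = 3" using distinct by simp
    then have le: "3 \<le> CARD('n)" using card_mono[of UNIV "{i1, i2, i3}"] by simp
    have "prod c UNIV = prod c {i1, i2, i3} * prod c (UNIV - {i1, i2, i3})"
      using prod.subset_diff[of "{i1, i2, i3}" UNIV c] by (simp only: subset_UNIV finite mult.commute simp_thms)
    also have "prod c {i1, i2, i3} = (\<Prod>l\<in>{i1, i2, i3}. \<mu>)"
      by (rule prod.cong) (auto simp: c_def)
    also have "\<dots> = \<mu> ^ 3" using card3 by (simp only: prod_constant)
    also have "prod c (UNIV - {i1, i2, i3}) = (\<Prod>l\<in>UNIV - {i1, i2, i3}. \<mu>\<^sup>2)"
      by (rule prod.cong) (auto simp: c_def)
    also have "\<dots> = (\<mu>\<^sup>2) ^ (CARD('n) - 3)" using card3 by (simp only: prod_constant card_Diff_subset finite subset_UNIV)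
    also have "\<mu> ^ 3 * (\<mu>\<^sup>2) ^ (CARD('n) - 3) = \<mu> ^ (3 + 2 * (CARD('n) - 3))" by (simp only: power_add power_mult)
    also have "3 + 2 * (CARD('n) - 3) = 2 * CARD('n) - 3" using le by simp
    finally show ?thesis .
  qed
  also have "det (\<chi> l. frame i k x l) = inverse \<mu> ^ CARD('d) * det (\<chi> l. frame i i x l)"
    using det_frame_pure_power[OF x(1), of k] by (simp add: \<mu>_def)
  finally have *: "det (\<chi> l. frame k k x l) = \<mu> ^ (2 * CARD('n) - 3) * (inverse \<mu> ^ CARD('d) * det (\<chi> l. frame i i x l))" .
  have "\<mu> ^ CARD('d) * inverse \<mu> ^ CARD('d) = 1"
    unfolding power_mult_distrib[symmetric] right_inverse[OF \<mu>0] by (rule power_one)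
  moreover have "p * (q * (r * z)) = (p * r) * (q * z)" for p q r z :: complex
    by (simp only: mult_ac)
  ultimately show ?thesis unfolding * by (simp only: mult_1)
qed

text \<open>The exponent is \<open>d - 2 * n\<close>, a genuine difference by \<open>degree\<close>.
  The vector \<open>A i x\<close> takes up the last unit of weight.\<close>

definition local_section :: "'n \<Rightarrow> complex ^ ('n, 'd) multi_index option \<Rightarrow> complex ^ 'n" where
  "local_section i x = (det (\<chi> k. frame i i x k) * (A i x $ i0) ^ (CARD('d) - 2 * (CARD('n) - 1))) *s A i x"

lemma local_section_change:
  assumes x: "x \<in> D i" "x \<in> D k"
  shows "local_section k x = local_section i x"
proof -
  define \<mu> where "\<mu> = inverse (A i x $ k)"
  have \<mu>0: "\<mu> \<noteq> 0" using D_iff[OF x(1)] x(2) by (simp add: \<mu>_def)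
  define e where "e = CARD('d) - 2 * (CARD('n) - 1)"
  have "card {i1, i2, i3} = 3" using distinct by simp
  then have "3 \<le> CARD('n)" using card_mono[of UNIV "{i1, i2, i3}"] by simp
  \<comment> \<open>The degree splits into the weight of the determinant, \<open>e\<close> factors
    for the power of coordinate \<open>i0\<close>, and one for the vector.\<close>
  then have d: "CARD('d) = (2 * CARD('n) - 3) + Suc e" using degree unfolding e_def by linarith
  have "\<mu> ^ CARD('d) = \<mu> ^ (2 * CARD('n) - 3) * \<mu> ^ Suc e" by (subst d) (rule power_add)
  then have "\<mu> ^ (2 * CARD('n) - 3) * (\<mu> ^ Suc e * det (\<chi> l. frame k k x l)) = \<mu> ^ (2 * CARD('n) - 3) * det (\<chi> l. frame i i x l)"
    using det_frame_change[OF x] unfolding \<mu>_def[symmetric] by (simp only: mult.assoc)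
  then have *: "\<mu> ^ Suc e * det (\<chi> l. frame k k x l) = det (\<chi> l. frame i i x l)"
    using \<mu>0 by (simp only: mult_cancel_left power_eq_0_iff simp_thms)
  have Ak: "A k x = \<mu> *s A i x" unfolding \<mu>_def by (rule A_change[OF x])
  show ?thesis
    unfolding local_section_def e_def[symmetric] *[symmetric] Ak
    by (simp add: vector_smult_assoc power_mult_distrib mult_ac)
qed

definition global_section :: "complex ^ ('n, 'd) multi_index option \<Rightarrow> complex ^ 'n" where
  "global_section x = local_section (SOME i. x \<in> D i) x"

lemma global_section_eq:
  assumes "x \<in> D i"
  shows "global_section x = local_section i x"
  unfolding global_section_def using local_section_change[OF assms] someI[of "\<lambda>i. x \<in> D i", OF assms] .

lemma holomorphic_frame: "sep_holomorphic_on (\<lambda>x. frame i i x k $ l) (D i)"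
proof -
  have d: "sep_holomorphic_on (\<lambda>x. vec_partial m (A i) x $ l) (D i)" for m l
    using sep_holomorphic_on_partial_deriv[OF open_D holomorphic_A] by simp
  show ?thesis
  proof (cases "k \<in> {i1, i2, i3}")
    case True
    then show ?thesis using d holomorphic_A distinct by (auto simp: frame_def)
  next
    case False
    have b: "sep_holomorphic_on (\<lambda>x. B k \<beta> p (equation_coeffs x)) (D i)" for \<beta> p
      using tangent[OF False] by (intro sep_holomorphic_on_equation_coeffs) (simp add: tangent_field_def)
    have "frame i i x k $ l = (A i x $ i0)\<^sup>2 * C k $ l
      + (\<Sum>\<beta>\<in>UNIV. (\<Sum>p\<in>UNIV. B k \<beta> p (equation_coeffs x) * A i x $ p) * vec_partial (Some \<beta>) (A i) x $ l)" for x
      using False by (simp add: frame_def field_value_def)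
    then show ?thesis
      by (simp only:) (intro sep_holomorphic_intros holomorphic_A b d)
  qed
qed

lemma holomorphic_global_section: "sep_holomorphic_on (\<lambda>x. global_section x $ l) (\<Union>i. D i)"
proof (rule sep_holomorphic_on_local)
  fix x assume "x \<in> (\<Union>i. D i)"
  then obtain i where i: "x \<in> D i" by blast
  have "sep_holomorphic_on (\<lambda>x. local_section i x $ l) (D i)"
    unfolding local_section_def vector_smult_component
    by (rule sep_holomorphic_on_mult sep_holomorphic_on_det sep_holomorphic_on_power holomorphic_A)+
      (simp_all add: holomorphic_frame holomorphic_A sep_holomorphic_on_power)
  then show "\<exists>V h. open V \<and> x \<in> V \<and> sep_holomorphic_on h V \<and> (\<forall>y\<in>V. global_section y $ l = h y)"
    using open_D i global_section_eq by (intro exI[of _ "D i"] exI[of _ "\<lambda>x. local_section i x $ l"]) auto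
qed

end

section \<open>Size of the section at a weighted maximum, and its vanishing\<close>

context framed_curve_family
begin

text \<open>The velocity fills exactly one row of the determinant, so the bound has one factor
  \<open>\<epsilon>\<close>; all other rows are controlled by the derivatives in the
  coefficients.\<close>

lemma norm_global_section_le:
  fixes \<epsilon> M K :: real
  assumes x: "x \<in> D i"
    and A1: "\<And>l. cmod (A i x $ l) \<le> 1"
    and \<epsilon>: "\<And>l. cmod (vec_partial None (A i) x $ l) \<le> \<epsilon>"
    and M: "\<And>\<beta> l. cmod (vec_partial (Some \<beta>) (A i) x $ l) \<le> M" "M \<ge> 1"
    and K: "\<And>k l. cmod (C k $ l) \<le> K" "\<And>k \<beta> l. k \<notin> {i1, i2, i3} \<Longrightarrow> cmod (B k \<beta> l (equation_coeffs x)) \<le> K" "K \<ge> 1"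
  shows "cmod (global_section x $ l) \<le>
    fact CARD('n) * \<epsilon> * ((1 + CARD(('n, 'd) multi_index) * CARD('n)) * K * M) ^ (CARD('n) - 1)"
proof -
  \<comment> \<open>A field row consists of one constant vector term and \<open>CARD('n)\<close>
    terms for every multi-index, each at most \<open>K * M\<close>.\<close>
  define K' where "K' = (1 + CARD(('n, 'd) multi_index) * CARD('n)) * K"
  have "K \<le> (1 + CARD(('n, 'd) multi_index) * CARD('n)) * K"
    using mult_right_mono[of 1 "real (1 + CARD(('n, 'd) multi_index) * CARD('n))" K] K(3) by simp
  then have K'K: "K' \<ge> K" by (simp add: K'_def)
  then have K'M1: "M \<le> K' * M"
    using K(3) M(2) mult_right_mono[of 1 K' M] by simp
  then have K'M: "M \<le> K' * M" "1 \<le> K' * M"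
    using M(2) by linarith+
  have \<epsilon>0: "\<epsilon> \<ge> 0" using \<epsilon>[of l] norm_ge_zero order_trans by blast
  have "cmod (frame i i x k $ j) \<le> (if k = i2 then \<epsilon> else K' * M)" for k j
  proof (cases "k \<in> {i1, i2, i3}")
    case True
    then consider "k = i1" | "k = i2" | "k = i3" by blast
    then show ?thesis
    proof cases
      case 1
      then show ?thesis using A1[of j] K'M(2) distinct by (simp add: frame_def)
    next
      case 2
      then show ?thesis using \<epsilon>[of j] distinct by (simp add: frame_def)
    next
      case 3
      then show ?thesis using M(1)[of "pure_power i" j] K'M(1) distinct by (simp add: frame_def)
    qed
  next
    case False
    have "cmod ((A i x $ i0)\<^sup>2 * C k $ j) \<le> K * M"
    proof -
      have "cmod ((A i x $ i0)\<^sup>2) \<le> 1" using A1[of i0] by (simp add: norm_power power_le_one)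
      then have "cmod ((A i x $ i0)\<^sup>2) * cmod (C k $ j) \<le> 1 * K" using K(1) by (intro mult_mono) auto
      also have "\<dots> \<le> K * M" using mult_left_mono[of 1 M K] K(3) M(2) by simp
      finally show ?thesis by (simp add: norm_mult)
    qed
    moreover have "cmod (\<Sum>\<beta>\<in>UNIV. (\<Sum>p\<in>UNIV. B k \<beta> p (equation_coeffs x) * A i x $ p) * vec_partial (Some \<beta>) (A i) x $ j)
      \<le> (\<Sum>\<beta>\<in>(UNIV :: ('n, 'd) multi_index set). (\<Sum>p\<in>(UNIV :: 'n set). K * 1) * M)"
    proof (rule sum_norm_le)
      fix \<beta> :: "('n, 'd) multi_index"
      have "cmod (\<Sum>p\<in>UNIV. B k \<beta> p (equation_coeffs x) * A i x $ p) \<le> (\<Sum>p\<in>(UNIV :: 'n set). K * 1)"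
      proof (rule sum_norm_le)
        show "cmod (B k \<beta> p (equation_coeffs x) * A i x $ p) \<le> K * 1" for p
          unfolding norm_mult using K(2)[OF False] A1 K(3) by (intro mult_mono) auto
      qed
      then show "cmod ((\<Sum>p\<in>UNIV. B k \<beta> p (equation_coeffs x) * A i x $ p) * vec_partial (Some \<beta>) (A i) x $ j)
        \<le> (\<Sum>p\<in>(UNIV :: 'n set). K * 1) * M"
        unfolding norm_mult using M K(3) by (intro mult_mono) (auto simp del: vec_partial_component)
    qed
    ultimately have "cmod ((A i x $ i0)\<^sup>2 * C k $ j
      + (\<Sum>\<beta>\<in>UNIV. (\<Sum>p\<in>UNIV. B k \<beta> p (equation_coeffs x) * A i x $ p) * vec_partial (Some \<beta>) (A i) x $ j))
      \<le> K * M + (\<Sum>\<beta>\<in>(UNIV :: ('n, 'd) multi_index set). (\<Sum>p\<in>(UNIV :: 'n set). K * 1) * M)"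
      by (rule norm_triangle_le[OF add_mono])
    also have "\<dots> = K' * M" by (simp add: K'_def algebra_simps)
    finally show ?thesis using False by (simp add: frame_def field_value_def)
  qed
  then have "cmod (det (\<chi> k. frame i i x k)) \<le> fact CARD('n) * (\<Prod>k\<in>UNIV. if k = i2 then \<epsilon> else K' * M)"
    by (intro norm_det_le) simp
  also have "(\<Prod>k\<in>UNIV. if k = i2 then \<epsilon> else K' * M) = \<epsilon> * (K' * M) ^ (CARD('n) - 1)"
    by (subst prod.remove[of _ i2]) (auto simp: card_Diff_subset)
  finally have det: "cmod (det (\<chi> k. frame i i x k)) \<le> fact CARD('n) * (\<epsilon> * (K' * M) ^ (CARD('n) - 1))" .
  have "cmod (global_section x $ l) =
    cmod (det (\<chi> k. frame i i x k)) * (cmod (A i x $ i0) ^ (CARD('d) - 2 * (CARD('n) - 1)) * cmod (A i x $ l))"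
    by (simp add: global_section_eq[OF x] local_section_def norm_mult norm_power)
  also have "\<dots> \<le> (fact CARD('n) * (\<epsilon> * (K' * M) ^ (CARD('n) - 1))) * (1 * 1)"
    using A1 \<epsilon>0 K'M det by (intro mult_mono power_le_one) auto
  finally show ?thesis by (simp add: K'_def mult_ac)
qed

text \<open>The section is a multiple of the lift, so quotients of its entries are affine
  coordinates and the quotient rule produces Wronskians. This turns bounds at the maximum into
  bounds on the curve.\<close>

lemma partial_chart_eq:
  assumes x: "x \<in> (\<Union>i. D i)" and i: "global_section x $ i \<noteq> 0"
  shows "x \<in> D i" "A i x $ l = global_section x $ l / global_section x $ i"
    "partial_deriv k (\<lambda>x. A i x $ l) x =
      (partial_deriv k (\<lambda>x. global_section x $ l) x * global_section x $ i
        - global_section x $ l * partial_deriv k (\<lambda>x. global_section x $ i) x) / (global_section x $ i)\<^sup>2"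
proof -
  obtain i' where i': "x \<in> D i'" using x by blast
  then have "A i' x $ i \<noteq> 0" using i by (auto simp: global_section_eq local_section_def)
  then show D: "x \<in> D i" using D_iff[OF i'] by simp
  have A: "A i y $ l = global_section y $ l / global_section y $ i" if "y \<in> D i" "global_section y $ i \<noteq> 0" for y
    using that A_diag[OF that(1)] by (simp add: global_section_eq local_section_def)
  then show "A i x $ l = global_section x $ l / global_section x $ i" using D i .
  let ?S = "\<Union>i. D i"
  have S: "open ?S" using open_D by auto
  have "continuous_on ?S (\<lambda>x. global_section x $ i)"
    by (rule sep_holomorphic_on_continuous[OF holomorphic_global_section])
  then have "open (?S \<inter> (\<lambda>x. global_section x $ i) -` (- {0}))"
    using S by (rule continuous_open_preimage) (simp add: open_Compl)
  then have V: "open (D i \<inter> (?S \<inter> (\<lambda>x. global_section x $ i) -` (- {0})))"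
    using open_D by blast
  have "partial_deriv k (\<lambda>x. A i x $ l) x = partial_deriv k (\<lambda>x. global_section x $ l / global_section x $ i) x"
    by (rule partial_deriv_cong[OF V]) (use D i A in auto)
  also have "\<dots> = (partial_deriv k (\<lambda>x. global_section x $ l) x * global_section x $ i
        - global_section x $ l * partial_deriv k (\<lambda>x. global_section x $ i) x) / (global_section x $ i)\<^sup>2"
    by (rule partial_deriv_divide[OF holomorphic_global_section holomorphic_global_section x i])
  finally show "partial_deriv k (\<lambda>x. A i x $ l) x =
      (partial_deriv k (\<lambda>x. global_section x $ l) x * global_section x $ i
        - global_section x $ l * partial_deriv k (\<lambda>x. global_section x $ i) x) / (global_section x $ i)\<^sup>2" .
qed

text \<open>By \<open>entire\<close> the domain is invariant under translation in the variable
  \<open>None\<close>, so a small ball already yields a cylinder that is unbounded in that direction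
  and contains polydiscs of any radius in it.\<close>

lemma exists_cylinder:
  assumes x0: "x0 \<in> (\<Union>i. D i)"
  shows "\<exists>\<delta>>0. \<forall>x. (\<forall>\<alpha>. cmod (x $ Some \<alpha> - x0 $ Some \<alpha>) \<le> \<delta>) \<longrightarrow> x \<in> (\<Union>i. D i)"
proof -
  have "open (\<Union>i. D i)" using open_D by auto
  then obtain e where e: "e > 0" "ball x0 e \<subseteq> (\<Union>i. D i)" using x0 open_contains_ball by blast
  define \<delta> where "\<delta> = e / (CARD(('n, 'd) multi_index option) + 1)"
  have \<delta>: "\<delta> > 0" using e by (simp add: \<delta>_def)
  have "x \<in> (\<Union>i. D i)" if x: "\<forall>\<alpha>. cmod (x $ Some \<alpha> - x0 $ Some \<alpha>) \<le> \<delta>" for x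
  proof -
    \<comment> \<open>The point \<open>x\<close>, translated along the curve to the level of
      \<open>x0\<close>.\<close>
    define y where "y = x + axis None (x0 $ None - x $ None)"
    have y: "y $ k = (case k of None \<Rightarrow> x0 $ None | Some \<alpha> \<Rightarrow> x $ Some \<alpha>)" for k
      by (cases k) (auto simp: y_def axis_def)
    have "cmod ((y - x0) $ k) \<le> \<delta>" for k
      using x \<delta> by (cases k) (auto simp: y)
    then have "(\<Sum>k\<in>UNIV. cmod ((y - x0) $ k)) \<le> (\<Sum>k\<in>(UNIV :: ('n, 'd) multi_index option set). \<delta>)"
      by (intro sum_mono)
    moreover have "norm (y - x0) \<le> (\<Sum>k\<in>UNIV. cmod ((y - x0) $ k))"
      unfolding norm_vec_def by (rule L2_set_le_sum) simp
    moreover have "(\<Sum>k\<in>(UNIV :: ('n, 'd) multi_index option set). \<delta>) < e"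
      using e by (simp add: \<delta>_def field_simps)
    ultimately have "y \<in> ball x0 e" by (simp add: dist_norm norm_minus_commute)
    then have "y \<in> (\<Union>i. D i)" using e by blast
    then have "y + axis None (x $ None - x0 $ None) \<in> (\<Union>i. D i)" by (rule entire)
    moreover have "y + axis None (x $ None - x0 $ None) = x"
      by (simp add: y_def add.assoc axis_add[symmetric])
    ultimately show ?thesis by simp
  qed
  then show ?thesis using \<delta> by blast
qed

text \<open>The fields depend on the coefficients only, and these range over a compact polydisc;
  hence \<open>K\<close> is independent of the radius in the variable \<open>None\<close>.\<close>

lemma exists_bound_on_coefficients:
  "\<exists>K\<ge>1. (\<forall>k l. cmod (C k $ l) \<le> K) \<and>
    (\<forall>x. (\<forall>\<alpha>. cmod (x $ Some \<alpha> - x0 $ Some \<alpha>) \<le> \<delta>) \<longrightarrow>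
      (\<forall>k \<beta> l. k \<notin> {i1, i2, i3} \<longrightarrow> cmod (B k \<beta> l (equation_coeffs x)) \<le> K))"
proof -
  define P where "P = {a. \<forall>\<alpha>. cmod (a $ \<alpha> - equation_coeffs x0 $ \<alpha>) \<le> \<delta>}"
  have compactP: "compact P"
    unfolding P_def using compact_polydisc[of "equation_coeffs x0" "\<lambda>_. \<delta>"] .
  have "\<exists>b. \<forall>a\<in>P. cmod (B k \<beta> l a) \<le> b" if "k \<notin> {i1, i2, i3}" for k \<beta> l
  proof -
    have "continuous_on UNIV (B k \<beta> l)"
      using tangent[OF that] by (simp add: tangent_field_def sep_holomorphic_on_def)
    then have "compact (B k \<beta> l ` P)"
      using compact_continuous_image[OF continuous_on_subset[OF _ subset_UNIV] compactP] by blast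
    then have "bounded (B k \<beta> l ` P)" by (rule compact_imp_bounded)
    then show ?thesis by (auto simp: bounded_iff)
  qed
  then have "\<forall>k \<beta> l. \<exists>b. k \<notin> {i1, i2, i3} \<longrightarrow> (\<forall>a\<in>P. cmod (B k \<beta> l a) \<le> b)" by blast
  then obtain b where b: "\<And>k \<beta> l a. k \<notin> {i1, i2, i3} \<Longrightarrow> a \<in> P \<Longrightarrow> cmod (B k \<beta> l a) \<le> b k \<beta> l" by metis
  define K where "K = 1 + (\<Sum>k\<in>UNIV. \<Sum>\<beta>\<in>UNIV. \<Sum>l\<in>UNIV. \<bar>b k \<beta> l\<bar>) + (\<Sum>k\<in>UNIV. \<Sum>l\<in>UNIV. cmod (C k $ l))"
  have nn: "0 \<le> (\<Sum>k\<in>UNIV. \<Sum>\<beta>\<in>UNIV. \<Sum>l\<in>UNIV. \<bar>b k \<beta> l\<bar>)" "0 \<le> (\<Sum>k\<in>UNIV. \<Sum>l\<in>UNIV. cmod (C k $ l))"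
    by (auto intro!: sum_nonneg)
  have bK: "b k \<beta> l \<le> K" for k \<beta> l
  proof -
    have "b k \<beta> l \<le> \<bar>b k \<beta> l\<bar>" by simp
    also have "\<dots> \<le> (\<Sum>l\<in>UNIV. \<bar>b k \<beta> l\<bar>)" by (rule member_le_sum) auto
    also have "\<dots> \<le> (\<Sum>\<beta>\<in>UNIV. \<Sum>l\<in>UNIV. \<bar>b k \<beta> l\<bar>)"
      by (rule member_le_sum[of \<beta> UNIV "\<lambda>\<beta>. \<Sum>l\<in>UNIV. \<bar>b k \<beta> l\<bar>"]) (auto intro!: sum_nonneg)
    also have "\<dots> \<le> (\<Sum>k\<in>UNIV. \<Sum>\<beta>\<in>UNIV. \<Sum>l\<in>UNIV. \<bar>b k \<beta> l\<bar>)"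
      by (rule member_le_sum[of k UNIV "\<lambda>k. \<Sum>\<beta>\<in>UNIV. \<Sum>l\<in>UNIV. \<bar>b k \<beta> l\<bar>"]) (auto intro!: sum_nonneg)
    finally show ?thesis using nn by (simp add: K_def)
  qed
  have CK: "cmod (C k $ l) \<le> K" for k l
  proof -
    have "cmod (C k $ l) \<le> (\<Sum>l\<in>UNIV. cmod (C k $ l))" by (rule member_le_sum) auto
    also have "\<dots> \<le> (\<Sum>k\<in>UNIV. \<Sum>l\<in>UNIV. cmod (C k $ l))"
      by (rule member_le_sum[of k UNIV "\<lambda>k. \<Sum>l\<in>UNIV. cmod (C k $ l)"]) (auto intro!: sum_nonneg)
    finally show ?thesis using nn by (simp add: K_def)
  qed
  have "K \<ge> 1" using nn by (simp add: K_def)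
  moreover have "cmod (B k \<beta> l (equation_coeffs x)) \<le> K"
    if "\<forall>\<alpha>. cmod (x $ Some \<alpha> - x0 $ Some \<alpha>) \<le> \<delta>" "k \<notin> {i1, i2, i3}" for x k \<beta> l
    using that(1) by (intro order_trans[OF b[OF that(2)] bK]) (simp add: P_def)
  ultimately show ?thesis using CK by blast
qed

lemma global_section_eq_0:
  assumes x0: "x0 \<in> (\<Union>i. D i)"
  shows "global_section x0 = 0"
proof (rule ccontr)
  assume nz: "global_section x0 \<noteq> 0"
  define F where "F = global_section"
  obtain \<delta> where \<delta>: "\<delta> > 0" and cyl: "\<And>x. (\<And>\<alpha>. cmod (x $ Some \<alpha> - x0 $ Some \<alpha>) \<le> \<delta>) \<Longrightarrow> x \<in> (\<Union>i. D i)"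
    using exists_cylinder[OF x0] by blast
  obtain K where K: "K \<ge> 1" "\<And>k l. cmod (C k $ l) \<le> K"
    "\<And>x k \<beta> l. (\<And>\<alpha>. cmod (x $ Some \<alpha> - x0 $ Some \<alpha>) \<le> \<delta>) \<Longrightarrow> k \<notin> {i1, i2, i3} \<Longrightarrow> cmod (B k \<beta> l (equation_coeffs x)) \<le> K"
    using exists_bound_on_coefficients[of x0 \<delta>] by metis
  define N where "N = CARD('n)"
  have N: "N > 0" by (simp add: N_def)
  \<comment> \<open>The square of the determinant bound will contain \<open>E\<close> to the power
    \<open>- 2 * N\<close>; this exponent of the weight cancels it exactly.\<close>
  define p where "p = 2 * N"
  define c0 where "c0 = 2 * sqrt (2 * p * CARD('n))"
  define M where "M = max 1 (c0 / \<delta>)"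
  define Q where "Q = fact N * c0 * ((1 + CARD(('n, 'd) multi_index) * CARD('n)) * K * M) ^ (N - 1)"
  define q0 where "q0 = (\<Sum>l\<in>UNIV. (cmod (F x0 $ l))\<^sup>2)"
  have q0: "q0 > 0"
  proof -
    obtain l where "F x0 $ l \<noteq> 0" using nz by (auto simp: vec_eq_iff F_def)
    then show ?thesis unfolding q0_def by (intro sum_pos2[of _ l]) auto
  qed
  have c0: "c0 \<ge> 0" by (simp add: c0_def)
  have M1: "M \<ge> 1" by (simp add: M_def)
  \<comment> \<open>\<open>Q\<close> and \<open>q0\<close> are fixed before \<open>R\<close>, so
    letting \<open>R\<close> grow is contradictory.\<close>
  have bound: "q0 \<le> N * Q\<^sup>2 / R\<^sup>2" if R: "R > 0" for R
  proof -
    define r where "r = (\<lambda>k :: ('n, 'd) multi_index option. case k of None \<Rightarrow> R | Some \<alpha> \<Rightarrow> \<delta>)"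
    define \<eta> where "\<eta> = (\<lambda>k (x :: complex ^ ('n, 'd) multi_index option). 1 - (cmod (x $ k - x0 $ k))\<^sup>2 / (r k)\<^sup>2)"
    have r: "r k > 0" for k using R \<delta> by (cases k) (auto simp: r_def)
    have sub: "{x. \<forall>k. cmod (x $ k - x0 $ k) \<le> r k} \<subseteq> (\<Union>i. D i)"
    proof
      fix x assume "x \<in> {x. \<forall>k. cmod (x $ k - x0 $ k) \<le> r k}"
      then have "cmod (x $ Some \<alpha> - x0 $ Some \<alpha>) \<le> r (Some \<alpha>)" for \<alpha> by blast
      then show "x \<in> (\<Union>i. D i)" by (intro cyl) (simp add: r_def)
    qed
    have hol: "sep_holomorphic_on (\<lambda>x. F x $ l) (\<Union>i. D i)" for l
      unfolding F_def by (rule holomorphic_global_section)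
    have F0: "F x0 \<noteq> 0" and p: "p > 0" using nz N by (simp_all add: F_def p_def)
    have "\<exists>x. (\<forall>k. cmod (x $ k - x0 $ k) < r k) \<and> F x \<noteq> 0 \<and>
      q0 \<le> (\<Sum>l\<in>UNIV. (cmod (F x $ l))\<^sup>2) * (\<Prod>k\<in>UNIV. \<eta> k x) ^ p \<and>
      (\<forall>i. (\<forall>l. cmod (F x $ l) \<le> cmod (F x $ i)) \<longrightarrow>
        (\<forall>k l. cmod (partial_deriv k (\<lambda>x. F x $ l) x * F x $ i - F x $ l * partial_deriv k (\<lambda>x. F x $ i) x)
          \<le> c0 / (r k * \<eta> k x) * (cmod (F x $ i))\<^sup>2))"
      unfolding q0_def \<eta>_def c0_def by (rule polydisc_weighted_maximum[OF hol r sub F0 p])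
    then obtain x where x: "\<And>k. cmod (x $ k - x0 $ k) < r k" "F x \<noteq> 0"
      "q0 \<le> (\<Sum>l\<in>UNIV. (cmod (F x $ l))\<^sup>2) * (\<Prod>k\<in>UNIV. \<eta> k x) ^ p"
      and W: "\<And>i k l. (\<And>l. cmod (F x $ l) \<le> cmod (F x $ i)) \<Longrightarrow>
        cmod (partial_deriv k (\<lambda>x. F x $ l) x * F x $ i - F x $ l * partial_deriv k (\<lambda>x. F x $ i) x)
        \<le> c0 / (r k * \<eta> k x) * (cmod (F x $ i))\<^sup>2"
      by blast
    have xS: "x \<in> (\<Union>i. D i)" using x(1) by (intro subsetD[OF sub]) (auto intro: less_imp_le)
    have \<eta>: "0 < \<eta> k x" "\<eta> k x \<le> 1" for k
    proof -
      have "(cmod (x $ k - x0 $ k))\<^sup>2 < (r k)\<^sup>2" using x(1)[of k] by (intro power_strict_mono) auto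
      then show "0 < \<eta> k x" "\<eta> k x \<le> 1" using r[of k] by (simp_all add: \<eta>_def)
    qed
    \<comment> \<open>One quantity below every \<open>\<eta> k x\<close>, so that all derivative
      bounds can be stated with the same denominator.\<close>
    define E where "E = (\<Prod>k\<in>UNIV. \<eta> k x)"
    have E0: "E > 0" unfolding E_def using \<eta> by (intro prod_pos) auto
    have E\<eta>: "E \<le> \<eta> k x" for k
    proof -
      have "E = \<eta> k x * (\<Prod>k\<in>UNIV - {k}. \<eta> k x)" unfolding E_def by (rule prod.remove) auto
      also have "\<dots> \<le> \<eta> k x * 1"
        using \<eta> by (intro mult_left_mono prod_le_1) (auto intro: less_imp_le)
      finally show ?thesis by simp
    qed
    have E1: "E \<le> 1" using E\<eta>[of None] \<eta>[of None] by simp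
    \<comment> \<open>The largest entry selects the chart in which all coordinates of the lift have
      modulus at most 1.\<close>
    have "Max (range (\<lambda>l. cmod (F x $ l))) \<in> range (\<lambda>l. cmod (F x $ l))"
      by (rule Max_in) auto
    then obtain i where "Max (range (\<lambda>l. cmod (F x $ l))) = cmod (F x $ i)" by blast
    then have i: "cmod (F x $ l) \<le> cmod (F x $ i)" for l
      using Max_ge[of "range (\<lambda>l. cmod (F x $ l))" "cmod (F x $ l)"] by simp
    have Fi: "F x $ i \<noteq> 0"
    proof
      assume "F x $ i = 0"
      then have "F x $ l = 0" for l using i[of l] by simp
      then show False using x(2) by (simp add: vec_eq_iff)
    qed
    note chart = partial_chart_eq[OF xS Fi[unfolded F_def], folded F_def]
    have A1: "cmod (A i x $ l) \<le> 1" for l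
      unfolding chart(2) using i[of l] Fi by (simp add: norm_divide)
    have dA: "cmod (vec_partial k (A i) x $ l) \<le> c0 / (r k * E)" for k l
    proof -
      have "cmod (vec_partial k (A i) x $ l) \<le> c0 / (r k * \<eta> k x)"
        unfolding vec_partial_component chart(3) norm_divide norm_power
        using W[of i k l] i Fi by (simp add: pos_divide_le_eq)
      also have "\<dots> \<le> c0 / (r k * E)"
        using E\<eta>[of k] E0 r[of k] c0 by (intro divide_left_mono mult_left_mono mult_pos_pos) auto
      finally show ?thesis .
    qed
    have "cmod (F x $ l) \<le> Q / R / E ^ N" for l
    proof -
      have "cmod (F x $ l) \<le> fact CARD('n) * (c0 / (R * E)) * ((1 + CARD(('n, 'd) multi_index) * CARD('n)) * K * (M / E)) ^ (CARD('n) - 1)"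
        unfolding F_def
      proof (rule norm_global_section_le[OF chart(1) A1])
        show "cmod (vec_partial None (A i) x $ l) \<le> c0 / (R * E)" for l using dA[of None l] by (simp add: r_def)
        show "cmod (vec_partial (Some \<beta>) (A i) x $ l) \<le> M / E" for \<beta> l
        proof -
          have "c0 / \<delta> / E \<le> M / E" using E0 by (intro divide_right_mono) (auto simp: M_def)
          then show ?thesis using dA[of "Some \<beta>" l] by (simp add: r_def)
        qed
        show "1 \<le> M / E" using M1 E1 E0 by (simp add: field_simps)
        have "cmod (x $ Some \<alpha> - x0 $ Some \<alpha>) \<le> \<delta>" for \<alpha>
          using x(1)[of "Some \<alpha>"] by (simp add: r_def)
        then show "cmod (B k \<beta> l (equation_coeffs x)) \<le> K" if "k \<notin> {i1, i2, i3}" for k \<beta> l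
          using that by (rule K(3))
      qed (rule K)+
      also have "\<dots> = Q / R / E ^ N"
      proof -
        have "E ^ N = E * E ^ (N - 1)" using N by (simp add: power_eq_if)
        then show ?thesis using E0 R by (simp add: Q_def N_def power_mult_distrib power_divide)
      qed
      finally show ?thesis .
    qed
    then have "(cmod (F x $ l))\<^sup>2 \<le> (Q / R / E ^ N)\<^sup>2" for l by (intro power_mono) auto
    then have "(\<Sum>l\<in>UNIV. (cmod (F x $ l))\<^sup>2) \<le> (\<Sum>l\<in>(UNIV :: 'n set). (Q / R / E ^ N)\<^sup>2)" by (intro sum_mono)
    then have "(\<Sum>l\<in>UNIV. (cmod (F x $ l))\<^sup>2) * E ^ p \<le> (N * (Q / R / E ^ N)\<^sup>2) * E ^ p"
      using E0 by (intro mult_right_mono) (auto simp: N_def)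
    also have "\<dots> = N * Q\<^sup>2 / R\<^sup>2"
    proof -
      have "(Q / R / E ^ N)\<^sup>2 * E ^ p = (Q / R / E ^ N * E ^ N)\<^sup>2"
        unfolding p_def power_even_eq by (rule power_mult_distrib[symmetric])
      also have "Q / R / E ^ N * E ^ N = Q / R" using E0 by simp
      finally have "(Q / R / E ^ N)\<^sup>2 * E ^ p = Q\<^sup>2 / R\<^sup>2" by (simp only: power_divide)
      then show ?thesis unfolding mult.assoc by (simp only: times_divide_eq_right)
    qed
    finally show ?thesis using x(3) by (simp add: E_def)
  qed
  \<comment> \<open>Chosen so that \<open>q0 * R\<^sup>2\<close> exceeds
    \<open>N * Q\<^sup>2\<close> by \<open>q0\<close>.\<close>
  define R where "R = sqrt (N * Q\<^sup>2 / q0 + 1)"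
  have R2: "R\<^sup>2 = N * Q\<^sup>2 / q0 + 1" unfolding R_def using q0 by (intro real_sqrt_pow2 add_nonneg_nonneg) auto
  have "R > 0" unfolding R_def using q0 by (intro real_sqrt_gt_zero add_nonneg_pos) auto
  then have "q0 * R\<^sup>2 \<le> N * Q\<^sup>2" using bound[of R] by (simp add: pos_le_divide_eq)
  then show False unfolding R2 using q0 by (simp add: distrib_left)
qed

end

text \<open>If the velocity were nonzero at \<open>x0\<close>, position and velocity could be
  completed by kernel vectors and a transversal one to a basis. The kernel vectors are values of
  tangent fields, and the frame built from these fields has a section that does not vanish at
  \<open>x0\<close>.\<close>

theorem (in curve_family) vec_partial_None_eq_0:
  assumes x0: "x0 \<in> D i"
  shows "vec_partial None (A i) x0 = 0"
proof (rule ccontr)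
  assume nz: "vec_partial None (A i) x0 \<noteq> 0"
  define L u E where "L = A i x0" and "u = vec_partial None (A i) x0" and "E = (\<lambda>\<beta>. vec_partial (Some \<beta>) (A i) x0)"
  have Li: "L $ i = 1" using A_diag[OF x0] by (simp add: L_def)
  \<comment> \<open>In chart \<open>i\<close> the \<open>i\<close>-th coordinate is constantly 1.
    This separates the velocity from the position vector.\<close>
  have ui: "u $ i = 0"
  proof -
    have "partial_deriv None (\<lambda>y. A i y $ i) x0 = partial_deriv None (\<lambda>y. 1) x0"
      by (rule partial_deriv_cong[OF open_D x0]) (rule A_diag)
    then show ?thesis by (simp add: u_def partial_deriv_def)
  qed
  have ind: "vec.independent {L, u}"
  proof (rule vec.independent_insertI)
    show "vec.independent {u}" using nz by (simp add: u_def)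
    show "L \<notin> vec.span {u}"
    proof
      assume "L \<in> vec.span {u}"
      then obtain t where "L = t *s u" by (auto simp: vec.span_singleton)
      then show False using Li ui by simp
    qed
  qed
  have ne: "L \<noteq> u" using Li ui by auto
  have "pairing (grad i x0) (E (pure_power i)) \<noteq> 0" unfolding E_def using pairing_grad_pure[OF x0] by simp
  moreover have "pairing (grad i x0) L = 0" "pairing (grad i x0) u = 0"
    unfolding L_def u_def using pairing_grad_self[OF x0] pairing_grad_None[OF x0] by auto
  ultimately obtain i1 i2 i3 Y where Y: "i1 \<noteq> i2" "i1 \<noteq> i3" "i2 \<noteq> i3" "Y i1 = L" "Y i2 = u" "Y i3 = E (pure_power i)"
    "\<forall>k. k \<noteq> i3 \<longrightarrow> pairing (grad i x0) (Y k) = 0" "det (\<chi> k. Y k) \<noteq> 0"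
    using exists_completion_to_invertible[OF _ _ _ ind ne] by metis
  \<comment> \<open>The fields are selected by their values at \<open>x0\<close> alone, but they are
    defined everywhere and so give a global frame.\<close>
  have "\<exists>c B. k \<noteq> i3 \<longrightarrow> tangent_field i c B \<and> Y k = field_value i c B (equation_coeffs x0) L E" for k
  proof (cases "k = i3")
    case False
    then have "Y k \<in> field_values i (equation_coeffs x0) L E"
      using Li Y(7) pairing_grad_Some[OF x0] unfolding L_def E_def by (intro kernel_subset_field_values) auto
    then show ?thesis unfolding field_values_def by blast
  qed auto
  then obtain C B where CB: "\<And>k. k \<noteq> i3 \<Longrightarrow> tangent_field i (C k) (B k)"
    "\<And>k. k \<noteq> i3 \<Longrightarrow> Y k = field_value i (C k) (B k) (equation_coeffs x0) L E" by metis
  interpret framed_curve_family D A i i1 i2 i3 C B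
    by unfold_locales (use Y CB in auto)
  have "frame i i x0 k = Y k" for k
    using Y CB by (auto simp: frame_def L_def u_def E_def)
  then have "global_section x0 $ i = det (\<chi> k. Y k)"
    using A_diag[OF x0] by (simp add: global_section_eq[OF x0] local_section_def)
  moreover have "global_section x0 = 0" using x0 by (intro global_section_eq_0) blast
  ultimately show False using Y(8) by simp
qed

section \<open>Charts of the universal family\<close>

lemma proj_rel_refl_iff: "proj_rel v v \<longleftrightarrow> v \<noteq> 0"
  by (auto simp: proj_rel_def intro!: exI[of _ 1])

lemma proj_cases:
  obtains v where "v \<noteq> 0" "p = abs_proj v"
  using Quotient3_abs_rep[OF Quotient3_proj] Quotient3_rep_reflp[OF Quotient3_proj] proj_rel_refl_iff by metis

lemma coord_nonzero_abs_proj: "v \<noteq> 0 \<Longrightarrow> coord_nonzero i (abs_proj v) \<longleftrightarrow> v $ i \<noteq> 0"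
  by (simp add: coord_nonzero.abs_eq proj_rel_refl_iff)

lemma aff_coord_abs_proj: "v \<noteq> 0 \<Longrightarrow> aff_coord i (abs_proj v) = (\<chi> l. v $ l / v $ i)"
  by (simp add: aff_coord.abs_eq proj_rel_refl_iff)

lemma aff_coord_self: "coord_nonzero i p \<Longrightarrow> aff_coord i p $ i = 1"
  by (cases p rule: proj_cases) (simp add: coord_nonzero_abs_proj aff_coord_abs_proj)

lemma coord_nonzero_iff_aff_coord: "coord_nonzero i p \<Longrightarrow> coord_nonzero k p \<longleftrightarrow> aff_coord i p $ k \<noteq> 0"
  by (cases p rule: proj_cases) (simp add: coord_nonzero_abs_proj aff_coord_abs_proj)

lemma aff_coord_change:
  "coord_nonzero i p \<Longrightarrow> coord_nonzero k p \<Longrightarrow> aff_coord k p = inverse (aff_coord i p $ k) *s aff_coord i p"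
  by (cases p rule: proj_cases) (simp add: coord_nonzero_abs_proj aff_coord_abs_proj vec_eq_iff)

lemma abs_proj_aff_coord:
  assumes "coord_nonzero i p"
  shows "abs_proj (aff_coord i p) = p"
proof -
  have "(\<chi> l. if l = i then 1 else aff_coord i p $ l) = aff_coord i p"
    using aff_coord_self[OF assms] by (simp add: vec_eq_iff)
  then show ?thesis using aff_point_aff_coord[OF assms] by (simp add: aff_point_def)
qed

lemma aff_coord_nonzero: "coord_nonzero i p \<Longrightarrow> aff_coord i p \<noteq> 0"
  using aff_coord_self[of i p] by auto

lemma aff_point_normalized:
  assumes "v $ j \<noteq> 0"
  shows "aff_point j (\<chi> l. v $ l / v $ j) = abs_proj v"
proof -
  have "v \<noteq> 0" using assms by auto
  then show ?thesis
    using aff_point_aff_coord[of j "abs_proj v"] assms by (simp add: coord_nonzero_abs_proj aff_coord_abs_proj)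
qed

lemma hypersurface_eq_aff_coord:
  assumes "on_hypersurface p (abs_proj a)" "a \<noteq> 0" "coord_nonzero i p"
  shows "hypersurface_eq (aff_coord i p) a = 0"
proof -
  have "on_hypersurface (abs_proj (aff_coord i p)) (abs_proj a)"
    using assms abs_proj_aff_coord by metis
  moreover have "proj_rel (aff_coord i p) (aff_coord i p)" "proj_rel a a"
    using assms aff_coord_nonzero by (simp_all add: proj_rel_refl_iff)
  ultimately show ?thesis by (simp only: on_hypersurface.abs_eq)
qed

lemma open_coord_nonzero: "open {p :: 'n::finite proj. coord_nonzero i p}"
proof -
  have "{v :: complex ^ 'n. v \<noteq> 0 \<and> abs_proj v \<in> {p. coord_nonzero i p}} = {v. v $ i \<noteq> 0}"
    by (auto simp: coord_nonzero_abs_proj) (metis coord_nonzero_abs_proj zero_index)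
  moreover have "open {v :: complex ^ 'n. v $ i \<noteq> 0}"
    by (intro open_Collect_neq continuous_intros)
  ultimately show ?thesis by (simp add: open_proj_def)
qed

lemma continuous_on_abs_proj: "continuous_on {v. v \<noteq> 0} (abs_proj :: complex ^ 'n::finite \<Rightarrow> 'n proj)"
proof -
  have "open {v :: complex ^ 'n. v \<noteq> 0}"
    by (intro open_Collect_neq continuous_intros)
  moreover have "open (abs_proj -` B \<inter> {v :: complex ^ 'n. v \<noteq> 0})" if "open B" for B
    using that unfolding open_proj_def by (simp add: Collect_conj_eq[symmetric] vimage_def Int_def conj_commute)
  ultimately show ?thesis by (simp add: continuous_on_open_vimage)
qed

text \<open>The total derivative is only real linear by itself. The hypothesis \<open>lin\<close>
  makes the derivative along a holomorphic curve a complex one.\<close>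

lemma has_field_derivative_along_curve:
  fixes G :: "complex \<times> (complex ^ 'm::finite) \<Rightarrow> complex ^ 'l::finite"
  assumes G: "(G has_derivative D) (at (p 0, q 0))"
    and lin: "\<And>c z w. D (c * z, c *s w) = c *s D (z, w)"
    and p: "(p has_field_derivative u) (at 0)"
    and q: "\<And>\<alpha>. ((\<lambda>c. q c $ \<alpha>) has_field_derivative v $ \<alpha>) (at 0)"
  shows "((\<lambda>c. G (p c, q c) $ s) has_field_derivative D (u, v) $ s) (at 0)"
proof -
  have "(q has_derivative (\<lambda>c. c *s v)) (at 0)"
    unfolding has_derivative_componentwise_within[of q]
  proof
    fix b :: "complex ^ 'm" assume "b \<in> Basis"
    then obtain \<alpha> e where b: "b = axis \<alpha> e" by (auto simp: Basis_vec_def)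
    have "((\<lambda>c. q c $ \<alpha>) has_derivative (\<lambda>c. c * v $ \<alpha>)) (at 0)"
      using q[of \<alpha>] unfolding has_field_derivative_def by (subst mult.commute)
    then have "((\<lambda>c. q c $ \<alpha> \<bullet> e) has_derivative (\<lambda>c. (c * v $ \<alpha>) \<bullet> e)) (at 0)"
      by (rule has_derivative_inner_left)
    then show "((\<lambda>c. q c \<bullet> b) has_derivative (\<lambda>c. (c *s v) \<bullet> b)) (at 0)"
      by (simp add: b inner_axis)
  qed
  moreover have "(p has_derivative (\<lambda>c. c * u)) (at 0)"
    using p unfolding has_field_derivative_def by (subst mult.commute)
  ultimately have "((\<lambda>c. (p c, q c)) has_derivative (\<lambda>c. (c * u, c *s v))) (at 0)"
    by (intro has_derivative_Pair)
  from diff_chain_at[OF this G]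
  have "((\<lambda>c. G (p c, q c)) has_derivative (\<lambda>c. D (c * u, c *s v))) (at 0)" by (simp add: o_def)
  then have "((\<lambda>c. G (p c, q c) $ s) has_derivative (\<lambda>c. D (c * u, c *s v) $ s)) (at 0)"
    by (rule bounded_linear.has_derivative[OF bounded_linear_vec_nth])
  then show ?thesis by (simp add: has_field_derivative_def lin mult_commute_abs)
qed

text \<open>
  In terms of the homogeneous coordinates of the coefficient space, so that all of the directions
  \<open>\<partial>\<^sub>\<alpha>\<close> are available.
\<close>

definition family_point :: "(complex \<times> 'm::finite proj \<Rightarrow> 'n::finite proj \<times> 'm proj) \<Rightarrow> complex ^ 'm option \<Rightarrow> 'n proj" where
  "family_point \<Phi> x = fst (\<Phi> (x $ None, abs_proj (equation_coeffs x)))"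

definition family_domain ::
  "(complex \<times> 'm::finite proj \<Rightarrow> 'n::finite proj \<times> 'm proj) \<Rightarrow> 'm proj set \<Rightarrow> 'n \<Rightarrow> (complex ^ 'm option) set" where
  "family_domain \<Phi> U i = {x. equation_coeffs x \<noteq> 0 \<and> abs_proj (equation_coeffs x) \<in> U \<and> coord_nonzero i (family_point \<Phi> x)}"

lemma open_family_domain:
  fixes \<Phi> :: "complex \<times> 'm::finite proj \<Rightarrow> 'n::finite proj \<times> 'm proj"
  assumes U: "open U" and cont: "continuous_on (UNIV \<times> U) \<Phi>"
  shows "open (family_domain \<Phi> U i)"
proof -
  define T where "T = {x :: complex ^ 'm option. equation_coeffs x \<noteq> 0}"
  define V where "V = (\<lambda>x :: complex ^ 'm option. abs_proj (equation_coeffs x)) -` U \<inter> T"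
  have T: "open T" unfolding T_def by (intro open_Collect_neq continuous_intros)
  have ct: "continuous_on T (\<lambda>x. abs_proj (equation_coeffs x))"
    by (rule continuous_on_compose2[OF continuous_on_abs_proj continuous_on_equation_coeffs]) (auto simp: T_def)
  then have V: "open V" unfolding V_def using U T by (metis continuous_on_open_vimage)
  have "continuous_on V (\<lambda>x. (x $ None, abs_proj (equation_coeffs x)))"
    using continuous_on_subset[OF ct] by (intro continuous_intros) (auto simp: V_def)
  then have "continuous_on V (\<lambda>x. \<Phi> (x $ None, abs_proj (equation_coeffs x)))"
    by (rule continuous_on_compose2[OF cont]) (auto simp: V_def)
  then have "continuous_on V (family_point \<Phi>)"
    unfolding family_point_def by (rule continuous_on_fst)
  then have "open (family_point \<Phi> -` {p. coord_nonzero i p} \<inter> V)"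
    using V open_coord_nonzero by (metis continuous_on_open_vimage)
  moreover have "family_point \<Phi> -` {p. coord_nonzero i p} \<inter> V = family_domain \<Phi> U i"
    by (auto simp: family_domain_def V_def T_def)
  ultimately show ?thesis by simp
qed

lemma sep_holomorphic_on_family_chart:
  fixes \<Phi> :: "complex \<times> 'm::finite proj \<Rightarrow> 'n::finite proj \<times> 'm proj"
  assumes U: "open U" and hol: "holomorphic_map_on \<Phi> (UNIV \<times> U)"
  shows "sep_holomorphic_on (\<lambda>x. aff_coord i (family_point \<Phi> x) $ l) (family_domain \<Phi> U i)"
proof (rule sep_holomorphic_on_local)
  fix x0 assume x0: "x0 \<in> family_domain \<Phi> U i"
  then obtain j where j: "x0 $ Some j \<noteq> 0"
    by (auto simp: family_domain_def vec_eq_iff)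
  define V where "V = family_domain \<Phi> U i \<inter> {x. x $ Some j \<noteq> 0}"
  have V: "open V" unfolding V_def
    using hol by (intro open_Int open_family_domain[OF U] open_Collect_neq continuous_intros) (simp add: holomorphic_map_on_def)
  define q where "q = (\<lambda>x :: complex ^ 'm option. \<chi> \<alpha>. x $ Some \<alpha> / x $ Some j)"
  have q: "aff_point j (q x) = abs_proj (equation_coeffs x)" "q x = aff_coord j (abs_proj (equation_coeffs x))" if "x \<in> V" for x
    using that aff_point_normalized[of "equation_coeffs x" j]
    by (auto simp: V_def q_def family_domain_def aff_coord_abs_proj)
  \<comment> \<open>The chart \<open>k\<close> on the second factor may vary with \<open>x\<close>.
    This does no harm, as the \<open>Inl\<close> components of \<open>local_expr\<close> do not
    depend on it.\<close>
  have diff: "\<exists>k D. (local_expr j i k \<Phi> has_derivative D) (at (x $ None, q x)) \<and> (\<forall>c z w. D (c * z, c *s w) = c *s D (z, w))"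
    if x: "x \<in> V" for x
  proof -
    let ?t = "abs_proj (equation_coeffs x)"
    obtain k where "coord_nonzero k (snd (\<Phi> (x $ None, ?t)))" using coord_nonzero_exists by blast
    then have "charts_at j i k \<Phi> (x $ None) ?t"
      using x by (auto simp: charts_at_def V_def family_domain_def family_point_def coord_nonzero_abs_proj)
    moreover have "?t \<in> U" using x by (simp add: V_def family_domain_def)
    ultimately have "complex_differentiable_at (local_expr j i k \<Phi>) (x $ None, aff_coord j ?t)"
      using hol unfolding holomorphic_map_on_def by blast
    then show ?thesis unfolding complex_differentiable_at_def q(2)[OF x] by blast
  qed
  have expr: "aff_coord i (family_point \<Phi> x) $ l = local_expr j i k \<Phi> (x $ None, q x) $ Inl l" if "x \<in> V" for x k
    using q(1)[OF that] by (simp add: local_expr_def family_point_def)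
  have "sep_holomorphic_on (\<lambda>x. aff_coord i (family_point \<Phi> x) $ l) V"
    unfolding sep_holomorphic_on_def
  proof (intro conjI ballI allI)
    have cq: "continuous_on V (\<lambda>x. (x $ None, q x))"
      unfolding q_def by (intro continuous_intros) (auto simp: V_def)
    show "continuous_on V (\<lambda>x. aff_coord i (family_point \<Phi> x) $ l)"
    proof (rule continuous_at_imp_continuous_on, rule ballI)
      fix x assume x: "x \<in> V"
      then obtain k D where "(local_expr j i k \<Phi> has_derivative D) (at (x $ None, q x))" using diff by blast
      then have "isCont (local_expr j i k \<Phi>) (x $ None, q x)" by (rule has_derivative_continuous)
      moreover have "isCont (\<lambda>x. (x $ None, q x)) x"
        using cq V x by (simp add: continuous_on_eq_continuous_at)
      ultimately have "isCont (\<lambda>x. local_expr j i k \<Phi> (x $ None, q x)) x"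
        using isCont_o2[of x "\<lambda>x. (x $ None, q x)" "local_expr j i k \<Phi>"] by simp
      then have "isCont (\<lambda>x. local_expr j i k \<Phi> (x $ None, q x) $ Inl l) x"
        by (rule continuous_component)
      moreover have "\<forall>\<^sub>F y in nhds x. aff_coord i (family_point \<Phi> y) $ l = local_expr j i k \<Phi> (y $ None, q y) $ Inl l"
        unfolding eventually_nhds using V x expr by blast
      ultimately show "isCont (\<lambda>x. aff_coord i (family_point \<Phi> x) $ l) x"
        by (subst isCont_cong)
    qed
    fix x m assume x: "x \<in> V"
    then obtain k D where D: "(local_expr j i k \<Phi> has_derivative D) (at (x $ None, q x))"
      "\<And>c z w. D (c * z, c *s w) = c *s D (z, w)" using diff by blast
    have xj: "x $ Some j \<noteq> 0" using x by (simp add: V_def)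
    have comp: "((\<lambda>c. (x + axis m c) $ r) has_field_derivative (if r = m then 1 else 0)) (at 0)" for r
      by (auto simp: axis_def intro!: derivative_eq_intros)
    \<comment> \<open>The derivative of the affine coordinates
      \<open>x $ Some \<alpha> / x $ Some j\<close> in direction \<open>m\<close>, by the quotient
      rule.\<close>
    define v :: "complex ^ 'm" where "v = (\<chi> \<alpha>. ((if Some \<alpha> = m then 1 else 0) * x $ Some j - x $ Some \<alpha> * (if Some j = m then 1 else 0)) / (x $ Some j * x $ Some j))"
    have "((\<lambda>c. local_expr j i k \<Phi> ((x + axis m c) $ None, q (x + axis m c)) $ Inl l) has_field_derivative
      D (if None = m then 1 else 0, v) $ Inl l) (at 0)"
    proof (rule has_field_derivative_along_curve[OF _ D(2) comp])
      show "(local_expr j i k \<Phi> has_derivative D) (at ((x + axis m 0) $ None, q (x + axis m 0)))" using D(1) by simp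
      show "((\<lambda>c. q (x + axis m c) $ \<alpha>) has_field_derivative v $ \<alpha>) (at 0)" for \<alpha>
        using DERIV_divide[OF comp[of "Some \<alpha>"] comp[of "Some j"]] xj by (simp add: q_def v_def)
    qed
    moreover have "\<forall>\<^sub>F c in nhds 0. local_expr j i k \<Phi> ((x + axis m c) $ None, q (x + axis m c)) $ Inl l
        = aff_coord i (family_point \<Phi> (x + axis m c)) $ l"
      using eventually_shift_axis[OF V x, of m] by eventually_elim (rule expr[symmetric])
    ultimately have "((\<lambda>c. aff_coord i (family_point \<Phi> (x + axis m c)) $ l) has_field_derivative
      D (if None = m then 1 else 0, v) $ Inl l) (at 0)"
      by (subst (asm) DERIV_cong_ev[OF refl _ refl])
    then show "(\<lambda>c. aff_coord i (family_point \<Phi> (x + axis m c)) $ l) field_differentiable at 0"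
      unfolding field_differentiable_def by blast
  qed
  then show "\<exists>V h. open V \<and> x0 \<in> V \<and> sep_holomorphic_on h V \<and> (\<forall>y\<in>V. aff_coord i (family_point \<Phi> y) $ l = h y)"
    using V x0 j by (intro exI[of _ V]) (auto simp: V_def)
qed

lemma curve_family_charts:
  fixes U :: "('n::finite, 'd::finite) multi_index proj set"
    and \<Phi> :: "complex \<times> ('n, 'd) multi_index proj \<Rightarrow> 'n proj \<times> ('n, 'd) multi_index proj"
  assumes U: "open U" and hol: "holomorphic_map_on \<Phi> (UNIV \<times> U)"
    and fib: "\<forall>t\<in>U. \<Phi> ` (UNIV \<times> {t}) \<subseteq> fiber t"
    and deg: "CARD('d) \<ge> 2 * (CARD('n) - 1)"
  shows "curve_family (family_domain \<Phi> U) (\<lambda>i x. aff_coord i (family_point \<Phi> x))"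
proof
  show "open (family_domain \<Phi> U i)" for i
    using hol by (intro open_family_domain[OF U]) (simp add: holomorphic_map_on_def)
  show "sep_holomorphic_on (\<lambda>x. aff_coord i (family_point \<Phi> x) $ l) (family_domain \<Phi> U i)" for i l
    by (rule sep_holomorphic_on_family_chart[OF U hol])
  show "aff_coord i (family_point \<Phi> x) $ i = 1" if "x \<in> family_domain \<Phi> U i" for x i
    using that by (simp add: family_domain_def aff_coord_self)
  show "x \<in> family_domain \<Phi> U k \<longleftrightarrow> aff_coord i (family_point \<Phi> x) $ k \<noteq> 0" if "x \<in> family_domain \<Phi> U i" for x i k
    using that by (simp add: family_domain_def coord_nonzero_iff_aff_coord[of i])
  show "aff_coord k (family_point \<Phi> x) = inverse (aff_coord i (family_point \<Phi> x) $ k) *s aff_coord i (family_point \<Phi> x)"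
    if "x \<in> family_domain \<Phi> U i" "x \<in> family_domain \<Phi> U k" for x i k
    using that by (intro aff_coord_change) (simp_all add: family_domain_def)
  show "hypersurface_eq (aff_coord i (family_point \<Phi> x)) (equation_coeffs x) = 0" if "x \<in> family_domain \<Phi> U i" for x i
  proof (rule hypersurface_eq_aff_coord)
    let ?t = "abs_proj (equation_coeffs x)"
    have "?t \<in> U" using that by (simp add: family_domain_def)
    then have "\<Phi> (x $ None, ?t) \<in> fiber ?t" using fib by blast
    then show "on_hypersurface (family_point \<Phi> x) ?t"
      by (auto simp: fiber_def universal_family_def family_point_def)
  qed (use that in \<open>auto simp: family_domain_def\<close>)
  \<comment> \<open>Moving along the curve keeps the coefficients, but the nonvanishing coordinate
    may change; hence the union over the charts.\<close>
  show "x + axis None c \<in> (\<Union>i. family_domain \<Phi> U i)" if "x \<in> (\<Union>i. family_domain \<Phi> U i)" for x c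
    using that coord_nonzero_exists by (auto simp: family_domain_def equation_coeffs_shift_None)
  show "CARD('d) \<ge> 2 * (CARD('n) - 1)" by (rule deg)
qed

section \<open>Counting the directions on which the differential can be nonzero\<close>

theorem mainTheorem1:
  fixes n d N :: nat
    and U :: "('n::finite, 'd::finite) multi_index proj set"
    and \<Phi> :: "complex \<times> ('n, 'd) multi_index proj \<Rightarrow> 'n proj \<times> ('n, 'd) multi_index proj"
  assumes "CARD('n) = n + 1" and "n \<ge> 1"
    and "CARD('d) = d" and "d \<ge> 1"
    and "N = ((n + d) choose d) - 1"
    and "open U"
    and "holomorphic_map_on \<Phi> (UNIV \<times> U)"
    and "\<Phi> ` (UNIV \<times> U) \<subseteq> universal_family"
    and "\<forall>t\<in>U. \<Phi> ` (UNIV \<times> {t}) \<subseteq> fiber t"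
    and "d \<ge> 2 * n"
  shows "\<forall>z. \<forall>t\<in>U. \<forall>j i k. charts_at j i k \<Phi> z t \<longrightarrow> differential_rank j i k \<Phi> z t < N + 1"
proof (intro allI ballI impI)
  fix z t j i k
  assume t: "t \<in> U" and ch: "charts_at j i k \<Phi> z t"
  interpret curve_family "family_domain \<Phi> U" "\<lambda>i x. aff_coord i (family_point \<Phi> x)"
    using assms by (intro curve_family_charts) auto
  define G where "G = local_expr j i k \<Phi>"
  define w where "w = aff_coord j t"
  have j: "coord_nonzero j t" using ch by (simp add: charts_at_def)
  have w: "aff_point j w = t" "abs_proj w = t" "w \<noteq> 0"
    unfolding w_def using aff_point_aff_coord[OF j] abs_proj_aff_coord[OF j] aff_coord_nonzero[OF j] by auto
  obtain D where D: "(G has_derivative D) (at (z, w))" and lin: "\<And>c z w. D (c * z, c *s w) = c *s D (z, w)"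
    using assms(7) t ch unfolding holomorphic_map_on_def complex_differentiable_at_def G_def w_def by blast
  have slice: "((\<lambda>c. G (z + c * u, w + c *s v) $ s) has_field_derivative D (u, v) $ s) (at 0)" for u v s
    using D by (intro has_field_derivative_along_curve[OF _ lin]) (auto intro!: derivative_eq_intros)
  \<comment> \<open>The \<open>Inl\<close> components vanish because the velocity does, the
    \<open>Inr\<close> components because the curve stays in one fiber.\<close>
  have D1: "D (1, 0) = 0"
  proof -
    have "D (1, 0) $ s = 0" for s
    proof (cases s)
      case (Inl l)
      \<comment> \<open>The pair \<open>(z, t)\<close> with \<open>t\<close> represented by the
        coefficient vector whose entry \<open>j\<close> is 1.\<close>
      define x where "x = (\<chi> m. case m of None \<Rightarrow> z | Some \<alpha> \<Rightarrow> w $ \<alpha>)"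
      have x: "x $ None = z" "equation_coeffs x = w" by (simp_all add: x_def vec_eq_iff)
      then have xD: "x \<in> family_domain \<Phi> U i"
        using t w ch by (simp add: family_domain_def family_point_def charts_at_def)
      have "((\<lambda>c. aff_coord i (family_point \<Phi> (x + axis None c)) $ l) has_field_derivative
        vec_partial None (\<lambda>x. aff_coord i (family_point \<Phi> x)) x $ l) (at 0)"
        using sep_holomorphic_onD[OF holomorphic_A xD] by simp
      moreover have "G (z + c * 1, w + c *s 0) $ s = aff_coord i (family_point \<Phi> (x + axis None c)) $ l" for c
        by (simp add: family_point_def equation_coeffs_shift_None x w G_def local_expr_def Inl)
      from slice[of 1 0 s, unfolded this]
      have "((\<lambda>c. aff_coord i (family_point \<Phi> (x + axis None c)) $ l) has_field_derivative D (1, 0) $ s) (at 0)" .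
      ultimately have "D (1, 0) $ s = vec_partial None (\<lambda>x. aff_coord i (family_point \<Phi> x)) x $ l"
        by (blast intro: DERIV_unique)
      then show ?thesis unfolding vec_partial_None_eq_0[OF xD] by simp
    next
      case (Inr l)
      have "snd (\<Phi> (z', t)) = t" for z'
      proof -
        have "\<Phi> (z', t) \<in> fiber t" using assms(9) t by blast
        then show ?thesis by (simp add: fiber_def)
      qed
      then have "G (z + c * 1, w + c *s 0) $ s = aff_coord k t $ l" for c
        by (simp add: G_def local_expr_def Inr w)
      from slice[of 1 0 s, unfolded this] show ?thesis by (rule DERIV_unique[OF _ DERIV_const])
    qed
    then show ?thesis by (simp add: vec_eq_iff)
  qed
  \<comment> \<open>\<open>aff_point j\<close> overwrites the entry \<open>j\<close>, so the
    differential is zero in this dummy direction.\<close>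
  have Dj: "D (0, axis j 1) = 0"
  proof -
    have "aff_point j (w + c *s axis j 1) = aff_point j w" for c
      unfolding aff_point_def by (rule arg_cong[of _ _ abs_proj]) (auto simp: vec_eq_iff axis_def)
    then have const: "G (z + c * 0, w + c *s axis j 1) $ s = G (z, w) $ s" for c s
      by (simp add: G_def local_expr_def)
    have "D (0, axis j 1) $ s = 0" for s
      using slice[of 0 "axis j 1" s, unfolded const] by (rule DERIV_unique[OF _ DERIV_const])
    then show ?thesis by (simp add: vec_eq_iff)
  qed
  \<comment> \<open>With the directions \<open>z\<close> and \<open>j\<close> killed, the images of
    the other \<open>N\<close> coefficient directions span the range.\<close>
  define W where "W = (\<lambda>\<alpha>. D (0, axis \<alpha> 1)) ` (UNIV - {j})"
  have add: "D (a + b) = D a + D b" for a b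
    using has_derivative_linear[OF D] by (rule linear_add)
  have "range D \<subseteq> vec.span W"
  proof
    fix y assume "y \<in> range D"
    then obtain u v where y: "y = D (u, v)" by auto
    have "D (u, 0) = u *s D (1, 0)" using lin[of u 1 0] by simp
    then have Du: "D (u, 0) = 0" using D1 by simp
    have sumD: "D (0, \<Sum>\<alpha>\<in>I. v $ \<alpha> *s axis \<alpha> 1) = (\<Sum>\<alpha>\<in>I. v $ \<alpha> *s D (0, axis \<alpha> 1))" for I
    proof (induction I rule: infinite_finite_induct)
      case (insert \<beta> I)
      then show ?case using add[of "(0, v $ \<beta> *s axis \<beta> 1)" "(0, \<Sum>\<alpha>\<in>I. v $ \<alpha> *s axis \<alpha> 1)"]
          lin[of "v $ \<beta>" 0 "axis \<beta> 1"] by simp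
    qed (use lin[of 0 0 0] in \<open>simp_all add: zero_prod_def\<close>)
    have "y = D (u, 0) + D (0, v)" unfolding y using add[of "(u, 0)" "(0, v)"] by simp
    also have "\<dots> = D (0, \<Sum>\<alpha>\<in>UNIV. v $ \<alpha> *s axis \<alpha> 1)" using Du by (simp add: basis_expansion)
    also have "\<dots> = (\<Sum>\<alpha>\<in>UNIV. v $ \<alpha> *s D (0, axis \<alpha> 1))" by (rule sumD)
    also have "\<dots> \<in> vec.span W"
    proof (intro vec.span_sum vec.span_scale)
      fix \<alpha> show "D (0, axis \<alpha> 1) \<in> vec.span W"
        using Dj by (cases "\<alpha> = j") (auto simp: W_def vec.span_zero intro: vec.span_base)
    qed
    finally show "y \<in> vec.span W" .
  qed
  then have "vec.dim (range D) \<le> card W" by (rule vec.dim_le_card) (simp add: W_def)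
  also have "\<dots> \<le> card (UNIV - {j})" unfolding W_def by (rule card_image_le) simp
  also have "\<dots> = CARD(('n, 'd) multi_index) - 1" by (simp add: card_Diff_subset)
  also have "\<dots> = N" using card_multi_index[where 'n='n and 'd='d, of n] assms(1,3,5) by simp
  finally show "differential_rank j i k \<Phi> z t < N + 1"
    using frechet_derivative_at[OF D] by (simp add: differential_rank_def G_def w_def)
qed

end
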